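(* Let $1<p\le N$, $N\ge2$, let $q_*$ be the critical exponent defined in the context, and assume $q_*<q<p\le N$. Let $\Omega\subset\mathbb{R}^N$ be a $C^2$ bounded domain with $0\in\partial\Omega$. If $u$ is a nonnegative solution of $$-\Delta_pu+|\nabla u|^q=0\quad\text{in }\Omega$$ which belongs to $C^1(\overline\Omega\setminus\{0\})$ and vanishes on $\partial\Omega\setminus\{0\}$, then $u$ is identically $0$.
   Context: $\Delta_pu=\mathrm{div}(|\nabla u|^{p-2}\nabla u)$; solutions are $C^1$ functions satisfying the equation in the weak sense. Let $\mathbb{R}^N_+=\{x=(x',x_N):x'\in\mathbb{R}^{N-1},x_N>0\}$, $S^{N-1}$ the unit sphere and $S^{N-1}_+=S^{N-1}\cap\mathbb{R}^N_+$; $\nabla'$, $\mathrm{div}'$ are the tangential gradient and divergence on $S^{N-1}$. The exponent $\beta_*>0$ is the unique positive real number for which there exists a positive function $\psi\in C^2(\overline{S^{N-1}_+})$ (unique up to a multiplicative constant) with $$-\mathrm{div}'\left((\beta_*^2\psi^2+|\nabla'\psi|^2)^{\frac{p-2}{2}}\nabla'\psi\right)-\beta_*\Lambda_{\beta_*}(\beta_*^2\psi^2+|\nabla'\psi|^2)^{\frac{p-2}{2}}\psi=0\ \text{ in }S^{N-1}_+,\qquad \psi=0\ \text{ on }\partial S^{N-1}_+,$$ where $\Lambda_{\beta_*}=\beta_*(p-1)+p-N$. The critical exponent is $q_*:=p-\frac{\beta_*}{\beta_*+1}$. *)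

theory Defs
  imports "HOL-Analysis.Analysis"
begin

definition grad :: "(real ^ 'n \<Rightarrow> real) \<Rightarrow> real ^ 'n \<Rightarrow> real ^ 'n" where
  "grad f x = (\<chi> i. frechet_derivative f (at x) (axis i 1))"

definition divergence :: "(real ^ 'n \<Rightarrow> real ^ 'n) \<Rightarrow> real ^ 'n \<Rightarrow> real" where
  "divergence F x = (\<Sum>i\<in>UNIV. frechet_derivative F (at x) (axis i 1) $ i)"


text \<open>Functions of class C^m on an open set \<open>U\<close>, all of whose partial derivatives of order at
  most \<open>m\<close> extend continuously from \<open>U\<close> to \<open>S\<close>, where \<open>U \<subseteq> S \<subseteq> closure U\<close>. With \<open>S = U\<close>
  this is C^m of the open set \<open>U\<close>; with \<open>S = closure U\<close> it is C^m up to the boundary.\<close>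

definition extends_continuously ::
    "(real ^ 'n) set \<Rightarrow> (real ^ 'n) set \<Rightarrow> (real ^ 'n \<Rightarrow> real) \<Rightarrow> bool" where
  "extends_continuously U S f \<longleftrightarrow> (\<exists>g. continuous_on S g \<and> (\<forall>x\<in>U. g x = f x))"

primrec derivs_extend ::
    "nat \<Rightarrow> (real ^ 'n) set \<Rightarrow> (real ^ 'n) set \<Rightarrow> (real ^ 'n \<Rightarrow> real) \<Rightarrow> bool" where
  "derivs_extend 0 U S f \<longleftrightarrow> extends_continuously U S f"
| "derivs_extend (Suc m) U S f \<longleftrightarrow>
     extends_continuously U S f \<and> f differentiable_on U \<and>
     (\<forall>i. derivs_extend m U S (\<lambda>x. grad f x $ i))"

definition Ck_upto ::
    "nat \<Rightarrow> (real ^ 'n) set \<Rightarrow> (real ^ 'n) set \<Rightarrow> (real ^ 'n \<Rightarrow> real) \<Rightarrow> bool" where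
  "Ck_upto m U S f \<longleftrightarrow> continuous_on S f \<and> derivs_extend m U S f"

abbreviation Ck_on :: "nat \<Rightarrow> (real ^ 'n) set \<Rightarrow> (real ^ 'n \<Rightarrow> real) \<Rightarrow> bool" where
  "Ck_on m U \<equiv> Ck_upto m U U"


text \<open>Near each boundary point the domain lies on one side of the graph of a C^2 function of the
  remaining \<open>N - 1\<close> coordinates, after relabelling (\<open>i\<close>) and reorienting (\<open>s\<close>) the axes. The
  function \<open>\<gamma>\<close> is defined on the whole space but does not depend on the coordinate \<open>i\<close>.\<close>

definition C2_boundary :: "(real ^ 'n) set \<Rightarrow> bool" where
  "C2_boundary \<Omega> \<longleftrightarrow>
     (\<forall>z\<in>frontier \<Omega>. \<exists>r>0. \<exists>i. \<exists>s\<in>{1, -1}. \<exists>\<gamma>.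
        Ck_on 2 UNIV \<gamma> \<and>
        (\<forall>x y. (\<forall>j. j \<noteq> i \<longrightarrow> x $ j = y $ j) \<longrightarrow> \<gamma> x = \<gamma> y) \<and>
        \<Omega> \<inter> ball z r = {x \<in> ball z r. s * x $ i > \<gamma> x})"

definition C2_bounded_domain :: "(real ^ 'n) set \<Rightarrow> bool" where
  "C2_bounded_domain \<Omega> \<longleftrightarrow>
     open \<Omega> \<and> connected \<Omega> \<and> \<Omega> \<noteq> {} \<and> bounded \<Omega> \<and> C2_boundary \<Omega>"


definition C1_test_function :: "(real ^ 'n) set \<Rightarrow> (real ^ 'n \<Rightarrow> real) \<Rightarrow> bool" where
  "C1_test_function \<Omega> \<phi> \<longleftrightarrow>
     Ck_on 1 UNIV \<phi> \<and> compact (closure {x. \<phi> x \<noteq> 0}) \<and> closure {x. \<phi> x \<noteq> 0} \<subseteq> \<Omega>"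

text \<open>C^1 weak solutions of \<open>- \<Delta>\<^sub>p u + |\<nabla>u|^q = 0\<close> in \<open>\<Omega>\<close>. Since \<open>0 powr a = 0\<close>, the vector
  \<open>norm g powr (p - 2) *\<^sub>R g\<close> is the continuous extension of \<open>|g|^(p - 2) g\<close> to \<open>g = 0\<close>
  when \<open>p > 1\<close>.\<close>

definition weak_solution ::
    "real \<Rightarrow> real \<Rightarrow> (real ^ 'n) set \<Rightarrow> (real ^ 'n \<Rightarrow> real) \<Rightarrow> bool" where
  "weak_solution p q \<Omega> u \<longleftrightarrow>
     Ck_on 1 \<Omega> u \<and>
     (\<forall>\<phi>. C1_test_function \<Omega> \<phi> \<longrightarrow>
        (LINT x:\<Omega>|lborel.
           (norm (grad u x) powr (p - 2) *\<^sub>R grad u x) \<bullet> grad \<phi> x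
           + norm (grad u x) powr q * \<phi> x) = 0)"


text \<open>Calculus on the unit sphere, through extensions that are homogeneous of degree 0. At a unit
  vector, the gradient of the extension of \<open>f\<close> is tangential and equals \<open>\<nabla>' f\<close>. For a tangential
  field \<open>F\<close> the divergence of the extension equals \<open>div' F\<close>, because the radial derivative of
  the extension vanishes.\<close>

definition radial_ext :: "(real ^ 'n \<Rightarrow> 'b) \<Rightarrow> real ^ 'n \<Rightarrow> 'b" where
  "radial_ext f x = f (x /\<^sub>R norm x)"

definition sphere_grad :: "(real ^ 'n \<Rightarrow> real) \<Rightarrow> real ^ 'n \<Rightarrow> real ^ 'n" where
  "sphere_grad f = grad (radial_ext f)"

definition sphere_div :: "(real ^ 'n \<Rightarrow> real ^ 'n) \<Rightarrow> real ^ 'n \<Rightarrow> real" where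
  "sphere_div F = divergence (radial_ext F)"

text \<open>The coordinate \<open>k\<close> plays the role of \<open>x\<^sub>N\<close>: the half space is \<open>{x. x $ k > 0}\<close>.\<close>

definition upper_hemisphere :: "'n \<Rightarrow> (real ^ 'n) set" where
  "upper_hemisphere k = {\<sigma> \<in> sphere 0 1. \<sigma> $ k > 0}"

definition equator :: "'n \<Rightarrow> (real ^ 'n) set" where
  "equator k = {\<sigma> \<in> sphere 0 1. \<sigma> $ k = 0}"

definition C2_closed_hemisphere :: "'n \<Rightarrow> (real ^ 'n \<Rightarrow> real) \<Rightarrow> bool" where
  "C2_closed_hemisphere k \<psi> \<longleftrightarrow>
     Ck_upto 2 {x. x $ k > 0} ({x. x $ k \<ge> 0} - {0}) (radial_ext \<psi>)"

definition hemisphere_problem ::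
    "'n::finite \<Rightarrow> real \<Rightarrow> real \<Rightarrow> (real ^ 'n \<Rightarrow> real) \<Rightarrow> bool" where
  "hemisphere_problem k p \<beta> \<psi> \<longleftrightarrow>
     (let \<Lambda> = \<beta> * (p - 1) + p - real CARD('n);
          w = (\<lambda>\<sigma>. (\<beta>\<^sup>2 * (\<psi> \<sigma>)\<^sup>2 + (norm (sphere_grad \<psi> \<sigma>))\<^sup>2) powr ((p - 2) / 2))
      in (\<forall>\<sigma>\<in>upper_hemisphere k.
            - sphere_div (\<lambda>\<tau>. w \<tau> *\<^sub>R sphere_grad \<psi> \<tau>) \<sigma> - \<beta> * \<Lambda> * w \<sigma> * \<psi> \<sigma> = 0) \<and>
         (\<forall>\<sigma>\<in>equator k. \<psi> \<sigma> = 0))"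

text \<open>The property that singles out the exponent \<open>\<beta>\<^sub>*\<close>. For \<open>1 < p \<le> N\<close> there is exactly one
  such \<open>\<beta>\<close>; by rotation invariance it does not depend on \<open>k\<close>.\<close>

definition is_beta_star :: "'n::finite \<Rightarrow> real \<Rightarrow> real \<Rightarrow> bool" where
  "is_beta_star k p \<beta> \<longleftrightarrow>
     \<beta> > 0 \<and>
     (\<exists>\<psi>. C2_closed_hemisphere k \<psi> \<and> (\<forall>\<sigma>\<in>upper_hemisphere k. \<psi> \<sigma> > 0) \<and>
          hemisphere_problem k p \<beta> \<psi>)"

definition q_star :: "real \<Rightarrow> real \<Rightarrow> real" where
  "q_star p \<beta> = p - \<beta> / (\<beta> + 1)"

end

theory Submission
  imports Defs
begin

text \<open>Put \<open>b = (p - q) / (q + 1 - p)\<close>; the condition \<open>q > q\<^sub>*\<close> means \<open>b < \<beta>\<close>. Comparison with the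
  supersolutions \<open>C (|x| - \<epsilon>) powr (- b)\<close> of the full equation gives \<open>u \<le> C |x| powr (- b)\<close>.

  The function \<open>U = |x| powr (- \<beta>) \<psi>(x / |x|)\<close> is \<open>p\<close>-harmonic in the half space, and for \<open>\<theta> < 1\<close> the
  power \<open>U powr \<theta>\<close> is strictly \<open>p\<close>-superharmonic. By Hopf's lemma \<open>\<nabla>U\<close> does not vanish on the closed
  half space, so by compactness \<open>W = (U \<circ> T) powr \<theta>\<close> remains \<open>p\<close>-superharmonic for maps \<open>T\<close> that are
  close to a rotation and send a cone slightly larger than a half space into the half space. Near \<open>0\<close>
  the domain lies in such a cone, and there \<open>W\<close> is comparable to \<open>|x| powr (- \<theta> \<beta>)\<close>, which dominates
  \<open>u\<close> when \<open>b < \<theta> \<beta>\<close>.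

  Testing with \<open>((u - \<kappa> - \<epsilon> Z)\<^sub>+)\<^sup>2\<close>, where \<open>Z\<close> is \<open>W\<close> cut off away from \<open>0\<close>, and letting \<open>\<epsilon> \<rightarrow> 0\<close> yields
  \<open>\<nabla>u = 0\<close> on \<open>{u > \<kappa>}\<close> for every \<open>\<kappa> > 0\<close>. Hence \<open>u\<close> is constant, and the constant is \<open>0\<close>.\<close>

section \<open>Integration by parts and comparison\<close>

text \<open>\<open>\<Omega>\<close> may bulge out of its tangent half space at \<open>0\<close>, so
  \<open>U\<close> itself cannot serve as a barrier; this forces the passage to a larger cone. The
  deformation changes the p-Laplacian of \<open>U\<close> by a small amount of unknown sign. The
  power \<open>\<theta> < 1\<close> gains a term of definite sign, proportional to
  \<open>1 - \<theta>\<close> and to the fourth power of the norm of the gradient; it absorbs that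
  error uniformly only if the gradient stays away from \<open>0\<close> up to the boundary, which is
  what Hopf's lemma is for. \<open>W\<close> is a barrier only near \<open>0\<close>, and after the
  cutoff \<open>Z\<close> fails to be superharmonic in the transition zone, so
  \<open>u \<le> \<epsilon> Z\<close> does not follow by comparison. But the flux is homogeneous of
  degree \<open>p - 1\<close>: the wrong-signed part of the divergence for
  \<open>\<epsilon> Z\<close> is a bounded function times \<open>\<epsilon> powr (p - 1)\<close>,
  whereas the absorption term of \<open>u\<close> does not shrink with \<open>\<epsilon>\<close>.
  Hence the conclusion concerns the gradient of \<open>u\<close> first, and \<open>u\<close> only
  afterwards. Squared positive parts are of class C1, so all test functions are classical and no
  Sobolev space enters.\<close>

lemma integral_directional_derivative_eq_0:
  fixes f :: "'a::euclidean_space \<Rightarrow> real"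
  assumes der: "\<And>x. (f has_derivative f' x) (at x)"
    and cont: "continuous_on UNIV (\<lambda>x. f' x e)"
    and K: "compact K" and zero: "\<And>x. x \<notin> K \<Longrightarrow> f x = 0"
  shows "integral\<^sup>L lborel (\<lambda>x. f' x e) = 0"
proof -
  have f'0: "f' x e = 0" if "x \<notin> K" for x
  proof -
    have "open (- K)" using K by (simp add: compact_imp_closed open_Compl)
    then have "(f has_derivative (\<lambda>h. 0)) (at x)"
      by (rule has_derivative_transform_within_open[OF has_derivative_const[of 0]])
        (use that zero in auto)
    with der show ?thesis by (metis has_derivative_unique)
  qed
  obtain B0 where B0: "\<And>x. x \<in> K \<Longrightarrow> \<bar>f' x e\<bar> \<le> B0"
  proof -
    have "compact ((\<lambda>x. f' x e) ` K)"
      using compact_continuous_image continuous_on_subset[OF cont] K by blast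
    then obtain B where "\<forall>y\<in>(\<lambda>x. f' x e) ` K. norm y \<le> B"
      using compact_imp_bounded bounded_iff by metis
    then show ?thesis using that by force
  qed
  define B where "B = max B0 0"
  have B: "\<bar>f' x e\<bar> \<le> B" for x
    using B0[of x] f'0[of x] by (cases "x \<in> K") (auto simp: B_def)
  have B_nn: "0 \<le> B" by (simp add: B_def)
  obtain R where R: "\<And>x. x \<in> K \<Longrightarrow> norm x \<le> R"
    using compact_imp_bounded[OF K] bounded_iff by metis
  have fcont: "continuous_on UNIV f"
    by (intro continuous_at_imp_continuous_on ballI has_derivative_continuous[OF der])
  \<comment> \<open>Difference quotients with increment \<open>1 / (n + 1)\<close>. Translation
    invariance of \<open>lborel\<close> makes each of their integrals \<open>0\<close>, and
    dominated convergence carries this over to the derivative.\<close>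
  define s where "s n x = (f (x + (1 / (real n + 1)) *\<^sub>R e) - f x) * (real n + 1)" for n x
  have integrable_f: "integrable lborel f"
  proof -
    have "integrable lborel (\<lambda>x. indicator K x *\<^sub>R f x)"
      using borel_integrable_compact[OF K] continuous_on_subset[OF fcont] by blast
    also have "(\<lambda>x. indicator K x *\<^sub>R f x) = f"
    proof
      show "indicator K x *\<^sub>R f x = f x" for x using zero[of x] by (cases "x \<in> K") auto
    qed
    finally show ?thesis .
  qed
  have fm: "f \<in> borel_measurable lborel" using fcont by (simp add: borel_measurable_continuous_onI)
  have shift: "integrable lborel (\<lambda>x. f (x + c)) \<and> integral\<^sup>L lborel (\<lambda>x. f (x + c)) = integral\<^sup>L lborel f" for c
  proof -
    have d: "distr lborel borel ((+) c) = (lborel :: 'a measure)" by (rule lborel_distr_plus)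
    have m: "(+) c \<in> measurable lborel borel" by simp
    have "integrable (distr lborel borel ((+) c)) f" using d integrable_f by simp
    moreover have "integral\<^sup>L (distr lborel borel ((+) c)) f = integral\<^sup>L lborel f" using d by simp
    ultimately show ?thesis
      using integrable_distr[OF m, of f] integral_distr[OF m, of f] fm by (simp add: add.commute)
  qed
  have int0: "integral\<^sup>L lborel (s n) = 0" for n
    unfolding s_def using shift integrable_f by simp
  have lim: "(\<lambda>n. s n x) \<longlonglongrightarrow> f' x e" for x
  proof -
    have "((\<lambda>t. f (x + t *\<^sub>R e)) has_derivative (\<lambda>t. f' x (t *\<^sub>R e))) (at 0)"
      by (rule has_derivative_compose[of "\<lambda>t. x + t *\<^sub>R e" _ _ _ f, simplified])
        (auto intro!: derivative_eq_intros der)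
    then have "((\<lambda>t. f (x + t *\<^sub>R e)) has_real_derivative f' x e) (at 0)"
      by (rule has_derivative_imp_has_field_derivative)
        (use linear_cmul[OF has_derivative_linear[OF der[of x]]] in auto)
    then have "((\<lambda>t. (f (x + t *\<^sub>R e) - f x) / t) \<longlongrightarrow> f' x e) (at 0)"
      by (simp add: DERIV_def)
    moreover have "filterlim (\<lambda>n. 1 / (real n + 1)) (at 0) sequentially"
      unfolding filterlim_at
      using LIMSEQ_inverse_real_of_nat by (auto simp: inverse_eq_divide add.commute intro!: always_eventually)
    ultimately have "((\<lambda>n. (f (x + (1 / (real n + 1)) *\<^sub>R e) - f x) / (1 / (real n + 1))) \<longlongrightarrow> f' x e) sequentially"
      by (rule filterlim_compose[of "\<lambda>t. (f (x + t *\<^sub>R e) - f x) / t"])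
    then show ?thesis by (simp add: s_def)
  qed
  \<comment> \<open>The mean value theorem bounds the quotients by \<open>B\<close>. The increments
    have norm at most \<open>norm e\<close>, so the quotients vanish outside a ball enlarged by
    \<open>norm e\<close>.\<close>
  have bnd: "\<bar>s n x\<bar> \<le> B * indicator (cball 0 (R + norm e)) x" for n x
  proof -
    let ?t = "1 / (real n + 1)"
    have t: "0 < ?t" "?t \<le> 1" by auto
    have "norm (f (x + ?t *\<^sub>R e) - f x) \<le> B * \<bar>?t - 0\<bar>"
    proof -
      have "\<exists>\<xi>\<in>{0<..<?t}. f (x + ?t *\<^sub>R e) - f (x + 0 *\<^sub>R e) = f' (x + \<xi> *\<^sub>R e) ((?t - 0) *\<^sub>R e)"
      proof (rule mvt_simple[of 0 ?t "\<lambda>t. f (x + t *\<^sub>R e)" "\<lambda>\<xi> t. f' (x + \<xi> *\<^sub>R e) (t *\<^sub>R e)"])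
        show "0 < ?t" by simp
        fix y assume "0 \<le> y" "y \<le> ?t"
        have "((\<lambda>t. f (x + t *\<^sub>R e)) has_derivative (\<lambda>t. f' (x + y *\<^sub>R e) (t *\<^sub>R e))) (at y)"
          by (rule has_derivative_compose[of "\<lambda>t. x + t *\<^sub>R e" _ _ _ f, simplified])
            (auto intro!: derivative_eq_intros der)
        then show "((\<lambda>t. f (x + t *\<^sub>R e)) has_derivative (\<lambda>t. f' (x + y *\<^sub>R e) (t *\<^sub>R e))) (at y within {0..?t})"
          by (rule has_derivative_at_withinI)
      qed
      then obtain \<xi> where "f (x + ?t *\<^sub>R e) - f x = f' (x + \<xi> *\<^sub>R e) (?t *\<^sub>R e)" by auto
      also have "\<dots> = ?t * f' (x + \<xi> *\<^sub>R e) e"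
        using linear_cmul[OF has_derivative_linear[OF der]] by fastforce
      finally have "\<bar>f (x + ?t *\<^sub>R e) - f x\<bar> = ?t * \<bar>f' (x + \<xi> *\<^sub>R e) e\<bar>"
        by (simp add: abs_mult)
      then show ?thesis using B[of "x + \<xi> *\<^sub>R e"] by (simp add: field_simps)
    qed
    moreover have "\<bar>s n x\<bar> = \<bar>f (x + ?t *\<^sub>R e) - f x\<bar> * (real n + 1)"
      unfolding s_def abs_mult by simp
    ultimately have le: "\<bar>s n x\<bar> \<le> B" by (simp add: field_simps)
    show ?thesis
    proof (cases "x \<in> cball 0 (R + norm e)")
      case False
      then have n: "norm x > R + norm e" by simp
      have "norm x \<le> norm (x + ?t *\<^sub>R e) + norm (?t *\<^sub>R e)"
        by (metis add_diff_cancel norm_triangle_ineq4)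
      moreover have "norm (?t *\<^sub>R e) \<le> norm e" using mult_right_mono[OF t(2) norm_ge_zero[of e]] by simp
      ultimately have "norm (x + ?t *\<^sub>R e) > R" using n by linarith
      moreover have "norm x > R" using n by (smt (verit) norm_ge_zero)
      ultimately have "f x = 0" "f (x + ?t *\<^sub>R e) = 0" using R zero by (meson not_le)+
      then show ?thesis by (simp add: s_def False B_nn)
    qed (use le in auto)
  qed
  have "(\<lambda>n. integral\<^sup>L lborel (s n)) \<longlonglongrightarrow> integral\<^sup>L lborel (\<lambda>x. f' x e)"
  proof (rule integral_dominated_convergence[where w = "\<lambda>x. B * indicator (cball 0 (R + norm e)) x"])
    show "(\<lambda>x. f' x e) \<in> borel_measurable lborel" using cont by (simp add: borel_measurable_continuous_onI)
    show "s n \<in> borel_measurable lborel" for n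
      unfolding s_def[abs_def]
      by (simp, intro borel_measurable_continuous_onI continuous_intros continuous_on_compose2[OF fcont] fcont) auto
    show "integrable lborel (\<lambda>x::'a. B * indicator (cball 0 (R + norm e)) x)"
      by (intro integrable_mult_right integrable_real_indicator emeasure_compact_finite) (auto simp: emeasure_compact_finite)
  qed (use lim bnd in auto)
  then show ?thesis using int0 by (simp add: LIMSEQ_const_iff)
qed

section \<open>C1 functions and fields, and equations in weak divergence form\<close>

definition C1_fun :: "(real ^ 'n) set \<Rightarrow> (real ^ 'n \<Rightarrow> real) \<Rightarrow> (real ^ 'n \<Rightarrow> real ^ 'n) \<Rightarrow> bool" where
  "C1_fun D w g \<longleftrightarrow> open D \<and> (\<forall>x\<in>D. (w has_derivative (\<lambda>h. g x \<bullet> h)) (at x)) \<and> continuous_on D g"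

text \<open>The derivative is an argument, as in \<open>C1_fun\<close>, so that explicit gradients
  and Jacobians can be carried through computations; the divergence is then
  \<open>trace (J x)\<close>.\<close>

definition C1_field :: "(real ^ 'n) set \<Rightarrow> (real ^ 'n \<Rightarrow> real ^ 'n) \<Rightarrow> (real ^ 'n \<Rightarrow> real ^ 'n ^ 'n) \<Rightarrow> bool" where
  "C1_field D F J \<longleftrightarrow> open D \<and> (\<forall>x\<in>D. (F has_derivative (\<lambda>h. J x *v h)) (at x)) \<and> continuous_on D J"

lemma C1_fun_cont: "C1_fun D w g \<Longrightarrow> continuous_on D w"
  unfolding C1_fun_def by (meson continuous_at_imp_continuous_on has_derivative_continuous)

lemma C1_field_cont: "C1_field D w g \<Longrightarrow> continuous_on D w"
  unfolding C1_field_def by (meson continuous_at_imp_continuous_on has_derivative_continuous)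

lemma continuous_on_trace [continuous_intros]:
  fixes J :: "'a::topological_space \<Rightarrow> real ^ 'n ^ 'n"
  shows "continuous_on D J \<Longrightarrow> continuous_on D (\<lambda>x. trace (J x))"
  unfolding trace_def by (intro continuous_intros)

lemma continuous_on_extend_zero:
  fixes f :: "'a::topological_space \<Rightarrow> 'b::real_normed_vector"
  assumes "continuous_on D f" "open D" "closed K" "K \<subseteq> D" "\<And>x. x \<in> D - K \<Longrightarrow> f x = 0"
  shows "continuous_on UNIV (\<lambda>x. if x \<in> D then f x else 0)"
proof -
  have "continuous_on (D \<union> - K) (\<lambda>x. if x \<in> D then f x else 0)"
  proof (rule continuous_on_open_Un)
    show "continuous_on D (\<lambda>x. if x \<in> D then f x else 0)"
      by (rule continuous_on_eq[OF assms(1)]) simp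
    show "continuous_on (- K) (\<lambda>x. if x \<in> D then f x else 0)"
      by (rule continuous_on_eq[OF continuous_on_const[of _ 0]]) (use assms(5) in auto)
  qed (use assms in auto)
  moreover have "D \<union> - K = UNIV" using assms(4) by auto
  ultimately show ?thesis by simp
qed

text \<open>The weak form of \<open>div F = h\<close>.\<close>

definition weak_div_eq :: "(real ^ 'n) set \<Rightarrow> (real ^ 'n \<Rightarrow> real ^ 'n) \<Rightarrow> (real ^ 'n \<Rightarrow> real) \<Rightarrow> bool" where
  "weak_div_eq D F h \<longleftrightarrow> (\<forall>K \<phi> g. compact K \<longrightarrow> K \<subseteq> D \<longrightarrow> C1_fun UNIV \<phi> g \<longrightarrow> (\<forall>x. x \<notin> K \<longrightarrow> \<phi> x = 0) \<longrightarrow>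
     integral\<^sup>L lborel (\<lambda>x. indicator K x *\<^sub>R (F x \<bullet> g x + h x * \<phi> x)) = 0)"

lemma weak_div_eq_subset: "weak_div_eq D F h \<Longrightarrow> D' \<subseteq> D \<Longrightarrow> weak_div_eq D' F h"
  unfolding weak_div_eq_def by (meson subset_trans)

lemma C1_fun_grad_eq_0:
  assumes "C1_fun UNIV \<phi> g" "closed K" "\<And>x. x \<notin> K \<Longrightarrow> \<phi> x = 0" "x \<notin> K"
  shows "g x = 0"
proof -
  have "(\<phi> has_derivative (\<lambda>h. 0)) (at x)"
    by (rule has_derivative_transform_within_open[OF has_derivative_const[of 0], where s = "- K"]) (use assms in auto)
  moreover have "(\<phi> has_derivative (\<lambda>h. g x \<bullet> h)) (at x)" using assms(1) by (auto simp: C1_fun_def)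
  ultimately have "(\<lambda>h. g x \<bullet> h) = (\<lambda>h. 0)" by (metis has_derivative_unique)
  then show ?thesis by (metis inner_eq_zero_iff)
qed

text \<open>For each \<open>i\<close> the product of \<open>F x $ i\<close> and
  \<open>\<phi> x\<close>, extended by zero off \<open>D\<close>, falls under
  \<open>integral_directional_derivative_eq_0\<close> in the direction \<open>axis i 1\<close>;
  summing over \<open>i\<close> gives the claim.\<close>

lemma C1_field_weak_div_eq:
  fixes D :: "(real ^ 'n) set"
  assumes F: "C1_field D F J"
  shows "weak_div_eq D F (\<lambda>x. trace (J x))"
  unfolding weak_div_eq_def
proof (intro allI impI)
  fix K and \<phi> :: "real ^ 'n \<Rightarrow> real" and g
  assume K: "compact K" "K \<subseteq> D" and \<phi>: "C1_fun UNIV \<phi> g" and z: "\<forall>x. x \<notin> K \<longrightarrow> \<phi> x = 0"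
  have clK: "closed K" using K compact_imp_closed by blast
  have g0: "g x = 0" if "x \<notin> K" for x using C1_fun_grad_eq_0[OF \<phi> clK] z that by blast
  have D: "open D" using F by (simp add: C1_field_def)
  have contJ: "continuous_on D J" and contF: "continuous_on D F" using F C1_field_cont by (auto simp: C1_field_def)
  have contphi: "continuous_on D \<phi>" "continuous_on D g"
    using C1_fun_cont[OF \<phi>] \<phi> continuous_on_subset by (auto simp: C1_fun_def intro: continuous_on_subset)
  define f where "f i x = (if x \<in> D then F x $ i * \<phi> x else 0)" for i x
  define f' where "f' i x h = (if x \<in> D then F x $ i * (g x \<bullet> h) + (J x *v h) $ i * \<phi> x else 0)" for i x h
  have der: "(f i has_derivative f' i x) (at x)" for i x
  proof (cases "x \<in> D")
    case True
    have 1: "((\<lambda>x. F x $ i) has_derivative (\<lambda>h. (J x *v h) $ i)) (at x)"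
      using F True by (auto simp: C1_field_def intro!: bounded_linear.has_derivative[OF bounded_linear_vec_nth])
    have 2: "(\<phi> has_derivative (\<lambda>h. g x \<bullet> h)) (at x)" using \<phi> by (auto simp: C1_fun_def)
    have "((\<lambda>x. F x $ i * \<phi> x) has_derivative f' i x) (at x)"
      using has_derivative_mult[OF 1 2] True by (auto simp: f'_def[abs_def])
    then show ?thesis
      by (rule has_derivative_transform_within_open[OF _ D True]) (simp add: f_def)
  next
    case False
    have "((\<lambda>x. 0) has_derivative f' i x) (at x)" using False by (auto simp: f'_def[abs_def])
    then show ?thesis
      by (rule has_derivative_transform_within_open[where s = "- K"]) (use False K clK z in \<open>auto simp: f_def\<close>)
  qed
  have cont: "continuous_on UNIV (\<lambda>x. f' i x h)" for i h
    unfolding f'_def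
    by (rule continuous_on_extend_zero[OF _ D clK K(2)])
      (use z g0 in \<open>auto intro!: continuous_intros contF contJ contphi simp: matrix_vector_mult_def\<close>)
  have int0: "integral\<^sup>L lborel (\<lambda>x. f' i x (axis i 1)) = 0" for i
    by (rule integral_directional_derivative_eq_0[OF der cont K(1)]) (use z in \<open>auto simp: f_def\<close>)
  have intble: "integrable lborel (\<lambda>x. f' i x (axis i 1))" for i
  proof -
    have "integrable lborel (\<lambda>x. indicator K x *\<^sub>R f' i x (axis i 1))"
      using borel_integrable_compact[OF K(1)] continuous_on_subset[OF cont] by blast
    also have "(\<lambda>x. indicator K x *\<^sub>R f' i x (axis i 1)) = (\<lambda>x. f' i x (axis i 1))"
    proof
      show "indicator K x *\<^sub>R f' i x (axis i 1) = f' i x (axis i 1)" for x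
        using z g0[of x] by (cases "x \<in> K") (auto simp: f'_def)
    qed
    finally show ?thesis .
  qed
  have "(\<lambda>x. indicator K x *\<^sub>R (F x \<bullet> g x + trace (J x) * \<phi> x)) = (\<lambda>x. \<Sum>i\<in>UNIV. f' i x (axis i 1))"
  proof
    fix x
    show "indicator K x *\<^sub>R (F x \<bullet> g x + trace (J x) * \<phi> x) = (\<Sum>i\<in>UNIV. f' i x (axis i 1))"
    proof (cases "x \<in> K")
      case True
      then have "x \<in> D" using K by auto
      then show ?thesis using True
        by (simp add: f'_def inner_axis matrix_vector_mult_basis column_def trace_def
            inner_vec_def[of "F x"] sum.distrib sum_distrib_right)
    next
      case False
      then show ?thesis using z g0[of x] by (simp add: f'_def cong: if_cong)
    qed
  qed
  then show "integral\<^sup>L lborel (\<lambda>x. indicator K x *\<^sub>R (F x \<bullet> g x + trace (J x) * \<phi> x)) = 0"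
    using intble int0 by simp
qed

lemma C1_fun_subset: "C1_fun D w g \<Longrightarrow> open D' \<Longrightarrow> D' \<subseteq> D \<Longrightarrow> C1_fun D' w g"
  unfolding C1_fun_def by (auto intro: continuous_on_subset)

lemma C1_field_subset: "C1_field D F J \<Longrightarrow> open D' \<Longrightarrow> D' \<subseteq> D \<Longrightarrow> C1_field D' F J"
  unfolding C1_field_def by (auto intro: continuous_on_subset)

lemma C1_fun_diff_const:
  assumes "C1_fun D u gu" "C1_fun D w gw"
  shows "C1_fun D (\<lambda>x. u x - w x - c) (\<lambda>x. gu x - gw x)"
  using assms unfolding C1_fun_def
  by (auto intro!: continuous_intros derivative_eq_intros simp: inner_diff_left)

lemma C1_fun_cmult:
  assumes "C1_fun D u gu"
  shows "C1_fun D (\<lambda>x. c * u x) (\<lambda>x. c *\<^sub>R gu x)"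
  using assms unfolding C1_fun_def
  by (auto intro!: continuous_intros derivative_eq_intros)

section \<open>Squared positive parts as test functions\<close>

lemma has_real_derivative_pos_part_square:
  "((\<lambda>r::real. (max r 0)\<^sup>2) has_real_derivative 2 * max r 0) (at r)"
proof -
  consider "r < 0" | "r = 0" | "r > 0" by linarith
  then show ?thesis
  proof cases
    case 1
    have "((\<lambda>r::real. 0) has_real_derivative 2 * max r 0) (at r)" using 1 by simp
    then show ?thesis by (rule DERIV_cong_ev[THEN iffD1, rotated 3])
        (use 1 in \<open>auto simp: eventually_at intro!: exI[of _ "-r"] eventually_nhds_metric[THEN iffD2] simp: dist_real_def max_def\<close>)
  next
    case 2
    have "((\<lambda>h::real. (max h 0)\<^sup>2 / h) \<longlongrightarrow> 0) (at 0)"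
    proof (rule Lim_null_comparison)
      show "\<forall>\<^sub>F h::real in at 0. norm ((max h 0)\<^sup>2 / h) \<le> \<bar>h\<bar>"
        by (auto simp: eventually_at max_def power2_eq_square intro!: exI[of _ 1])
      show "((\<lambda>h::real. \<bar>h\<bar>) \<longlongrightarrow> 0) (at 0)"
        by (auto intro!: tendsto_eq_intros)
    qed
    then show ?thesis using 2 by (simp add: DERIV_def)
  next
    case 3
    have "((\<lambda>r::real. r\<^sup>2) has_real_derivative 2 * max r 0) (at r)" using 3
      by (auto intro!: derivative_eq_intros)
    then show ?thesis by (rule DERIV_cong_ev[THEN iffD1, rotated 3])
        (use 3 in \<open>auto simp: eventually_at intro!: eventually_nhds_metric[THEN iffD2] exI[of _ "r"] simp: dist_real_def max_def\<close>)
  qed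
qed

definition trunc_sq :: "(real ^ 'n) set \<Rightarrow> (real ^ 'n \<Rightarrow> real) \<Rightarrow> real ^ 'n \<Rightarrow> real" where
  "trunc_sq D z x = (if x \<in> D then (max (z x) 0)\<^sup>2 else 0)"

text \<open>The square removes the kink of the positive part. Compactness of the superlevel set
  replaces a boundary condition: it keeps the support away from the boundary of \<open>D\<close>, so
  that the extension by zero remains C1.\<close>

lemma C1_fun_trunc_sq:
  assumes z: "C1_fun D z gz" and K: "compact {x \<in> D. z x \<ge> 0}"
  shows "C1_fun UNIV (trunc_sq D z) (\<lambda>x. if x \<in> D then (2 * max (z x) 0) *\<^sub>R gz x else 0)"
proof -
  let ?K = "{x \<in> D. z x \<ge> 0}"
  have clK: "closed ?K" using K compact_imp_closed by blast
  have D: "open D" and cg: "continuous_on D gz" and cz: "continuous_on D z"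
    using z C1_fun_cont by (auto simp: C1_fun_def)
  have "(trunc_sq D z has_derivative (\<lambda>h. (if x \<in> D then (2 * max (z x) 0) *\<^sub>R gz x else 0) \<bullet> h)) (at x)" for x
  proof (cases "x \<in> D")
    case True
    have 1: "(z has_derivative (\<lambda>h. gz x \<bullet> h)) (at x)" using z True by (auto simp: C1_fun_def)
    have "((\<lambda>x. (max (z x) 0)\<^sup>2) has_derivative (\<lambda>h. (gz x \<bullet> h) * (2 * max (z x) 0))) (at x)"
      by (rule has_derivative_compose[OF 1, of "\<lambda>r. (max r 0)\<^sup>2" "\<lambda>h. h * (2 * max (z x) 0)"])
        (use has_real_derivative_pos_part_square[of "z x"] in
          \<open>simp add: has_field_derivative_def mult.commute[of _ "2 * max (z x) 0"]\<close>)
    then have "(trunc_sq D z has_derivative (\<lambda>h. (gz x \<bullet> h) * (2 * max (z x) 0))) (at x)"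
      by (rule has_derivative_transform_within_open[OF _ D True]) (simp add: trunc_sq_def)
    then show ?thesis using True by (simp add: mult_ac)
  next
    case False
    have "((\<lambda>x. 0) has_derivative (\<lambda>h. (if x \<in> D then (2 * max (z x) 0) *\<^sub>R gz x else 0) \<bullet> h)) (at x)" using False by auto
    then show ?thesis
      by (rule has_derivative_transform_within_open[where s = "- ?K"]) (use False clK in \<open>auto simp: trunc_sq_def max_def\<close>)
  qed
  moreover have "continuous_on UNIV (\<lambda>x. if x \<in> D then (2 * max (z x) 0) *\<^sub>R gz x else 0)"
    by (rule continuous_on_extend_zero[OF _ D clK])
      (intro continuous_intros cg cz, auto simp: max_def)
  ultimately show ?thesis by (simp add: C1_fun_def)
qed

lemma trunc_sq_eq_0: "x \<notin> {x \<in> D. z x \<ge> 0} \<Longrightarrow> trunc_sq D z x = 0"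
  by (auto simp: trunc_sq_def max_def)

lemma compact_superlevel:
  fixes f :: "'a::t2_space \<Rightarrow> real"
  assumes "compact K" "continuous_on K f"
  shows "compact {x \<in> K. c \<le> f x}"
proof -
  have "closedin (top_of_set K) (K \<inter> f -` {c..})"
    by (rule continuous_closedin_preimage[OF assms(2)]) simp
  moreover have "K \<inter> f -` {c..} = {x \<in> K. c \<le> f x}" by auto
  ultimately show ?thesis using closedin_compact[OF assms(1)] by metis
qed

lemma weak_div_eq_trunc_sq:
  assumes F: "weak_div_eq D F h" and z: "C1_fun D z gz" and K: "compact {x \<in> D. z x \<ge> 0}"
  shows "integral\<^sup>L lborel (\<lambda>x. indicator {x \<in> D. z x \<ge> 0} x *\<^sub>R (F x \<bullet> ((2 * max (z x) 0) *\<^sub>R gz x) + h x * (max (z x) 0)\<^sup>2)) = 0"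
    (is "integral\<^sup>L lborel ?f = 0")
proof -
  let ?K = "{x \<in> D. z x \<ge> 0}"
  have "integral\<^sup>L lborel (\<lambda>x. indicator ?K x *\<^sub>R (F x \<bullet> (if x \<in> D then (2 * max (z x) 0) *\<^sub>R gz x else 0) + h x * trunc_sq D z x)) = 0"
    by (rule F[unfolded weak_div_eq_def, rule_format, OF K _ C1_fun_trunc_sq[OF z K]])
      (auto intro: trunc_sq_eq_0)
  also have "(\<lambda>x. indicator ?K x *\<^sub>R (F x \<bullet> (if x \<in> D then (2 * max (z x) 0) *\<^sub>R gz x else 0) + h x * trunc_sq D z x)) = ?f"
    by (rule ext) (auto simp: indicator_def trunc_sq_def)
  finally show ?thesis .
qed

text \<open>Both equations are tested with the squared positive part of \<open>z\<close> and
  subtracted. The resulting flux term is \<open>2 * max (z x) 0\<close> times the product in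
  \<open>mono\<close>, hence nonnegative, and is dropped.\<close>

lemma integral_weak_diff_le_0:
  assumes F1: "weak_div_eq D F1 h1" and F2: "weak_div_eq D F2 h2"
    and cont: "continuous_on D F1" "continuous_on D F2" "continuous_on D h1" "continuous_on D h2"
    and z: "C1_fun D z gz" and K: "compact {x \<in> D. z x \<ge> 0}"
    and mono: "\<And>x. x \<in> D \<Longrightarrow> z x \<ge> 0 \<Longrightarrow> (F1 x - F2 x) \<bullet> gz x \<ge> 0"
  shows "integral\<^sup>L lborel (\<lambda>x. indicator {x \<in> D. z x \<ge> 0} x *\<^sub>R ((h1 x - h2 x) * (max (z x) 0)\<^sup>2)) \<le> 0"
proof -
  let ?K = "{x \<in> D. z x \<ge> 0}"
  have sub: "?K \<subseteq> D" by auto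
  have cz: "continuous_on D z" "continuous_on D gz" using z C1_fun_cont by (auto simp: C1_fun_def)
  note conts = cont[THEN continuous_on_subset, OF sub] cz[THEN continuous_on_subset, OF sub]
  let ?f1 = "\<lambda>x. F1 x \<bullet> ((2 * max (z x) 0) *\<^sub>R gz x) + h1 x * (max (z x) 0)\<^sup>2"
  let ?f2 = "\<lambda>x. F2 x \<bullet> ((2 * max (z x) 0) *\<^sub>R gz x) + h2 x * (max (z x) 0)\<^sup>2"
  let ?f3 = "\<lambda>x. (h1 x - h2 x) * (max (z x) 0)\<^sup>2"
  have i1: "integrable lborel (\<lambda>x. indicator ?K x *\<^sub>R ?f1 x)"
    by (rule borel_integrable_compact[OF K]) (intro continuous_intros conts)
  have i2: "integrable lborel (\<lambda>x. indicator ?K x *\<^sub>R ?f2 x)"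
    by (rule borel_integrable_compact[OF K]) (intro continuous_intros conts)
  have i3: "integrable lborel (\<lambda>x. indicator ?K x *\<^sub>R ?f3 x)"
    by (rule borel_integrable_compact[OF K]) (intro continuous_intros conts)
  have "integral\<^sup>L lborel (\<lambda>x. indicator ?K x *\<^sub>R ?f3 x) \<le> integral\<^sup>L lborel (\<lambda>x. indicator ?K x *\<^sub>R ?f1 x - indicator ?K x *\<^sub>R ?f2 x)"
  proof (rule integral_mono[OF i3 Bochner_Integration.integrable_diff[OF i1 i2]])
    fix x
    show "indicator ?K x *\<^sub>R ?f3 x \<le> indicator ?K x *\<^sub>R ?f1 x - indicator ?K x *\<^sub>R ?f2 x"
    proof (cases "x \<in> ?K")
      case True
      then have "0 \<le> (2 * max (z x) 0) * ((F1 x - F2 x) \<bullet> gz x)" using mono by auto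
      then show ?thesis using True by (simp add: algebra_simps inner_diff_left)
    qed auto
  qed
  also have "\<dots> = 0"
    using weak_div_eq_trunc_sq[OF F1 z K] weak_div_eq_trunc_sq[OF F2 z K]
    by (subst Bochner_Integration.integral_diff[OF i1 i2]) simp
  finally show ?thesis .
qed

lemma integral_ge_on_cball:
  fixes f :: "real ^ 'n \<Rightarrow> real"
  assumes K: "compact K" and f: "continuous_on K f" and nn: "\<And>x. x \<in> K \<Longrightarrow> 0 \<le> f x"
    and sub: "cball x0 r \<subseteq> K" and c: "\<And>x. x \<in> cball x0 r \<Longrightarrow> c \<le> f x"
  shows "c * measure lborel (cball x0 r) \<le> integral\<^sup>L lborel (\<lambda>x. indicator K x *\<^sub>R f x)"
proof -
  have i: "integrable lborel (\<lambda>x. indicator K x *\<^sub>R f x)" by (rule borel_integrable_compact[OF K f])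
  have "integral\<^sup>L lborel (\<lambda>x. c * indicator (cball x0 r) x) \<le> integral\<^sup>L lborel (\<lambda>x. indicator K x *\<^sub>R f x)"
  proof (rule integral_mono[OF _ i])
    show "integrable lborel (\<lambda>x::real^'n. c * indicator (cball x0 r) x)"
      by (intro integrable_mult_right integrable_real_indicator emeasure_compact_finite) auto
    show "c * indicator (cball x0 r) x \<le> indicator K x *\<^sub>R f x" for x
      using nn[of x] c[of x] sub by (auto simp: indicator_def)
  qed
  then show ?thesis by simp
qed

section \<open>The flux of the p-Laplacian, its monotonicity, and comparison\<close>

definition pflux :: "real \<Rightarrow> real ^ 'n \<Rightarrow> real ^ 'n" where
  "pflux p v = norm v powr (p - 2) *\<^sub>R v"

lemma norm_pflux: "norm (pflux p v) = norm v powr (p - 1)"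
proof (cases "v = 0")
  case False
  then have "norm v powr (p - 1) = norm v powr (p - 2) * norm v powr 1"
    by (subst powr_add[symmetric]) simp
  then show ?thesis using False by (simp add: pflux_def)
qed (simp add: pflux_def)

lemma pflux_scale: "c > 0 \<Longrightarrow> pflux p (c *\<^sub>R v) = c powr (p - 1) *\<^sub>R pflux p v"
proof -
  assume c: "c > 0"
  then have "c powr (p - 1) = c powr (p - 2) * c powr 1" by (subst powr_add[symmetric]) simp
  then show ?thesis using c by (simp add: pflux_def powr_mult mult_ac)
qed

text \<open>The Cauchy-Schwarz inequality for the two mixed products leaves the product of
  \<open>norm a powr (p - 1) - norm b powr (p - 1)\<close> and \<open>norm a - norm b\<close>, two
  factors of equal sign.\<close>

lemma pflux_monotone:
  assumes p: "1 < p"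
  shows "0 \<le> (pflux p a - pflux p b) \<bullet> (a - b)"
proof -
  have e: "pflux p v \<bullet> v = norm v powr (p - 1) * norm v" for v :: "real ^ 'a"
  proof (cases "v = 0")
    case False
    then have "norm v powr (p - 1) = norm v powr (p - 2) * norm v powr 1"
      by (subst powr_add[symmetric]) simp
    then show ?thesis using False by (simp add: pflux_def power2_norm_eq_inner[symmetric] power2_eq_square)
  qed (simp add: pflux_def)
  have "pflux p a \<bullet> b \<le> norm a powr (p - 1) * norm b" "pflux p b \<bullet> a \<le> norm b powr (p - 1) * norm a"
    using norm_cauchy_schwarz[of "pflux p a" b] norm_cauchy_schwarz[of "pflux p b" a] by (simp_all add: norm_pflux)
  then have "(norm a powr (p - 1) - norm b powr (p - 1)) * (norm a - norm b) \<le> (pflux p a - pflux p b) \<bullet> (a - b)"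
    by (simp add: algebra_simps e)
  moreover have "0 \<le> (norm a powr (p - 1) - norm b powr (p - 1)) * (norm a - norm b)"
  proof (cases "norm a \<le> norm b")
    case True
    then show ?thesis using powr_mono2[of "p-1" "norm a" "norm b"] p by (simp add: mult_nonpos_nonpos)
  next
    case False
    then show ?thesis using powr_mono2[of "p-1" "norm b" "norm a"] p by simp
  qed
  ultimately show ?thesis by linarith
qed

lemma continuous_on_powr_const:
  fixes f :: "'a::topological_space \<Rightarrow> real"
  assumes "continuous_on S f" "a > 0" "\<And>x. x \<in> S \<Longrightarrow> f x \<ge> 0"
  shows "continuous_on S (\<lambda>x. f x powr a)"
  by (rule continuous_on_powr') (use assms in \<open>auto intro: continuous_intros\<close>)

lemma continuous_pflux:
  assumes p: "1 < p"
  shows "continuous_on UNIV (pflux p :: real ^ 'n \<Rightarrow> _)"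
proof (intro continuous_at_imp_continuous_on ballI)
  fix v :: "real ^ 'n"
  show "isCont (pflux p) v"
  proof (cases "v = 0")
    case True
    \<comment> \<open>For \<open>p < 2\<close> the factor \<open>norm v powr (p - 2)\<close> blows
      up at \<open>0\<close>, but the norm of the product is the positive power
      \<open>norm v powr (p - 1)\<close>.\<close>
    have "isCont (\<lambda>v::real^'n. norm v powr (p - 1)) 0"
      using continuous_on_powr_const[of UNIV "norm :: real ^ 'n \<Rightarrow> real" "p - 1"] p
      by (simp add: continuous_on_norm_id continuous_on_eq_continuous_at)
    then have "((\<lambda>v::real^'n. norm (pflux p v)) \<longlongrightarrow> 0) (at 0)" by (simp add: norm_pflux isCont_def)
    then have "(pflux p \<longlongrightarrow> (0 :: real ^ 'n)) (at 0)" by (rule tendsto_norm_zero_cancel)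
    then show ?thesis using True by (simp add: isCont_def pflux_def[of p 0])
  next
    case False
    then show ?thesis unfolding pflux_def by (intro continuous_intros) auto
  qed
qed

lemma continuous_on_pflux [continuous_intros]:
  "1 < p \<Longrightarrow> continuous_on D g \<Longrightarrow> continuous_on D (\<lambda>x. pflux p (g x))"
  using continuous_on_compose2[OF continuous_pflux] by blast

text \<open>Strictness is only needed where the gradients agree: at the maximum of \<open>u - w\<close> they do, and the
  test function \<open>((u - w - \<kappa>')\<^sub>+)\<^sup>2\<close> with \<open>\<kappa>'\<close> close to the maximum only sees points nearby.\<close>

lemma comparison:
  assumes p: "1 < p" and u: "C1_fun D u gu" and w: "C1_fun D w gw"
    and F1: "weak_div_eq D (\<lambda>x. pflux p (gu x)) h1" and F2: "weak_div_eq D (\<lambda>x. pflux p (gw x)) h2"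
    and cont: "continuous_on D h1" "continuous_on D h2"
    and touch: "\<And>x. x \<in> D \<Longrightarrow> gu x = gw x \<Longrightarrow> h1 x > h2 x"
    and K: "compact {x \<in> D. u x - w x \<ge> \<kappa>}"
  shows "\<forall>x\<in>D. u x - w x \<le> \<kappa>"
proof (rule ccontr)
  assume "\<not> ?thesis"
  let ?K = "{x \<in> D. u x - w x \<ge> \<kappa>}"
  from \<open>\<not> ?thesis\<close> obtain x1 where x1: "x1 \<in> D" "u x1 - w x1 > \<kappa>" by (auto simp: not_le)
  then have ne: "?K \<noteq> {}" by auto
  have D: "open D" and cg: "continuous_on D gu" "continuous_on D gw"
    and cu: "continuous_on D u" "continuous_on D w"
    using u w C1_fun_cont by (auto simp: C1_fun_def)
  have sub: "?K \<subseteq> D" by auto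
  have cuK: "continuous_on ?K (\<lambda>x. u x - w x)" by (intro continuous_intros cu[THEN continuous_on_subset, OF sub])
  obtain x0 where x0: "x0 \<in> ?K" "\<And>x. x \<in> ?K \<Longrightarrow> u x - w x \<le> u x0 - w x0"
    using continuous_attains_sup[OF K ne cuK] by blast
  let ?m = "u x0 - w x0"
  have max: "u x - w x \<le> ?m" if "x \<in> D" for x using x0 that by (cases "x \<in> ?K") auto
  have touchm: "h1 x > h2 x" if "x \<in> D" "u x - w x = ?m" for x
  proof -
    have d: "((\<lambda>x. u x - w x) has_derivative (\<lambda>h. (gu x - gw x) \<bullet> h)) (at x)"
      using u w that by (auto simp: C1_fun_def inner_diff_left intro!: derivative_intros)
    have "(\<lambda>h. (gu x - gw x) \<bullet> h) = (\<lambda>h. 0)"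
      by (rule differential_zero_maxmin[OF that(1) D d]) (use max that in auto)
    then have "gu x - gw x = 0" by (metis inner_eq_zero_iff)
    then show ?thesis using touch that by simp
  qed
  \<comment> \<open>\<open>?B\<close> is where the strict inequality fails. It is compact and misses
    every point at which \<open>u - w\<close> attains its maximum \<open>?m\<close>, so
    \<open>u - w\<close> stays below some \<open>m' < ?m\<close> on it.\<close>
  let ?B = "{x \<in> ?K. h1 x - h2 x \<le> 0}"
  have cB: "compact ?B"
  proof -
    have "compact {x \<in> ?K. 0 \<le> h2 x - h1 x}"
      by (rule compact_superlevel[OF K]) (intro continuous_intros cont[THEN continuous_on_subset, OF sub])
    then show ?thesis by (simp add: algebra_simps)
  qed
  have "\<exists>m'<?m. \<forall>x\<in>?B. u x - w x \<le> m'"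
  proof (cases "?B = {}")
    case True then show ?thesis by (auto intro: exI[of _ "?m - 1"])
  next
    case False
    have subB: "?B \<subseteq> ?K" by auto
    obtain y where y: "y \<in> ?B" "\<And>x. x \<in> ?B \<Longrightarrow> u x - w x \<le> u y - w y"
      using continuous_attains_sup[OF cB False continuous_on_subset[OF cuK subB]] by blast
    have "u y - w y \<noteq> ?m" using touchm[of y] y(1) by force
    moreover have "u y - w y \<le> ?m" using max[of y] y(1) by auto
    ultimately show ?thesis using y by (intro exI[of _ "u y - w y"]) auto
  qed
  then obtain m' where m': "m' < ?m" "\<And>x. x \<in> ?B \<Longrightarrow> u x - w x \<le> m'" by blast
  \<comment> \<open>A level strictly between \<open>max m' \<kappa>\<close> and \<open>?m\<close>:
    the test function then lives inside \<open>?K\<close> and off \<open>?B\<close>, yet it is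
    positive near \<open>x0\<close>.\<close>
  define \<kappa>' where "\<kappa>' = (max m' \<kappa> + ?m) / 2"
  define z where "z x = u x - w x - \<kappa>'" for x
  have "?m > \<kappa>" using max[OF x1(1)] x1(2) by linarith
  then have \<kappa>': "m' < \<kappa>'" "\<kappa> < \<kappa>'" "\<kappa>' < ?m" using m'(1) by (auto simp: \<kappa>'_def)
  have z: "C1_fun D z (\<lambda>x. gu x - gw x)" unfolding z_def by (rule C1_fun_diff_const[OF u w])
  have cz: "continuous_on D z" using z by (rule C1_fun_cont)
  let ?K' = "{x \<in> D. z x \<ge> 0}"
  have "?K' = {x \<in> ?K. \<kappa>' \<le> u x - w x}" using \<kappa>' by (auto simp: z_def)
  then have K': "compact ?K'" using compact_superlevel[OF K cuK] by simp
  have hpos: "h1 x - h2 x > 0" if "x \<in> ?K'" for x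
  proof -
    have "x \<in> ?K" "u x - w x > m'" using that \<kappa>' by (auto simp: z_def)
    then have "x \<notin> ?B" using m'(2) by force
    then show ?thesis using \<open>x \<in> ?K\<close> by auto
  qed
  let ?f = "\<lambda>x. (h1 x - h2 x) * (max (z x) 0)\<^sup>2"
  have le0: "integral\<^sup>L lborel (\<lambda>x. indicator ?K' x *\<^sub>R ?f x) \<le> 0"
    by (rule integral_weak_diff_le_0[OF F1 F2 _ _ cont z K'])
      (auto intro!: continuous_intros p cg pflux_monotone)
  have "open {x \<in> D. 0 < z x}"
    using continuous_open_preimage[OF cz D, of "{0<..}"] by (simp add: vimage_def Int_def)
  moreover have x0': "x0 \<in> {x \<in> D. 0 < z x}" using x0 \<kappa>' by (simp add: z_def)
  ultimately obtain r where r: "r > 0" "cball x0 r \<subseteq> {x \<in> D. 0 < z x}"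
    using open_contains_cball by blast
  have fpos: "?f x > 0" if "x \<in> cball x0 r" for x
  proof -
    have "z x > 0" "x \<in> ?K'" using r that by auto
    then show ?thesis using hpos[of x] by simp
  qed
  have cf: "continuous_on D ?f" by (intro continuous_intros cont cz)
  have rD: "cball x0 r \<subseteq> D" "cball x0 r \<subseteq> ?K'" using r by force+
  obtain y where y: "y \<in> cball x0 r" "\<And>x. x \<in> cball x0 r \<Longrightarrow> ?f y \<le> ?f x"
    using continuous_attains_inf[OF compact_cball _ continuous_on_subset[OF cf rD(1)]] r(1) by fastforce
  have "?f y * measure lborel (cball x0 r) \<le> integral\<^sup>L lborel (\<lambda>x. indicator ?K' x *\<^sub>R ?f x)"
  proof (rule integral_ge_on_cball[OF K' continuous_on_subset[OF cf] _ rD(2) y(2)])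
    show "0 \<le> ?f x" if "x \<in> ?K'" for x using hpos[OF that] by simp
  qed auto
  moreover have "?f y * measure lborel (cball x0 r) > 0"
    using fpos[OF y(1)] content_cball_pos[OF r(1), of x0] by simp
  ultimately show False using le0 by linarith
qed

section \<open>Functions of class C2 and the p-Laplacian\<close>

definition outer :: "real ^ 'n \<Rightarrow> real ^ 'n \<Rightarrow> real ^ 'n ^ 'n" where
  "outer a b = (\<chi> i j. a $ i * b $ j)"

lemma outer_mult_vec: "outer a b *v h = (b \<bullet> h) *\<^sub>R a"
  by (simp add: outer_def matrix_vector_mult_def inner_vec_def vec_eq_iff sum_distrib_left sum_distrib_right mult_ac)

lemma trace_outer: "trace (outer a b) = a \<bullet> b"
  by (simp add: outer_def trace_def inner_vec_def)

lemma continuous_on_outer [continuous_intros]: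
  "continuous_on S f \<Longrightarrow> continuous_on S g \<Longrightarrow> continuous_on S (\<lambda>x. outer (f x) (g x))"
  unfolding outer_def by (intro continuous_intros)

lemma continuous_on_matrix_vector_mult [continuous_intros]:
  fixes M :: "'a::topological_space \<Rightarrow> real ^ 'n ^ 'm"
  shows "continuous_on S M \<Longrightarrow> continuous_on S v \<Longrightarrow> continuous_on S (\<lambda>x. M x *v v x)"
  unfolding matrix_vector_mult_def by (intro continuous_intros)

lemma continuous_on_vector_matrix_mult [continuous_intros]:
  fixes M :: "'a::topological_space \<Rightarrow> real ^ 'n ^ 'm"
  shows "continuous_on S M \<Longrightarrow> continuous_on S v \<Longrightarrow> continuous_on S (\<lambda>x. v x v* M x)"
  unfolding vector_matrix_mult_def by (intro continuous_intros)

lemma continuous_on_matrix_mult [continuous_intros]: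
  fixes M :: "'a::topological_space \<Rightarrow> real ^ 'n ^ 'm" and L :: "'a \<Rightarrow> real ^ 'k ^ 'n"
  shows "continuous_on S M \<Longrightarrow> continuous_on S L \<Longrightarrow> continuous_on S (\<lambda>x. M x ** L x)"
  unfolding matrix_matrix_mult_def by (intro continuous_intros)

lemma trace_scaleR: "trace (c *\<^sub>R (A :: real ^ 'n ^ 'n)) = c * trace A"
  by (simp add: trace_def sum_distrib_left)

lemma matrix_eq_of_mult_vec: "(\<And>h. A *v h = B *v h) \<Longrightarrow> A = (B :: real ^ 'n ^ 'm)"
  by (simp add: matrix_eq)

lemmas mat_simps = outer_mult_vec matrix_vector_mult_add_rdistrib matrix_vector_mult_diff_rdistrib scaleR_matrix_vector_assoc[symmetric]
  trace_outer trace_add trace_sub trace_scaleR trace_I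

definition C2_fun :: "(real ^ 'n) set \<Rightarrow> (real ^ 'n \<Rightarrow> real) \<Rightarrow> (real ^ 'n \<Rightarrow> real ^ 'n) \<Rightarrow> (real ^ 'n \<Rightarrow> real ^ 'n ^ 'n) \<Rightarrow> bool" where
  "C2_fun D w g M \<longleftrightarrow> C1_fun D w g \<and> C1_field D g M"

text \<open>The \<open>p\<close>-Laplacian is \<open>norm g powr (p - 4) * plap p g M\<close>, for gradient \<open>g\<close> and Hessian \<open>M\<close>. The
  singular factor is split off because \<open>plap\<close> is polynomial, hence continuous also at \<open>g = 0\<close>.\<close>

definition plap :: "real \<Rightarrow> real ^ 'n \<Rightarrow> real ^ 'n ^ 'n \<Rightarrow> real" where
  "plap p g M = (norm g)\<^sup>2 * trace M + (p - 2) * (g \<bullet> (M *v g))"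

lemma C2_funD:
  assumes "C2_fun D w g M"
  shows "open D" "continuous_on D w" "continuous_on D g" "continuous_on D M"
    "\<And>x. x \<in> D \<Longrightarrow> (w has_derivative (\<lambda>h. g x \<bullet> h)) (at x)"
    "\<And>x. x \<in> D \<Longrightarrow> (g has_derivative (\<lambda>h. M x *v h)) (at x)"
    "C1_fun D w g" "C1_field D g M"
  using assms C1_fun_cont by (auto simp: C2_fun_def C1_fun_def C1_field_def)

lemma C2_funI:
  assumes "open D" "\<And>x. x \<in> D \<Longrightarrow> (w has_derivative (\<lambda>h. g x \<bullet> h)) (at x)"
    "\<And>x. x \<in> D \<Longrightarrow> (g has_derivative (\<lambda>h. M x *v h)) (at x)" "continuous_on D M"
  shows "C2_fun D w g M"
proof -
  have "C1_field D g M" using assms by (simp add: C1_field_def)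
  then show ?thesis using assms C1_field_cont[of D g M] by (simp add: C2_fun_def C1_fun_def)
qed

lemma C2_fun_subset: "C2_fun D w g M \<Longrightarrow> open D' \<Longrightarrow> D' \<subseteq> D \<Longrightarrow> C2_fun D' w g M"
  unfolding C2_fun_def using C1_fun_subset C1_field_subset by blast

lemma norm_powr_inner: "norm v powr a = (v \<bullet> v) powr (a / 2)"
  by (simp add: norm_eq_sqrt_inner powr_half_sqrt[symmetric] powr_powr)

text \<open>With \<open>s = g x \<bullet> g x\<close> and \<open>a = (p - 2) / 2\<close> the flux is
  \<open>s powr a *\<^sub>R g x\<close>, differentiable because \<open>s > 0\<close>. Taking out
  \<open>s powr (a - 1)\<close> from the trace leaves the polynomial \<open>plap\<close>.\<close>

lemma C1_field_pflux:
  assumes w: "C2_fun D w g M" and nz: "\<And>x. x \<in> D \<Longrightarrow> g x \<noteq> 0"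
  obtains J where "C1_field D (\<lambda>x. pflux p (g x)) J"
    "\<And>x. x \<in> D \<Longrightarrow> trace (J x) = norm (g x) powr (p - 4) * plap p (g x) (M x)"
proof
  define a where "a = (p - 2) / 2"
  define s where "s x = g x \<bullet> g x" for x
  define J where "J x = s x powr a *\<^sub>R M x + (2 * a * s x powr (a - 1)) *\<^sub>R outer (g x) (g x v* M x)" for x
  have spos: "s x > 0" if "x \<in> D" for x using nz[OF that] by (simp add: s_def)
  have pf: "pflux p (g x) = s x powr a *\<^sub>R g x" for x
    by (simp add: pflux_def norm_powr_inner s_def a_def)
  show "C1_field D (\<lambda>x. pflux p (g x)) J"
    unfolding C1_field_def
  proof (intro conjI ballI)
    show "open D" by (rule C2_funD[OF w])
    have cs: "continuous_on D s" unfolding s_def by (intro continuous_intros C2_funD[OF w])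
    show "continuous_on D J" unfolding J_def
      by (intro continuous_intros C2_funD[OF w] cs) (use spos in force)+
    fix x assume x: "x \<in> D"
    note dg = C2_funD(6)[OF w x]
    have ds: "(s has_derivative (\<lambda>h. 2 * (g x \<bullet> (M x *v h)))) (at x)"
      unfolding s_def using dg by (auto intro!: derivative_eq_intros simp: inner_commute)
    have dp: "((\<lambda>y. s y powr a) has_derivative (\<lambda>h. (2 * (g x \<bullet> (M x *v h))) * (a * s x powr (a - 1)))) (at x)"
    proof (rule has_derivative_compose[OF ds, of "\<lambda>r. r powr a" "\<lambda>h. h * (a * s x powr (a - 1))"])
      show "((\<lambda>r. r powr a) has_derivative (\<lambda>h. h * (a * s x powr (a - 1)))) (at (s x))"
        using has_real_derivative_powr[OF spos[OF x], of a]
        by (simp add: has_field_derivative_def mult.commute[of _ "a * s x powr (a - 1)"])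
    qed
    show "((\<lambda>x. pflux p (g x)) has_derivative (\<lambda>h. J x *v h)) (at x)"
      unfolding pf using has_derivative_scaleR[OF dp dg]
      by (rule has_derivative_eq_rhs) (simp add: J_def mat_simps dot_lmul_matrix fun_eq_iff mult_ac)
  qed
  show "trace (J x) = norm (g x) powr (p - 4) * plap p (g x) (M x)" if x: "x \<in> D" for x
  proof -
    have e: "norm (g x) powr (p - 4) = s x powr (a - 1)" by (simp add: norm_powr_inner s_def a_def diff_divide_distrib)
    have "s x powr a = s x powr (a - 1) * s x powr 1" by (subst powr_add[symmetric]) simp
    then have "s x powr a = s x powr (a - 1) * s x" using spos[OF x] by simp
    moreover have "(norm (g x))\<^sup>2 = s x" by (simp add: s_def power2_norm_eq_inner)
    moreover have "p - 2 = 2 * a" by (simp add: a_def)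
    ultimately show ?thesis
      unfolding e plap_def
      by (simp add: J_def mat_simps inner_commute[of "g x" "g x v* M x"] dot_lmul_matrix algebra_simps)
  qed
qed

lemma C2_fun_compose:
  assumes w: "C2_fun D w g M" and S: "w ` D \<subseteq> S"
    and f1: "\<And>t. t \<in> S \<Longrightarrow> (f has_real_derivative f1 t) (at t)"
    and f2: "\<And>t. t \<in> S \<Longrightarrow> (f1 has_real_derivative f2 t) (at t)" and cf2: "continuous_on S f2"
  shows "C2_fun D (\<lambda>x. f (w x)) (\<lambda>x. f1 (w x) *\<^sub>R g x) (\<lambda>x. f1 (w x) *\<^sub>R M x + f2 (w x) *\<^sub>R outer (g x) (g x))"
proof (rule C2_funI)
  show "open D" by (rule C2_funD[OF w])
  have cf1: "continuous_on S f1" using f2 DERIV_isCont continuous_at_imp_continuous_on by blast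
  show "continuous_on D (\<lambda>x. f1 (w x) *\<^sub>R M x + f2 (w x) *\<^sub>R outer (g x) (g x))"
    by (intro continuous_intros C2_funD[OF w] continuous_on_compose2[OF cf1] continuous_on_compose2[OF cf2] S)
  fix x assume x: "x \<in> D"
  then have wx: "w x \<in> S" using S by auto
  show "((\<lambda>x. f (w x)) has_derivative (\<lambda>h. f1 (w x) *\<^sub>R g x \<bullet> h)) (at x)"
    using has_derivative_compose[OF C2_funD(5)[OF w x], of f "\<lambda>h. f1 (w x) * h"] f1[OF wx]
    by (simp add: has_field_derivative_def)
  have d1: "((\<lambda>x. f1 (w x)) has_derivative (\<lambda>h. f2 (w x) * (g x \<bullet> h))) (at x)"
    using has_derivative_compose[OF C2_funD(5)[OF w x], of f1 "\<lambda>h. f2 (w x) * h"] f2[OF wx]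
    by (simp add: has_field_derivative_def)
  show "((\<lambda>x. f1 (w x) *\<^sub>R g x) has_derivative (\<lambda>h. (f1 (w x) *\<^sub>R M x + f2 (w x) *\<^sub>R outer (g x) (g x)) *v h)) (at x)"
    using has_derivative_scaleR[OF d1 C2_funD(6)[OF w x]]
    by (rule has_derivative_eq_rhs) (simp add: mat_simps fun_eq_iff)
qed

text \<open>With \<open>a\<close> and \<open>b\<close> the first and second derivative of an outer
  function, this is the expression for a composition. For \<open>p > 1\<close> the last term has the
  sign of \<open>b\<close>: concave outer functions gain superharmonicity, convex ones
  subharmonicity.\<close>

lemma plap_compose:
  "plap p (a *\<^sub>R g) (a *\<^sub>R M + b *\<^sub>R outer g g) = a ^ 3 * plap p g M + (p - 1) * a\<^sup>2 * b * norm g ^ 4"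
proof -
  have [simp]: "g \<bullet> g = (norm g)\<^sup>2" by (simp add: power2_norm_eq_inner)
  have "plap p (a *\<^sub>R g) (a *\<^sub>R M + b *\<^sub>R outer g g)
     = (\<bar>a\<bar> * norm g)\<^sup>2 * (a * trace M + b * (norm g)\<^sup>2) + (p - 2) * (a * (a * (a * (g \<bullet> (M *v g)))) + a * (a * (b * ((norm g)\<^sup>2 * (norm g)\<^sup>2))))"
    by (simp add: plap_def mat_simps matrix_vector_mult_scaleR inner_add_right algebra_simps)
  also have "\<dots> = a ^ 3 * plap p g M + (p - 1) * a\<^sup>2 * b * norm g ^ 4"
    unfolding plap_def power_mult_distrib power2_abs by algebra
  finally show ?thesis .
qed

lemma C2_fun_mult:
  assumes v: "C2_fun D v gv Mv" and w: "C2_fun D w gw Mw"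
  shows "C2_fun D (\<lambda>x. v x * w x) (\<lambda>x. v x *\<^sub>R gw x + w x *\<^sub>R gv x)
    (\<lambda>x. v x *\<^sub>R Mw x + w x *\<^sub>R Mv x + (outer (gw x) (gv x) + outer (gv x) (gw x)))"
proof (rule C2_funI)
  show "open D" by (rule C2_funD[OF w])
  show "continuous_on D (\<lambda>x. v x *\<^sub>R Mw x + w x *\<^sub>R Mv x + (outer (gw x) (gv x) + outer (gv x) (gw x)))"
    by (intro continuous_intros C2_funD[OF w] C2_funD[OF v])
  fix x assume x: "x \<in> D"
  show "((\<lambda>x. v x * w x) has_derivative (\<lambda>h. (v x *\<^sub>R gw x + w x *\<^sub>R gv x) \<bullet> h)) (at x)"
    using has_derivative_mult[OF C2_funD(5)[OF v x] C2_funD(5)[OF w x]]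
    by (rule has_derivative_eq_rhs) (simp add: inner_add_left fun_eq_iff)
  show "((\<lambda>x. v x *\<^sub>R gw x + w x *\<^sub>R gv x) has_derivative
      (\<lambda>h. (v x *\<^sub>R Mw x + w x *\<^sub>R Mv x + (outer (gw x) (gv x) + outer (gv x) (gw x))) *v h)) (at x)"
    using has_derivative_add[OF has_derivative_scaleR[OF C2_funD(5)[OF v x] C2_funD(6)[OF w x]]
        has_derivative_scaleR[OF C2_funD(5)[OF w x] C2_funD(6)[OF v x]]]
    by (rule has_derivative_eq_rhs) (simp add: mat_simps fun_eq_iff)
qed

lemma C2_fun_norm_sq:
  fixes c :: "real ^ 'n"
  shows "C2_fun UNIV (\<lambda>x. (x - c) \<bullet> (x - c)) (\<lambda>x. 2 *\<^sub>R (x - c)) (\<lambda>x. 2 *\<^sub>R mat 1)"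
proof (rule C2_funI)
  fix x :: "real ^ 'n"
  show "((\<lambda>x. (x - c) \<bullet> (x - c)) has_derivative (\<bullet>) (2 *\<^sub>R (x - c))) (at x)"
    by (auto intro!: derivative_eq_intros simp: fun_eq_iff inner_commute)
  show "((\<lambda>x. 2 *\<^sub>R (x - c)) has_derivative (*v) (2 *\<^sub>R mat 1)) (at x)"
    by (auto intro!: derivative_eq_intros simp: fun_eq_iff scaleR_matrix_vector_assoc[symmetric])
qed auto

lemma C2_fun_norm: "C2_fun (- {0}) norm (\<lambda>x. (1 / norm x) *\<^sub>R x) (\<lambda>x. (1 / norm x) *\<^sub>R mat 1 - (1 / norm x ^ 3) *\<^sub>R outer x x)"
proof -
  have 1: "C2_fun (- {0 :: real ^ 'n}) (\<lambda>x. (x - 0) \<bullet> (x - 0)) (\<lambda>x. 2 *\<^sub>R (x - 0)) (\<lambda>x. 2 *\<^sub>R mat 1)"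
    by (rule C2_fun_subset[OF C2_fun_norm_sq]) auto
  have A: "C2_fun (- {0 :: real ^ 'n}) (\<lambda>x. sqrt ((x - 0) \<bullet> (x - 0))) (\<lambda>x. (1 / (2 * sqrt ((x - 0) \<bullet> (x - 0)))) *\<^sub>R 2 *\<^sub>R (x - 0))
     (\<lambda>x. (1 / (2 * sqrt ((x - 0) \<bullet> (x - 0)))) *\<^sub>R (2 *\<^sub>R mat 1) + (- 1 / (4 * sqrt ((x - 0) \<bullet> (x - 0)) ^ 3)) *\<^sub>R outer (2 *\<^sub>R (x - 0)) (2 *\<^sub>R (x - 0)))"
  proof (rule C2_fun_compose[OF 1, where S = "{0<..}"])
    fix t :: real assume t: "t \<in> {0<..}"
    show "(sqrt has_real_derivative 1 / (2 * sqrt t)) (at t)"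
      using t by (auto intro!: derivative_eq_intros simp: field_simps)
    show "((\<lambda>t. 1 / (2 * sqrt t)) has_real_derivative - 1 / (4 * sqrt t ^ 3)) (at t)"
      using t by (auto intro!: derivative_eq_intros simp: field_simps power3_eq_cube)
  next
    show "continuous_on {0<..} (\<lambda>t::real. - 1 / (4 * sqrt t ^ 3))"
      by (intro continuous_intros) auto
  qed auto
  have eq: "(- 1 / (4 * r)) *\<^sub>R outer (2 *\<^sub>R (x - 0)) (2 *\<^sub>R (x - 0)) = - ((1 / r) *\<^sub>R outer x x)" for x :: "real ^ 'n" and r
    by (simp add: outer_def vec_eq_iff)
  have "C2_fun (- {0 :: real ^ 'n}) (\<lambda>x. sqrt (x \<bullet> x)) (\<lambda>x. (1 / sqrt (x \<bullet> x)) *\<^sub>R x)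
      (\<lambda>x. (1 / sqrt (x \<bullet> x)) *\<^sub>R mat 1 - (1 / sqrt (x \<bullet> x) ^ 3) *\<^sub>R outer x x)"
    using A unfolding eq by simp
  then show ?thesis by (simp add: norm_eq_sqrt_inner[abs_def])
qed

text \<open>The Hessian of the norm annihilates its gradient, a unit vector, so only the trace
  survives: the mean curvature of the sphere.\<close>

lemma plap_norm: "x \<noteq> 0 \<Longrightarrow> plap p ((1 / norm x) *\<^sub>R x) ((1 / norm x) *\<^sub>R mat 1 - (1 / norm x ^ 3) *\<^sub>R outer x x) = (real CARD('n) - 1) / norm (x :: real ^ 'n)"
proof -
  assume x: "x \<noteq> 0"
  have [simp]: "x \<bullet> x = (norm x)\<^sup>2" by (simp add: power2_norm_eq_inner)
  show ?thesis using x
    by (simp add: plap_def mat_simps matrix_vector_mult_scaleR inner_diff_right field_simps power2_eq_square power3_eq_cube)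
qed

section \<open>Homogeneous functions\<close>

lemma has_derivative_homogeneous:
  fixes f :: "'a::real_normed_vector \<Rightarrow> 'b::real_normed_vector"
  assumes D: "open D" and cone: "\<And>t x. t > 0 \<Longrightarrow> x \<in> D \<Longrightarrow> t *\<^sub>R x \<in> D"
    and hom: "\<And>t x. t > 0 \<Longrightarrow> x \<in> D \<Longrightarrow> f (t *\<^sub>R x) = t powr a *\<^sub>R f x"
    and der: "\<And>x. x \<in> D \<Longrightarrow> (f has_derivative f' x) (at x)"
    and t: "t > 0" and x: "x \<in> D"
  shows "f' (t *\<^sub>R x) h = t powr (a - 1) *\<^sub>R f' x h"
proof -
  have "((\<lambda>y. t powr a *\<^sub>R f ((1 / t) *\<^sub>R y)) has_derivative (\<lambda>h. t powr a *\<^sub>R f' x ((1 / t) *\<^sub>R h))) (at (t *\<^sub>R x))"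
  proof (rule has_derivative_scaleR_right, rule has_derivative_compose[of "\<lambda>y. (1 / t) *\<^sub>R y" "\<lambda>y. (1 / t) *\<^sub>R y"])
    show "((\<lambda>y. (1 / t) *\<^sub>R y) has_derivative (\<lambda>y. (1 / t) *\<^sub>R y)) (at (t *\<^sub>R x))"
      by (auto intro!: derivative_eq_intros)
    show "(f has_derivative f' x) (at ((1 / t) *\<^sub>R t *\<^sub>R x))" using der x t by simp
  qed
  then have "(f has_derivative (\<lambda>h. t powr a *\<^sub>R f' x ((1 / t) *\<^sub>R h))) (at (t *\<^sub>R x))"
  proof (rule has_derivative_transform_within_open[OF _ D cone[OF t x]])
    fix y assume "y \<in> D"
    then have "f (t *\<^sub>R ((1 / t) *\<^sub>R y)) = t powr a *\<^sub>R f ((1 / t) *\<^sub>R y)"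
      using hom[OF t, of "(1 / t) *\<^sub>R y"] cone[of "1 / t" y] t by simp
    then show "t powr a *\<^sub>R f ((1 / t) *\<^sub>R y) = f y" using t by simp
  qed
  then have "f' (t *\<^sub>R x) = (\<lambda>h. t powr a *\<^sub>R f' x ((1 / t) *\<^sub>R h))"
    using der[OF cone[OF t x]] has_derivative_unique by blast
  moreover have "f' x ((1 / t) *\<^sub>R h) = (1 / t) *\<^sub>R f' x h"
    using linear_cmul[OF has_derivative_linear[OF der[OF x]]] by blast
  moreover have "t powr (a - 1) = t powr a * (1 / t)" using t by (simp add: powr_diff)
  ultimately show ?thesis by simp
qed

lemma has_derivative_euler:
  fixes f :: "'a::real_normed_vector \<Rightarrow> 'b::real_normed_vector"
  assumes hom: "\<And>t. t > 0 \<Longrightarrow> f (t *\<^sub>R x) = t powr a *\<^sub>R f x"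
    and der: "(f has_derivative f') (at x)"
  shows "f' x = a *\<^sub>R f x"
proof -
  have "((\<lambda>t. f (t *\<^sub>R x)) has_derivative (\<lambda>t. f' (t *\<^sub>R x))) (at (1::real))"
    by (rule has_derivative_compose[of "\<lambda>t. t *\<^sub>R x" "\<lambda>t. t *\<^sub>R x"])
      (auto intro!: derivative_eq_intros der)
  moreover have "((\<lambda>t. f (t *\<^sub>R x)) has_derivative (\<lambda>t. (t * a) *\<^sub>R f x)) (at (1::real))"
  proof (rule has_derivative_transform_within_open[where s = "{0<..}"])
    show "((\<lambda>t. t powr a *\<^sub>R f x) has_derivative (\<lambda>t. (t * a) *\<^sub>R f x)) (at (1::real))"
      by (auto intro!: derivative_eq_intros simp: mult_ac)
  qed (use hom in auto)
  ultimately have "(\<lambda>t. f' (t *\<^sub>R x)) = (\<lambda>t. (t * a) *\<^sub>R f x)" by (rule has_derivative_unique)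
  from fun_cong[OF this, of 1] show ?thesis by simp
qed

text \<open>Each derivative lowers the degree by one, as differentiating
  \<open>w y = t powr a * w (y / t)\<close> in \<open>y\<close> shows. Signs of \<open>plap\<close>
  and bounds then need checking at unit vectors only.\<close>

lemma C2_fun_homogeneous:
  assumes w: "C2_fun D w g M" and cone: "\<And>t x. t > 0 \<Longrightarrow> x \<in> D \<Longrightarrow> t *\<^sub>R x \<in> D"
    and hom: "\<And>t x. t > 0 \<Longrightarrow> x \<in> D \<Longrightarrow> w (t *\<^sub>R x) = t powr a * w x"
    and t: "t > 0" and x: "x \<in> D"
  shows "g (t *\<^sub>R x) = t powr (a - 1) *\<^sub>R g x" and "M (t *\<^sub>R x) = t powr (a - 2) *\<^sub>R M x"
proof -
  have g: "g (t *\<^sub>R x) = t powr (a - 1) *\<^sub>R g x" if t: "t > 0" and x: "x \<in> D" for t x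
  proof -
    have "g (t *\<^sub>R x) \<bullet> h = (t powr (a - 1) *\<^sub>R g x) \<bullet> h" for h
      using has_derivative_homogeneous[of D w a "\<lambda>x h. g x \<bullet> h" t x h] hom cone C2_funD[OF w] t x by simp
    then show ?thesis by (metis vector_eq_rdot)
  qed
  then show "g (t *\<^sub>R x) = t powr (a - 1) *\<^sub>R g x" using t x by blast
  have "M (t *\<^sub>R x) *v h = (t powr (a - 2) *\<^sub>R M x) *v h" for h
    using has_derivative_homogeneous[of D g "a - 1" "\<lambda>x h. M x *v h" t x h] g cone C2_funD[OF w] t x
    by (simp add: scaleR_matrix_vector_assoc[symmetric])
  then show "M (t *\<^sub>R x) = t powr (a - 2) *\<^sub>R M x" by (rule matrix_eq_of_mult_vec)
qed

lemma plap_scale: "plap p (a *\<^sub>R g) (b *\<^sub>R M) = a\<^sup>2 * b * plap p g M"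
  by (simp add: plap_def trace_scaleR power_mult_distrib matrix_vector_mult_scaleR scaleR_matrix_vector_assoc[symmetric] power2_eq_square algebra_simps)

section \<open>The p-harmonic function of the half space\<close>

lemma has_derivative_grad:
  fixes f :: "real ^ 'n \<Rightarrow> real"
  assumes "f differentiable (at x)"
  shows "(f has_derivative (\<lambda>h. grad f x \<bullet> h)) (at x)"
proof -
  let ?D = "frechet_derivative f (at x)"
  have d: "(f has_derivative ?D) (at x)" using assms frechet_derivative_works by blast
  have lin: "linear ?D" using d has_derivative_linear by blast
  have "?D h = grad f x \<bullet> h" for h
  proof -
    have "?D h = ?D (\<Sum>i\<in>UNIV. h $ i *\<^sub>R axis i 1)" using basis_expansion[of h] by (simp add: scalar_mult_eq_scaleR)
    also have "\<dots> = (\<Sum>i\<in>UNIV. h $ i * ?D (axis i 1))"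
      by (simp add: linear_sum[OF lin] linear_cmul[OF lin])
    finally show ?thesis by (simp add: grad_def inner_vec_def mult.commute)
  qed
  then have "?D = (\<lambda>h. grad f x \<bullet> h)" by auto
  with d show ?thesis by simp
qed

lemma divergence_eq_trace:
  assumes "(F has_derivative (\<lambda>h. J *v h)) (at x)"
  shows "divergence F x = trace J"
proof -
  have "frechet_derivative F (at x) = (\<lambda>h. J *v h)" using frechet_derivative_at[OF assms] by simp
  then show ?thesis by (simp add: divergence_def trace_def matrix_vector_mult_basis column_def)
qed

lemma extends_continuouslyD:
  "extends_continuously U S f \<Longrightarrow> U \<subseteq> S \<Longrightarrow> continuous_on U f"
  unfolding extends_continuously_def by (metis continuous_on_eq continuous_on_subset)

lemma Ck_upto_1_C1_fun:
  assumes f: "Ck_upto 1 U S f" and U: "open U" "U \<subseteq> S"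
  shows "C1_fun U f (grad f)"
  unfolding C1_fun_def
proof (intro conjI ballI)
  have d: "f differentiable_on U" and e: "\<And>i. extends_continuously U S (\<lambda>x. grad f x $ i)"
    using f by (auto simp: Ck_upto_def)
  show "(f has_derivative (\<lambda>h. grad f x \<bullet> h)) (at x)" if "x \<in> U" for x
    using d that U has_derivative_grad by (metis differentiable_on_def at_within_open)
  have "continuous_on U (\<lambda>x. \<chi> i. grad f x $ i)"
    by (intro continuous_intros extends_continuouslyD[OF e] U)
  then show "continuous_on U (grad f)" by simp
qed (rule U)

text \<open>\<open>g\<close> and \<open>M\<close> are assembled from the continuous extensions of
  the partial derivatives. They are meaningful on all of \<open>S\<close>, although the derivatives
  are taken in \<open>U\<close> only; boundary values of the gradient are later understood in this
  sense.\<close>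

lemma Ck_upto_2_C2_fun:
  fixes f :: "real ^ 'n \<Rightarrow> real"
  assumes f: "Ck_upto 2 U S f" and U: "open U" "U \<subseteq> S"
  obtains g M where "C2_fun U f g M" "continuous_on S g" "continuous_on S M" "\<And>x. x \<in> U \<Longrightarrow> g x = grad f x"
proof -
  have d: "f differentiable_on U" and d2: "\<And>i. (\<lambda>x. grad f x $ i) differentiable_on U"
    and e: "\<And>i. extends_continuously U S (\<lambda>x. grad f x $ i)"
    and e2: "\<And>i j. extends_continuously U S (\<lambda>x. grad (\<lambda>x. grad f x $ i) x $ j)"
    using f by (auto simp: Ck_upto_def numeral_2_eq_2)
  obtain G where G: "\<And>i. continuous_on S (G i)" "\<And>i x. x \<in> U \<Longrightarrow> G i x = grad f x $ i"
    using e unfolding extends_continuously_def by metis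
  obtain H where H: "\<And>i j. continuous_on S (H i j)" "\<And>i j x. x \<in> U \<Longrightarrow> H i j x = grad (\<lambda>x. grad f x $ i) x $ j"
    using e2 unfolding extends_continuously_def by metis
  define g where "g x = (\<chi> i. G i x)" for x
  define M where "M x = (\<chi> i j. H i j x)" for x
  have g: "g x = grad f x" if "x \<in> U" for x using G that by (simp add: g_def vec_eq_iff)
  have cg: "continuous_on S g" and cM: "continuous_on S M"
    unfolding g_def M_def by (intro continuous_intros G H)+
  have "C2_fun U f g M"
  proof (rule C2_funI[OF U(1)])
    fix x assume x: "x \<in> U"
    have "f differentiable (at x)" using d x U by (metis differentiable_on_def at_within_open)
    then show "(f has_derivative (\<lambda>h. g x \<bullet> h)) (at x)" using has_derivative_grad g[OF x] by metis
    have "((\<lambda>y. g y \<bullet> b) has_derivative (\<lambda>h. (M x *v h) \<bullet> b)) (at x)" if bB: "b \<in> Basis" for b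
    proof -
      obtain i where b: "b = axis i 1" using bB by (auto simp: Basis_vec_def)
      have "(\<lambda>x. grad f x $ i) differentiable (at x)" using d2 x U by (metis differentiable_on_def at_within_open)
      then have "((\<lambda>x. grad f x $ i) has_derivative (\<lambda>h. grad (\<lambda>x. grad f x $ i) x \<bullet> h)) (at x)"
        by (rule has_derivative_grad)
      moreover have "grad (\<lambda>x. grad f x $ i) x \<bullet> h = (M x *v h) $ i" for h
        using H(2)[OF x] by (simp add: M_def matrix_vector_mult_def inner_vec_def)
      ultimately have "((\<lambda>x. grad f x $ i) has_derivative (\<lambda>h. (M x *v h) $ i)) (at x)" by simp
      then have "((\<lambda>x. g x $ i) has_derivative (\<lambda>h. (M x *v h) $ i)) (at x)"
        by (rule has_derivative_transform_within_open[OF _ U(1) x]) (simp add: g)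
      then show ?thesis by (simp add: b inner_axis)
    qed
    then show "(g has_derivative (\<lambda>h. M x *v h)) (at x)"
      by (subst has_derivative_componentwise_within) auto
  qed (use cM U in \<open>auto intro: continuous_on_subset\<close>)
  then show ?thesis using that cg cM g by blast
qed

text \<open>The algebra of the separation of variables. At a unit vector \<open>\<sigma>\<close>,
  \<open>P\<close>, \<open>g\<close>, \<open>M\<close> stand for value, gradient and Hessian of a
  function of degree 0, and the arguments of \<open>plap\<close> are those of its product with
  \<open>norm x powr (- \<beta>)\<close>. The relations between \<open>M\<close>,
  \<open>\<sigma>\<close> and \<open>g\<close> express the homogeneity; \<open>eq\<close> is the
  spherical equation with its divergence expanded and the factor
  \<open>\<omega> powr ((p - 4) / 2)\<close> cancelled.\<close>

lemma plap_homogeneous_cone: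
  fixes \<sigma> g :: "real ^ 'n"
  assumes \<sigma>: "\<sigma> \<bullet> \<sigma> = 1" and g\<sigma>: "g \<bullet> \<sigma> = 0" and M\<sigma>: "M *v \<sigma> = - g" and \<sigma>M: "\<sigma> \<bullet> (M *v g) = - (g \<bullet> g)"
    and w: "\<omega> = \<beta>\<^sup>2 * P\<^sup>2 + g \<bullet> g"
    and eq: "\<omega> * trace M + (p - 2) * (\<beta>\<^sup>2 * P * (g \<bullet> g) + g \<bullet> (M *v g)) + \<beta> * (\<beta> * (p - 1) + p - real CARD('n)) * \<omega> * P = 0"
  shows "plap p (P *\<^sub>R (- \<beta>) *\<^sub>R \<sigma> + g)
     (P *\<^sub>R ((- \<beta>) *\<^sub>R (mat 1 - outer \<sigma> \<sigma>) + (\<beta> * (\<beta> + 1)) *\<^sub>R outer \<sigma> \<sigma>) + M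
       + (outer ((- \<beta>) *\<^sub>R \<sigma>) g + outer g ((- \<beta>) *\<^sub>R \<sigma>))) = 0" (is "plap p ?g ?M = 0")
proof -
  have \<sigma>g: "\<sigma> \<bullet> g = 0" using g\<sigma> by (simp add: inner_commute)
  have n: "(norm ?g)\<^sup>2 = \<omega>"
    unfolding power2_norm_eq_inner w by (simp add: inner_add_left inner_add_right inner_diff_left inner_diff_right \<sigma> g\<sigma> \<sigma>g power2_eq_square)
  have t: "trace ?M = P * (- \<beta> * (real CARD('n) - 1) + \<beta> * (\<beta> + 1)) + trace M"
    by (simp add: mat_simps \<sigma> g\<sigma> \<sigma>g)
  have Mg: "?M *v ?g = P *\<^sub>R ((- \<beta>) *\<^sub>R g + (\<beta> * (\<beta> + 1) * (- \<beta> * P)) *\<^sub>R \<sigma>) + (P * \<beta>) *\<^sub>R g + M *v g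
      - (\<beta> * (g \<bullet> g)) *\<^sub>R \<sigma> + (\<beta>\<^sup>2 * P) *\<^sub>R g"
    by (simp add: mat_simps matrix_vector_right_distrib matrix_vector_mult_diff_distrib matrix_vector_mult_scaleR M\<sigma> \<sigma> g\<sigma> \<sigma>g inner_add_right inner_diff_right,
        simp add: algebra_simps power2_eq_square)
  have i: "?g \<bullet> (?M *v ?g) = - P * \<beta> * (g \<bullet> g) + \<beta> ^ 3 * (\<beta> + 1) * P ^ 3 + P * \<beta> * (g \<bullet> g) + g \<bullet> (M *v g) + \<beta> * P * (g \<bullet> g)
      + \<beta>\<^sup>2 * P * (g \<bullet> g) + \<beta>\<^sup>2 * P * (g \<bullet> g)"
    unfolding Mg by (simp add: inner_add_left inner_add_right inner_diff_right \<sigma> g\<sigma> \<sigma>g \<sigma>M algebra_simps power2_eq_square power3_eq_cube)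
  show ?thesis
    unfolding plap_def n t i using eq w by algebra
qed

lemma C2_fun_norm_powr:
  obtains g M where "C2_fun (- {0 :: real ^ 'n}) (\<lambda>x. norm x powr a) g M"
    "\<And>x. norm x = 1 \<Longrightarrow> g x = a *\<^sub>R x"
    "\<And>x. norm x = 1 \<Longrightarrow> M x = a *\<^sub>R (mat 1 - outer x x) + (a * (a - 1)) *\<^sub>R outer x x"
proof
  show "C2_fun (- {0 :: real ^ 'n}) (\<lambda>x. norm x powr a) (\<lambda>x. (a * norm x powr (a - 1)) *\<^sub>R (1 / norm x) *\<^sub>R x)
     (\<lambda>x. (a * norm x powr (a - 1)) *\<^sub>R ((1 / norm x) *\<^sub>R mat 1 - (1 / norm x ^ 3) *\<^sub>R outer x x)
        + (a * ((a - 1) * norm x powr (a - 1 - 1))) *\<^sub>R outer ((1 / norm x) *\<^sub>R x) ((1 / norm x) *\<^sub>R x))"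
  proof (rule C2_fun_compose[OF C2_fun_norm, where S = "{0<..}"])
    fix t :: real assume t: "t \<in> {0<..}"
    then show "((\<lambda>t. t powr a) has_real_derivative a * t powr (a - 1)) (at t)"
      by (auto intro: has_real_derivative_powr)
    show "((\<lambda>t. a * t powr (a - 1)) has_real_derivative a * ((a - 1) * t powr (a - 1 - 1))) (at t)"
      using t by (intro DERIV_cmult has_real_derivative_powr) auto
  qed (auto intro!: continuous_intros)
qed auto

section \<open>The separable function \<open>U\<close> in the half space\<close>

locale hemisphere_solution =
  fixes k :: "'n::finite" and p \<beta> :: real and \<psi> :: "real ^ 'n \<Rightarrow> real"
  assumes p: "1 < p" and \<beta>: "\<beta> > 0" and C2: "C2_closed_hemisphere k \<psi>"
    and pos: "\<forall>\<sigma>\<in>upper_hemisphere k. \<psi> \<sigma> > 0" and prob: "hemisphere_problem k p \<beta> \<psi>"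
begin

definition half :: "(real ^ 'n) set" where "half = {x. x $ k > 0}"
definition chalf :: "(real ^ 'n) set" where "chalf = {x. x $ k \<ge> 0} - {0}"
definition \<Psi> :: "real ^ 'n \<Rightarrow> real" where "\<Psi> = radial_ext \<psi>"
definition U :: "real ^ 'n \<Rightarrow> real" where "U x = \<Psi> x * norm x powr (- \<beta>)"

lemma half: "open half" "half \<subseteq> chalf" "half \<subseteq> - {0}" "chalf \<subseteq> - {0}"
  "\<And>t x. t > 0 \<Longrightarrow> x \<in> half \<Longrightarrow> t *\<^sub>R x \<in> half"
proof -
  have "half = (\<lambda>x. x $ k) -` {0<..}" by (auto simp: half_def)
  moreover have "open ((\<lambda>x::real^'n. x $ k) -` {0<..})"
    by (rule open_vimage) (auto intro: continuous_intros)
  ultimately show "open half" by simp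
qed (auto simp: half_def chalf_def)

lemma \<Psi>_scale: "t > 0 \<Longrightarrow> \<Psi> (t *\<^sub>R x) = \<Psi> x"
proof -
  assume "t > 0"
  then have "(t *\<^sub>R x) /\<^sub>R norm (t *\<^sub>R x) = x /\<^sub>R norm x"
    by (cases "x = 0") (simp_all add: vec_eq_iff field_simps)
  then show ?thesis by (simp only: \<Psi>_def radial_ext_def)
qed

lemma U_scale: "t > 0 \<Longrightarrow> U (t *\<^sub>R x) = t powr (- \<beta>) * U x"
  by (simp add: U_def \<Psi>_scale powr_mult)

lemma \<Psi>_pos: "x \<in> half \<Longrightarrow> \<Psi> x > 0"
proof -
  assume x: "x \<in> half"
  then have "x \<noteq> 0" using half(3) by auto
  then have "x /\<^sub>R norm x \<in> upper_hemisphere k" using x by (auto simp: upper_hemisphere_def half_def)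
  then show ?thesis using pos by (simp add: \<Psi>_def radial_ext_def)
qed

lemma U_pos: "x \<in> half \<Longrightarrow> U x > 0"
proof -
  assume x: "x \<in> half"
  then have "x \<noteq> 0" using half(3) by auto
  then show ?thesis using \<Psi>_pos[OF x] by (simp add: U_def)
qed

lemma U_boundary: "x $ k = 0 \<Longrightarrow> U x = 0"
proof (cases "x = 0")
  case False
  assume "x $ k = 0"
  then have "x /\<^sub>R norm x \<in> equator k" using False by (auto simp: equator_def)
  then have "\<Psi> x = 0" using prob by (simp add: hemisphere_problem_def Let_def \<Psi>_def radial_ext_def)
  then show ?thesis by (simp add: U_def)
qed (simp add: U_def)

text \<open>The first three relations come from homogeneity alone, the last one from computing the
  spherical divergence through the degree 0 extension of the flux.\<close>

lemma spherical_equation: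
  assumes g0: "C2_fun half \<Psi> g0 M0" and g0g: "\<And>x. x \<in> half \<Longrightarrow> g0 x = grad \<Psi> x"
    and \<sigma>: "\<sigma> \<in> half" "norm \<sigma> = 1"
  defines "\<omega> \<equiv> \<beta>\<^sup>2 * (\<Psi> \<sigma>)\<^sup>2 + g0 \<sigma> \<bullet> g0 \<sigma>"
  shows "g0 \<sigma> \<bullet> \<sigma> = 0" and "M0 \<sigma> *v \<sigma> = - g0 \<sigma>" and "\<sigma> \<bullet> (M0 \<sigma> *v g0 \<sigma>) = - (g0 \<sigma> \<bullet> g0 \<sigma>)"
    and "\<omega> * trace (M0 \<sigma>) + (p - 2) * (\<beta>\<^sup>2 * \<Psi> \<sigma> * (g0 \<sigma> \<bullet> g0 \<sigma>) + g0 \<sigma> \<bullet> (M0 \<sigma> *v g0 \<sigma>))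
      + \<beta> * (\<beta> * (p - 1) + p - real CARD('n)) * \<omega> * \<Psi> \<sigma> = 0"
proof -
  have g0s: "g0 (t *\<^sub>R x) = t powr (- 1) *\<^sub>R g0 x" if "t > 0" "x \<in> half" for t x
    using C2_fun_homogeneous(1)[OF g0 half(5), of 0 t x] that by (simp add: \<Psi>_scale)
  have gx: "g0 x \<bullet> x = 0" if "x \<in> half" for x
    using has_derivative_euler[OF _ C2_funD(5)[OF g0 that], of 0] by (simp add: \<Psi>_scale)
  show g\<sigma>: "g0 \<sigma> \<bullet> \<sigma> = 0" by (rule gx[OF \<sigma>(1)])
  show "M0 \<sigma> *v \<sigma> = - g0 \<sigma>"
    using has_derivative_euler[OF _ C2_funD(6)[OF g0 \<sigma>(1)], of "-1"] by (simp add: g0s \<sigma>)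
  \<comment> \<open>Differentiating the identity \<open>g0 x \<bullet> x = 0\<close> in the
    direction \<open>g0 \<sigma>\<close> gives the third relation.\<close>
  have "((\<lambda>x. g0 x \<bullet> x) has_derivative (\<lambda>h. g0 \<sigma> \<bullet> h + (M0 \<sigma> *v h) \<bullet> \<sigma>)) (at \<sigma>)"
    by (intro has_derivative_inner C2_funD(6)[OF g0 \<sigma>(1)] has_derivative_ident)
  moreover have "((\<lambda>x. g0 x \<bullet> x) has_derivative (\<lambda>h. 0)) (at \<sigma>)"
    by (rule has_derivative_transform_within_open[OF has_derivative_const[of 0] half(1) \<sigma>(1)]) (simp add: gx)
  ultimately have "(\<lambda>h. g0 \<sigma> \<bullet> h + (M0 \<sigma> *v h) \<bullet> \<sigma>) = (\<lambda>h. 0)" by (rule has_derivative_unique)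
  from fun_cong[OF this, of "g0 \<sigma>"] show "\<sigma> \<bullet> (M0 \<sigma> *v g0 \<sigma>) = - (g0 \<sigma> \<bullet> g0 \<sigma>)"
    by (simp add: inner_commute[of \<sigma>])
  define a where "a = (p - 2) / 2"
  \<comment> \<open>\<open>g0\<close> has degree -1, so the factor \<open>norm x * norm x\<close>
    makes \<open>w\<close> the degree 0 extension of the weight; the factor \<open>norm x\<close> in
    the formula for \<open>S\<close> has the same origin.\<close>
  define w where "w x = \<beta>\<^sup>2 * (\<Psi> x)\<^sup>2 + (norm x * norm x) * (g0 x \<bullet> g0 x)" for x
  have w\<sigma>: "w \<sigma> = \<omega>" by (simp add: w_def \<omega>_def \<sigma>)
  have \<omega>: "\<omega> > 0" unfolding \<omega>_def using \<Psi>_pos[OF \<sigma>(1)] \<beta> by (intro add_pos_nonneg) auto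
  define S where "S = radial_ext (\<lambda>\<tau>. (\<beta>\<^sup>2 * (\<psi> \<tau>)\<^sup>2 + (norm (sphere_grad \<psi> \<tau>))\<^sup>2) powr ((p - 2) / 2) *\<^sub>R sphere_grad \<psi> \<tau>)"
  have S: "S x = w x powr a *\<^sub>R (norm x *\<^sub>R g0 x)" if x: "x \<in> half" for x
  proof -
    have nx: "norm x > 0" using x half(3) by auto
    have xh: "x /\<^sub>R norm x \<in> half" using half(5)[OF _ x, of "inverse (norm x)"] nx by simp
    have "sphere_grad \<psi> (x /\<^sub>R norm x) = g0 (x /\<^sub>R norm x)"
      using g0g[OF xh] by (simp add: sphere_grad_def \<Psi>_def)
    also have "\<dots> = norm x *\<^sub>R g0 x"
      using g0s[OF _ x, of "inverse (norm x)"] nx by (simp add: powr_minus)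
    finally have sg: "sphere_grad \<psi> (x /\<^sub>R norm x) = norm x *\<^sub>R g0 x" .
    moreover have "(norm (norm x *\<^sub>R g0 x))\<^sup>2 = (norm x * norm x) * (g0 x \<bullet> g0 x)"
      by (simp add: power_mult_distrib dot_square_norm power2_eq_square)
    ultimately show ?thesis
      by (simp add: S_def radial_ext_def w_def a_def \<Psi>_def)
  qed
  define \<omega>' where "\<omega>' = (2 * \<beta>\<^sup>2 * \<Psi> \<sigma>) *\<^sub>R g0 \<sigma> + (2 * (g0 \<sigma> \<bullet> g0 \<sigma>)) *\<^sub>R \<sigma> + 2 *\<^sub>R (g0 \<sigma> v* M0 \<sigma>)"
  define J where "J = \<omega> powr a *\<^sub>R (outer (g0 \<sigma>) \<sigma> + M0 \<sigma>) + (a * \<omega> powr (a - 1)) *\<^sub>R outer (g0 \<sigma>) \<omega>'"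
  have dn: "(norm has_derivative (\<lambda>h. \<sigma> \<bullet> h)) (at \<sigma>)"
    using C2_funD(5)[OF C2_fun_norm, of \<sigma>] \<sigma> half(3) by fastforce
  have dw: "(w has_derivative (\<lambda>h. \<omega>' \<bullet> h)) (at \<sigma>)"
    unfolding w_def
    by (rule derivative_eq_intros refl dn C2_funD(5)[OF g0 \<sigma>(1)] C2_funD(6)[OF g0 \<sigma>(1)])+
      (simp add: \<omega>'_def \<sigma> fun_eq_iff inner_add_left dot_lmul_matrix inner_commute[of "M0 \<sigma> *v _"] algebra_simps)
  have dp: "((\<lambda>x. w x powr a) has_derivative (\<lambda>h. (\<omega>' \<bullet> h) * (a * \<omega> powr (a - 1)))) (at \<sigma>)"
  proof (rule has_derivative_compose[OF dw, of "\<lambda>r. r powr a" "\<lambda>h. h * (a * \<omega> powr (a - 1))"])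
    show "((\<lambda>r. r powr a) has_derivative (\<lambda>h. h * (a * \<omega> powr (a - 1)))) (at (w \<sigma>))"
      unfolding w\<sigma> using has_real_derivative_powr[OF \<omega>, of a]
      by (simp add: has_field_derivative_def mult.commute[of _ "a * \<omega> powr (a - 1)"])
  qed
  have "((\<lambda>x. w x powr a *\<^sub>R (norm x *\<^sub>R g0 x)) has_derivative (\<lambda>h. J *v h)) (at \<sigma>)"
    using has_derivative_scaleR[OF dp has_derivative_scaleR[OF dn C2_funD(6)[OF g0 \<sigma>(1)]]]
    by (rule has_derivative_eq_rhs) (simp add: J_def mat_simps \<sigma> w\<sigma> fun_eq_iff algebra_simps)
  then have "(S has_derivative (\<lambda>h. J *v h)) (at \<sigma>)"
    by (rule has_derivative_transform_within_open[OF _ half(1) \<sigma>(1)]) (simp add: S)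
  then have "divergence S \<sigma> = trace J" by (rule divergence_eq_trace)
  moreover have "- divergence S \<sigma> - \<beta> * (\<beta> * (p - 1) + p - real CARD('n)) * (\<omega> powr a) * \<Psi> \<sigma> = 0"
  proof -
    have "\<sigma> \<in> upper_hemisphere k" using \<sigma> by (simp add: upper_hemisphere_def half_def)
    moreover have "\<psi> \<sigma> = \<Psi> \<sigma>" using \<sigma> by (simp add: \<Psi>_def radial_ext_def)
    moreover have "sphere_grad \<psi> \<sigma> = g0 \<sigma>" using g0g[OF \<sigma>(1)] by (simp add: sphere_grad_def \<Psi>_def)
    ultimately show ?thesis using prob
      by (simp add: hemisphere_problem_def Let_def sphere_div_def S_def \<omega>_def a_def power2_norm_eq_inner)
  qed
  moreover have "trace J = \<omega> powr a * trace (M0 \<sigma>) + a * \<omega> powr (a - 1) * (2 * \<beta>\<^sup>2 * \<Psi> \<sigma> * (g0 \<sigma> \<bullet> g0 \<sigma>) + 2 * (g0 \<sigma> \<bullet> (M0 \<sigma> *v g0 \<sigma>)))"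
    by (simp add: J_def mat_simps g\<sigma> \<omega>'_def inner_add_right inner_commute[of "g0 \<sigma>" "g0 \<sigma> v* M0 \<sigma>"] dot_lmul_matrix algebra_simps)
  \<comment> \<open>Splitting off one factor \<open>\<omega>\<close> makes
    \<open>\<omega> powr (a - 1)\<close> common to all terms; being positive, it cancels.\<close>
  moreover have "\<omega> powr a = \<omega> powr (a - 1) * \<omega>"
  proof -
    have "\<omega> powr a = \<omega> powr (a - 1) * \<omega> powr 1" by (subst powr_add[symmetric]) simp
    then show ?thesis using \<omega> by simp
  qed
  moreover have "p - 2 = 2 * a" by (simp add: a_def)
  ultimately have "\<omega> powr (a - 1) * (\<omega> * trace (M0 \<sigma>) + (p - 2) * (\<beta>\<^sup>2 * \<Psi> \<sigma> * (g0 \<sigma> \<bullet> g0 \<sigma>) + g0 \<sigma> \<bullet> (M0 \<sigma> *v g0 \<sigma>))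
      + \<beta> * (\<beta> * (p - 1) + p - real CARD('n)) * \<omega> * \<Psi> \<sigma>) = 0"
    by algebra
  then show "\<omega> * trace (M0 \<sigma>) + (p - 2) * (\<beta>\<^sup>2 * \<Psi> \<sigma> * (g0 \<sigma> \<bullet> g0 \<sigma>) + g0 \<sigma> \<bullet> (M0 \<sigma> *v g0 \<sigma>))
      + \<beta> * (\<beta> * (p - 1) + p - real CARD('n)) * \<omega> * \<Psi> \<sigma> = 0"
    using \<omega> by simp
qed

text \<open>The product rule gives explicit derivatives; the spherical equation settles unit vectors
  and homogeneity the rest. Gradient and Hessian are continuous on \<open>chalf\<close> because
  those of \<open>\<Psi>\<close> were extended there.\<close>

lemma p_harmonic:
  obtains g M where "C2_fun half U g M" "continuous_on chalf U" "continuous_on chalf g" "continuous_on chalf M"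
    "\<And>x. x \<in> half \<Longrightarrow> plap p (g x) (M x) = 0"
proof -
  have CU: "Ck_upto 2 half chalf \<Psi>" using C2 by (simp add: C2_closed_hemisphere_def half_def chalf_def \<Psi>_def)
  obtain g0 M0 where g0: "C2_fun half \<Psi> g0 M0" "continuous_on chalf g0" "continuous_on chalf M0"
    "\<And>x. x \<in> half \<Longrightarrow> g0 x = grad \<Psi> x"
    using Ck_upto_2_C2_fun[OF CU half(1,2)] by blast
  have c\<Psi>: "continuous_on chalf \<Psi>" using CU by (simp add: Ck_upto_def)
  obtain ga Ma where ga: "C2_fun (- {0 :: real ^ 'n}) (\<lambda>x. norm x powr (- \<beta>)) ga Ma"
    "\<And>x. norm x = 1 \<Longrightarrow> ga x = (- \<beta>) *\<^sub>R x"
    "\<And>x. norm x = 1 \<Longrightarrow> Ma x = (- \<beta>) *\<^sub>R (mat 1 - outer x x) + (- \<beta> * (- \<beta> - 1)) *\<^sub>R outer x x"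
    using C2_fun_norm_powr by blast
  define g where "g x = \<Psi> x *\<^sub>R ga x + norm x powr (- \<beta>) *\<^sub>R g0 x" for x
  define M where "M x = \<Psi> x *\<^sub>R Ma x + norm x powr (- \<beta>) *\<^sub>R M0 x + (outer (ga x) (g0 x) + outer (g0 x) (ga x))" for x
  have C: "C2_fun half U g M"
    using C2_fun_mult[OF g0(1) C2_fun_subset[OF ga(1) half(1,3)]]
    unfolding U_def[abs_def] g_def[abs_def] M_def[abs_def] .
  note cs = c\<Psi> g0(2,3) C2_funD(2-4)[OF ga(1), THEN continuous_on_subset, OF half(4)]
  have "continuous_on chalf U" "continuous_on chalf g" "continuous_on chalf M"
    unfolding U_def[abs_def] g_def M_def by (intro continuous_intros cs)+
  moreover have "plap p (g x) (M x) = 0" if x: "x \<in> half" for x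
  proof -
    define \<sigma> where "\<sigma> = inverse (norm x) *\<^sub>R x"
    have nx: "norm x > 0" using x half(3) by auto
    have \<sigma>: "\<sigma> \<in> half" "norm \<sigma> = 1" using half(5)[OF _ x, of "inverse (norm x)"] nx by (auto simp: \<sigma>_def)
    have ss: "\<sigma> \<bullet> \<sigma> = 1" using \<sigma>(2) by (simp add: power2_norm_eq_inner[symmetric])
    note eqs = spherical_equation[OF g0(1,4) \<sigma>]
    have bb: "- \<beta> * (- \<beta> - 1) = \<beta> * (\<beta> + 1)" by (simp add: algebra_simps)
    have "plap p (g \<sigma>) (M \<sigma>) = 0"
      unfolding g_def M_def ga(2,3)[OF \<sigma>(2)] \<sigma>(2) powr_one_eq_one scaleR_one bb
      by (rule plap_homogeneous_cone[OF ss eqs(1-3) refl eqs(4)])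
    moreover have "x = norm x *\<^sub>R \<sigma>" using nx by (simp add: \<sigma>_def)
    ultimately show ?thesis
      using C2_fun_homogeneous[OF C half(5), of "- \<beta>" "norm x" \<sigma>] nx \<sigma>(1) plap_scale U_scale
      by (metis mult_zero_right)
  qed
  ultimately show ?thesis using that C by blast
qed

section \<open>Nonvanishing of the gradient of \<open>U\<close> up to the boundary\<close>

lemma grad_nonzero_interior:
  assumes C: "C2_fun half U g M" and x: "x \<in> half"
  shows "g x \<noteq> 0"
proof
  assume "g x = 0"
  \<comment> \<open>Euler's identity for the degree \<open>- \<beta>\<close>: the radial derivative
    is a nonzero multiple of \<open>U x\<close>, which is positive inside.\<close>
  have "g x \<bullet> x = (- \<beta>) *\<^sub>R U x"
    by (rule has_derivative_euler[OF _ C2_funD(5)[OF C x], of "- \<beta>"]) (simp add: U_scale)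
  then show False using \<open>g x = 0\<close> U_pos[OF x] \<beta> by simp
qed

text \<open>Hopf's boundary point lemma: on an annulus in the half space touching \<open>y\<close>, the function \<open>U\<close>
  lies above a multiple of \<open>exp (- a |x - c|\<^sup>2) - exp (- a)\<close>, a strict subsolution for large \<open>a\<close>.\<close>

lemma linear_growth_boundary:
  assumes C: "C2_fun half U g M" and cU: "continuous_on chalf U"
    and pl: "\<And>x. x \<in> half \<Longrightarrow> plap p (g x) (M x) = 0"
    and y: "y $ k = 0" "y \<noteq> 0"
  obtains c where "c > 0" "\<And>t. 0 < t \<Longrightarrow> t < 1 / 2 \<Longrightarrow> c * t \<le> U (y + t *\<^sub>R axis k 1)"
proof -
  define e where "e = (axis k 1 :: real ^ 'n)"
  \<comment> \<open>The unit ball about \<open>z\<close> lies in the half space and touches its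
    boundary at \<open>y\<close>. Its closure avoids the origin, since the square of
    \<open>norm z\<close> exceeds that of \<open>norm y\<close> by \<open>1\<close>.\<close>
  define z where "z = y + e"
  define s where "s x = (x - z) \<bullet> (x - z)" for x
  have ye: "y \<bullet> e = 0" "e \<bullet> e = 1" "norm e = 1" using y by (simp_all add: e_def inner_axis)
  have s_dist: "s x = (dist z x)\<^sup>2" for x by (simp add: s_def dist_norm power2_norm_eq_inner norm_minus_commute)
  have half_ball: "x \<in> half" if "dist z x < 1" for x
  proof -
    have "\<bar>(z - x) $ k\<bar> < 1" using component_le_norm_cart[of "z - x" k] that by (simp add: dist_norm)
    moreover have "z $ k = 1" using y by (simp add: z_def e_def)
    ultimately show ?thesis by (simp add: half_def)
  qed
  have chalf_ball: "x \<in> chalf" if "dist z x \<le> 1" for x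
  proof -
    have "\<bar>(z - x) $ k\<bar> \<le> 1" using component_le_norm_cart[of "z - x" k] that by (simp add: dist_norm)
    moreover have "z $ k = 1" using y by (simp add: z_def e_def)
    moreover have "x \<noteq> 0"
    proof
      assume "x = 0"
      then have "norm z \<le> 1" using that by (simp add: dist_norm)
      then have "(norm z)\<^sup>2 \<le> 1" by (simp add: power_le_one)
      moreover have "(norm z)\<^sup>2 = (norm y)\<^sup>2 + 1"
        unfolding power2_norm_eq_inner z_def using ye by (simp add: inner_add_left inner_add_right inner_commute)
      ultimately show False using y by simp
    qed
    ultimately show ?thesis by (simp add: chalf_def)
  qed
  have U_nn: "U x \<ge> 0" if "x \<in> chalf" for x
    using that U_pos[of x] U_boundary[of x] by (cases "x $ k = 0") (auto simp: chalf_def half_def less_le)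
  have "cball z (1/2) \<subseteq> half" using half_ball by auto
  then have "continuous_on (cball z (1/2)) U" using C2_funD(2)[OF C] continuous_on_subset by blast
  then obtain x0 where x0: "x0 \<in> cball z (1/2)" "\<And>x. x \<in> cball z (1/2) \<Longrightarrow> U x0 \<le> U x"
    using continuous_attains_inf[of "cball z (1/2)" U] by fastforce
  \<comment> \<open>Half the minimum of \<open>U\<close> on the inner ball: the comparison function
    is at most \<open>\<epsilon>\<close> on the inner sphere, hence below \<open>U\<close>
    there.\<close>
  define \<epsilon> where "\<epsilon> = U x0 / 2"
  have "x0 \<in> half" using x0(1) half_ball[of x0] by simp
  then have \<epsilon>: "\<epsilon> > 0" "\<epsilon> < U x0" using U_pos[of x0] by (auto simp: \<epsilon>_def)
  define n where "n = real CARD('n)"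
  have n0: "n > 0" by (simp add: n_def)
  \<comment> \<open>Chosen so that \<open>2 * (a * (p - 1)) * s x\<close> exceeds
    \<open>n + p\<close>, and with it \<open>n + p - 2\<close>, as soon as \<open>s x > 1/4\<close>;
    the difference decides the sign of \<open>plap\<close>.\<close>
  define a where "a = 2 * (n + p) / (p - 1)"
  have a: "a > 0" "a * (p - 1) = 2 * (n + p)" using p n0 by (simp_all add: a_def)
  define f where "f t = \<epsilon> * (exp (- a * t) - exp (- a))" for t
  define D where "D = {x. 1/4 < s x \<and> s x < 1}"
  define A where "A = {x. 1/4 \<le> s x \<and> s x \<le> 1}"
  have cs: "continuous_on S s" for S unfolding s_def by (intro continuous_intros)
  have Dopen: "open D"
    unfolding D_def by (intro open_Collect_conj open_Collect_less cs continuous_intros)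
  have Dhalf: "D \<subseteq> half"
  proof
    fix x assume "x \<in> D"
    then have "(dist z x)\<^sup>2 < 1\<^sup>2" by (simp add: D_def s_dist)
    then have "dist z x < 1" using power_less_imp_less_base zero_le_one by blast
    then show "x \<in> half" by (rule half_ball)
  qed
  have Achalf: "A \<subseteq> chalf"
  proof
    fix x assume "x \<in> A"
    then have "(dist z x)\<^sup>2 \<le> 1\<^sup>2" by (simp add: A_def s_dist)
    then have "dist z x \<le> 1" using power2_le_imp_le zero_le_one by blast
    then show "x \<in> chalf" by (rule chalf_ball)
  qed
  have Acomp: "compact A"
  proof -
    have "closed A" unfolding A_def by (intro closed_Collect_conj closed_Collect_le cs continuous_intros)
    moreover have "A \<subseteq> cball z 1"
    proof
      fix x assume "x \<in> A"
      then have "(dist z x)\<^sup>2 \<le> 1\<^sup>2" by (simp add: A_def s_dist)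
      then have "dist z x \<le> 1" using power2_le_imp_le zero_le_one by blast
      then show "x \<in> cball z 1" by simp
    qed
    ultimately show ?thesis using compact_eq_bounded_closed bounded_subset bounded_cball by blast
  qed
  define gv where "gv x = (- \<epsilon> * a * exp (- a * s x)) *\<^sub>R 2 *\<^sub>R (x - z)" for x
  define Mv where "Mv x = (- \<epsilon> * a * exp (- a * s x)) *\<^sub>R 2 *\<^sub>R mat 1 + (\<epsilon> * a\<^sup>2 * exp (- a * s x)) *\<^sub>R outer (2 *\<^sub>R (x - z)) (2 *\<^sub>R (x - z))" for x
  have v: "C2_fun UNIV (\<lambda>x. f (s x)) gv Mv"
    unfolding gv_def[abs_def] Mv_def[abs_def] s_def
  proof (rule C2_fun_compose[OF C2_fun_norm_sq, where S = UNIV])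
    fix t :: real
    show "(f has_real_derivative - \<epsilon> * a * exp (- a * t)) (at t)"
      unfolding f_def by (auto intro!: derivative_eq_intros)
    show "((\<lambda>t. - \<epsilon> * a * exp (- a * t)) has_real_derivative \<epsilon> * a\<^sup>2 * exp (- a * t)) (at t)"
      by (auto intro!: derivative_eq_intros simp: power2_eq_square)
  qed (auto intro!: continuous_intros)
  have vD: "C2_fun D (\<lambda>x. f (s x)) gv Mv" using C2_fun_subset[OF v Dopen] by simp
  have gv0: "gv x \<noteq> 0" if "x \<in> D" for x
    using that \<epsilon>(1) a(1) by (auto simp: gv_def D_def s_def)
  have plv: "plap p (gv x) (Mv x) > 0" if x: "x \<in> D" for x
  proof -
    define E where "E = exp (- a * s x)"
    have E: "E > 0" by (simp add: E_def)
    have nn: "(norm (2 *\<^sub>R (x - z)))\<^sup>2 = 4 * s x" by (simp add: s_def power_mult_distrib power2_norm_eq_inner)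
    have "norm (2 *\<^sub>R (x - z)) ^ 4 = ((norm (2 *\<^sub>R (x - z)))\<^sup>2)\<^sup>2" by simp
    then have n4: "norm (2 *\<^sub>R (x - z)) ^ 4 = 16 * (s x)\<^sup>2" unfolding nn by (simp add: power_mult_distrib)
    have p0: "plap p (2 *\<^sub>R (x - z)) (2 *\<^sub>R mat 1) = 8 * s x * (n + p - 2)"
      unfolding plap_def nn by (simp add: mat_simps matrix_vector_mult_scaleR n_def s_def[symmetric], simp add: algebra_simps)
    have "plap p (gv x) (Mv x) = (- \<epsilon> * a * E) ^ 3 * (8 * s x * (n + p - 2)) + (p - 1) * (- \<epsilon> * a * E)\<^sup>2 * (\<epsilon> * a\<^sup>2 * E) * (16 * (s x)\<^sup>2)"
      unfolding gv_def Mv_def E_def[symmetric] plap_compose p0 n4 ..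
    also have "\<dots> = \<epsilon> ^ 3 * a ^ 3 * E ^ 3 * (8 * s x) * (2 * (a * (p - 1)) * s x - (n + p - 2))" by algebra
    also have "\<dots> > 0"
    proof -
      have sx: "s x > 1/4" using x by (simp add: D_def)
      have "2 * (a * (p - 1)) * s x > 2 * (2 * (n + p)) * (1/4)"
        unfolding a(2) using sx n0 p by (intro mult_strict_left_mono) auto
      then have "2 * (a * (p - 1)) * s x - (n + p - 2) > 0" by simp
      then show ?thesis using \<epsilon>(1) a(1) E sx by (intro mult_pos_pos) auto
    qed
    finally show ?thesis .
  qed
  obtain J1 where J1: "C1_field D (\<lambda>x. pflux p (gv x)) J1"
    "\<And>x. x \<in> D \<Longrightarrow> trace (J1 x) = norm (gv x) powr (p - 4) * plap p (gv x) (Mv x)"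
    using C1_field_pflux[OF vD gv0] by blast
  have CD: "C2_fun D U g M" by (rule C2_fun_subset[OF C Dopen Dhalf])
  have g0: "g x \<noteq> 0" if "x \<in> D" for x using grad_nonzero_interior[OF C] that Dhalf by blast
  obtain J2 where J2: "C1_field D (\<lambda>x. pflux p (g x)) J2"
    "\<And>x. x \<in> D \<Longrightarrow> trace (J2 x) = norm (g x) powr (p - 4) * plap p (g x) (M x)"
    using C1_field_pflux[OF CD g0] by blast
  have cmp: "f (s x) \<le> U x" if x: "x \<in> D" for x
  proof (rule field_le_epsilon)
    fix \<kappa> :: real assume \<kappa>: "\<kappa> > 0"
    have "\<forall>x\<in>D. f (s x) - U x \<le> \<kappa>"
    proof (rule comparison[OF p C2_funD(7)[OF vD] C2_funD(7)[OF CD] C1_field_weak_div_eq[OF J1(1)] C1_field_weak_div_eq[OF J2(1)]])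
      show "continuous_on D (\<lambda>x. trace (J1 x))" "continuous_on D (\<lambda>x. trace (J2 x))"
        using J1(1) J2(1) by (auto simp: C1_field_def intro!: continuous_intros)
      show "trace (J2 x) < trace (J1 x)" if "x \<in> D" for x
        using plv[OF that] gv0[OF that] pl[of x] that Dhalf by (auto simp: J1(2)[OF that] J2(2)[OF that])
      \<comment> \<open>The slack \<open>\<kappa>\<close> keeps the superlevel set off both spheres:
        on the outer one \<open>f\<close> is \<open>0\<close> and \<open>U\<close> is nonnegative,
        on the inner one \<open>f \<le> \<epsilon> < U\<close>.\<close>
      have "compact {x \<in> A. \<kappa> \<le> f (s x) - U x}"
        by (rule compact_superlevel[OF Acomp])
          (intro continuous_intros continuous_on_subset[OF cU Achalf] continuous_on_subset[OF C2_funD(2)[OF v]], simp)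
      moreover have "{x \<in> A. \<kappa> \<le> f (s x) - U x} = {x \<in> D. \<kappa> \<le> f (s x) - U x}"
      proof -
        have "x \<in> D" if x: "x \<in> A" "\<kappa> \<le> f (s x) - U x" for x
        proof -
          have "s x \<noteq> 1" using x U_nn[of x] Achalf \<kappa> by (auto simp: f_def)
          moreover have "s x \<noteq> 1/4"
          proof
            assume "s x = 1/4"
            then have "(dist z x)\<^sup>2 = (1/2)\<^sup>2" by (simp add: s_dist power2_eq_square)
            then have "dist z x \<le> 1/2" by (simp add: power2_eq_iff_nonneg)
            then have "U x0 \<le> U x" using x0(2) by simp
            moreover have "f (s x) \<le> \<epsilon>"
            proof -
              have "exp (- a * s x) \<le> 1" using \<open>s x = 1/4\<close> a(1) by simp
              then have "exp (- a * s x) - exp (- a) \<le> 1" by (smt (verit) exp_ge_zero)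
              then show ?thesis unfolding f_def using \<epsilon>(1) mult_left_le by auto
            qed
            ultimately show False using x(2) \<epsilon>(2) \<kappa> by linarith
          qed
          ultimately show ?thesis using x(1) by (auto simp: A_def D_def)
        qed
        then show ?thesis by (auto simp: A_def D_def)
      qed
      ultimately show "compact {x \<in> D. \<kappa> \<le> f (s x) - U x}" by simp
    qed
    then show "f (s x) \<le> U x + \<kappa>" using x by (simp add: algebra_simps)
  qed
  define c where "c = \<epsilon> * exp (- a) * a"
  show thesis
  proof (rule that)
    show "c > 0" using \<epsilon>(1) a(1) by (simp add: c_def)
    fix t :: real assume t: "0 < t" "t < 1/2"
    let ?x = "y + t *\<^sub>R axis k 1"
    have "?x - z = (t - 1) *\<^sub>R e" by (simp add: z_def e_def algebra_simps)
    then have "s ?x = ((t - 1) *\<^sub>R e) \<bullet> ((t - 1) *\<^sub>R e)" by (simp only: s_def)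
    then have sx: "s ?x = (1 - t)\<^sup>2" by (simp add: ye power2_eq_square algebra_simps)
    have "(1/2)\<^sup>2 < (1 - t)\<^sup>2" using t by (intro power_strict_mono) auto
    moreover have "(1 - t)\<^sup>2 < 1" using t by (simp add: power_less_one_iff abs_square_less_1)
    ultimately have "?x \<in> D" by (simp add: D_def sx power2_eq_square)
    then have "f (s ?x) \<le> U ?x" by (rule cmp)
    moreover have "c * t \<le> f (s ?x)"
    proof -
      \<comment> \<open>This and \<open>exp r - 1 \<ge> r\<close> give the linear lower bound with
        slope \<open>c\<close>.\<close>
      have "t \<le> 1 - (1 - t)\<^sup>2" using t by (simp add: power2_eq_square algebra_simps mult_left_le)
      then have "a * t \<le> a - a * (1 - t)\<^sup>2" using a(1) by (metis mult.right_neutral mult_left_mono less_imp_le right_diff_distrib)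
      also have "\<dots> \<le> exp (a - a * (1 - t)\<^sup>2) - 1" using exp_ge_add_one_self[of "a - a * (1 - t)\<^sup>2"] by linarith
      finally have "exp (- a) * (a * t) \<le> exp (- a) * (exp (a - a * (1 - t)\<^sup>2) - 1)" by (intro mult_left_mono) auto
      also have "\<dots> = exp (- a * (1 - t)\<^sup>2) - exp (- a)"
        by (simp add: right_diff_distrib exp_add[symmetric])
      finally have "\<epsilon> * (exp (- a) * (a * t)) \<le> \<epsilon> * (exp (- a * (1 - t)\<^sup>2) - exp (- a))" using \<epsilon>(1) by (intro mult_left_mono) auto
      then show ?thesis by (simp add: f_def sx c_def mult_ac)
    qed
    ultimately show "c * t \<le> U ?x" by linarith
  qed
qed

text \<open>If the gradient vanished at \<open>y\<close>, continuity would make it shorter than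
  \<open>c\<close> nearby, whereas the mean value theorem along the inner normal turns the linear
  growth of \<open>U\<close> into a normal derivative of at least \<open>c\<close> at some point
  close to \<open>y\<close>.\<close>

lemma grad_nonzero_boundary:
  assumes C: "C2_fun half U g M" and cU: "continuous_on chalf U" and cg: "continuous_on chalf g"
    and pl: "\<And>x. x \<in> half \<Longrightarrow> plap p (g x) (M x) = 0"
    and y: "y $ k = 0" "y \<noteq> 0"
  shows "g y \<noteq> 0"
proof
  assume gy: "g y = 0"
  obtain c where c: "c > 0" "\<And>t. 0 < t \<Longrightarrow> t < 1 / 2 \<Longrightarrow> c * t \<le> U (y + t *\<^sub>R axis k 1)"
    using linear_growth_boundary[OF C cU pl y] by blast
  have ych: "y \<in> chalf" using y by (simp add: chalf_def)
  obtain d where d: "d > 0" "\<And>x. x \<in> chalf \<Longrightarrow> dist x y < d \<Longrightarrow> dist (g x) (g y) < c"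
    using cg ych c(1) unfolding continuous_on_iff by meson
  define t where "t = min (1/4) (d / 2)"
  have t: "t > 0" "t < 1/2" "t < d" using d(1) by (auto simp: t_def)
  define e where "e = (axis k 1 :: real ^ 'n)"
  have ne: "norm e = 1" by (simp add: e_def)
  have inh: "y + r *\<^sub>R e \<in> half" if "r > 0" for r using that y by (simp add: half_def e_def)
  have inch: "y + r *\<^sub>R e \<in> chalf" if "r \<ge> 0" for r using that inh[of r] half(2) ych by (cases "r = 0") auto
  obtain \<xi> where \<xi>: "0 < \<xi>" "\<xi> < t" "U (y + t *\<^sub>R e) - U (y + 0 *\<^sub>R e) = (t - 0) * (g (y + \<xi> *\<^sub>R e) \<bullet> e)"
  proof (rule mvt[OF t(1), of "\<lambda>r. U (y + r *\<^sub>R e)" "\<lambda>r h. h * (g (y + r *\<^sub>R e) \<bullet> e)"])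
    show "continuous_on {0..t} (\<lambda>r. U (y + r *\<^sub>R e))"
      by (intro continuous_on_compose2[OF cU] continuous_intros) (use inch in auto)
    fix r assume r: "0 < r" "r < t"
    show "((\<lambda>r. U (y + r *\<^sub>R e)) has_derivative (\<lambda>h. h * (g (y + r *\<^sub>R e) \<bullet> e))) (at r)"
      using has_derivative_compose[OF has_derivative_add[OF has_derivative_const[of y] has_derivative_scaleR_left[OF has_derivative_ident, of e]]
          C2_funD(5)[OF C inh[OF r(1)]]] by simp
  qed
  have "c * t \<le> t * (g (y + \<xi> *\<^sub>R e) \<bullet> e)"
    using c(2)[OF t(1,2)] \<xi>(3) U_boundary[OF y(1)] by (simp add: e_def)
  then have "c \<le> g (y + \<xi> *\<^sub>R e) \<bullet> e" using t(1) by (simp add: mult.commute)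
  also have "\<dots> \<le> norm (g (y + \<xi> *\<^sub>R e))" using norm_cauchy_schwarz[of "g (y + \<xi> *\<^sub>R e)" e] ne by simp
  also have "\<dots> < c"
    using d(2)[OF inch, of \<xi>] \<xi> t(3) gy ne by (simp add: dist_norm)
  finally show False by simp
qed

section \<open>Perturbation to a larger cone\<close>

text \<open>\<open>A\<close> will be an orthogonal matrix taking the inner normal
  \<open>\<nu>\<close> to \<open>axis k 1\<close>. The second term lifts the cone
  \<open>- \<eta> * norm x < x \<bullet> \<nu>\<close> into the half space; its factor
  \<open>norm x\<close> makes the map positively homogeneous, so that composing with
  \<open>U\<close> keeps the degree \<open>- \<beta>\<close>.\<close>

definition T :: "real ^ 'n ^ 'n \<Rightarrow> real \<Rightarrow> real ^ 'n \<Rightarrow> real ^ 'n" where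
  "T A \<eta> x = A *v x + (\<eta> * norm x) *\<^sub>R axis k 1"

definition DT :: "real ^ 'n ^ 'n \<Rightarrow> real \<Rightarrow> real ^ 'n \<Rightarrow> real ^ 'n ^ 'n" where
  "DT A \<eta> x = A + \<eta> *\<^sub>R outer (axis k 1) ((1 / norm x) *\<^sub>R x)"

definition gV :: "(real ^ 'n \<Rightarrow> real ^ 'n) \<Rightarrow> real ^ 'n ^ 'n \<Rightarrow> real \<Rightarrow> real ^ 'n \<Rightarrow> real ^ 'n" where
  "gV g A \<eta> x = g (T A \<eta> x) v* A + (\<eta> * g (T A \<eta> x) $ k) *\<^sub>R ((1 / norm x) *\<^sub>R x)"

text \<open>The Hessian of \<open>U\<close> composed with \<open>T A \<eta>\<close>, where
  \<open>DT\<close> is the Jacobian; the last summand stems from the second derivative of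
  \<open>T\<close>, that is, from the Hessian of the norm.\<close>

definition MV :: "(real ^ 'n \<Rightarrow> real ^ 'n) \<Rightarrow> (real ^ 'n \<Rightarrow> real ^ 'n ^ 'n) \<Rightarrow> real ^ 'n ^ 'n \<Rightarrow> real \<Rightarrow> real ^ 'n \<Rightarrow> real ^ 'n ^ 'n" where
  "MV g M A \<eta> x = transpose (DT A \<eta> x) ** (M (T A \<eta> x) ** DT A \<eta> x)
     + (\<eta> * g (T A \<eta> x) $ k) *\<^sub>R ((1 / norm x) *\<^sub>R mat 1 - (1 / norm x ^ 3) *\<^sub>R outer x x)"

lemma T_scale: "t > 0 \<Longrightarrow> T A \<eta> (t *\<^sub>R x) = t *\<^sub>R T A \<eta> x"
  by (simp add: T_def matrix_vector_mult_scaleR algebra_simps)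

lemma C2_fun_V:
  assumes C: "C2_fun half U g M" and D: "open D" "0 \<notin> D" "\<And>x. x \<in> D \<Longrightarrow> T A \<eta> x \<in> half"
  shows "C2_fun D (\<lambda>x. U (T A \<eta> x)) (gV g A \<eta>) (MV g M A \<eta>)"
proof (rule C2_funI[OF D(1)])
  let ?n = "\<lambda>x::real^'n. (1 / norm x) *\<^sub>R x"
  let ?N = "\<lambda>x::real^'n. (1 / norm x) *\<^sub>R mat 1 - (1 / norm x ^ 3) *\<^sub>R outer x x"
  have sub: "D \<subseteq> - {0}" using D(2) by auto
  note cn = C2_funD(2-4)[OF C2_fun_norm, THEN continuous_on_subset, OF sub]
  have cT: "continuous_on D (T A \<eta>)" unfolding T_def by (intro continuous_intros)
  have TD: "T A \<eta> ` D \<subseteq> half" using D(3) by auto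
  show "continuous_on D (MV g M A \<eta>)"
    unfolding MV_def DT_def transpose_def
    by (intro continuous_intros cn continuous_on_compose2[OF C2_funD(3)[OF C] cT TD] continuous_on_compose2[OF C2_funD(4)[OF C] cT TD])
  fix x assume x: "x \<in> D"
  then have x0: "x \<in> - {0}" using D(2) by auto
  have dT: "(T A \<eta> has_derivative (\<lambda>h. DT A \<eta> x *v h)) (at x)"
    unfolding T_def
    by (rule derivative_eq_intros refl C2_funD(5)[OF C2_fun_norm x0] bounded_linear_imp_has_derivative matrix_vector_mul_bounded_linear)+
      (simp add: DT_def mat_simps fun_eq_iff)
  have "((\<lambda>x. U (T A \<eta> x)) has_derivative (\<lambda>h. g (T A \<eta> x) \<bullet> (DT A \<eta> x *v h))) (at x)"
    by (rule has_derivative_compose[OF dT C2_funD(5)[OF C D(3)[OF x]]])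
  then show "((\<lambda>x. U (T A \<eta> x)) has_derivative (\<lambda>h. gV g A \<eta> x \<bullet> h)) (at x)"
    by (rule has_derivative_eq_rhs)
      (simp add: gV_def DT_def mat_simps fun_eq_iff inner_add_left inner_add_right dot_lmul_matrix inner_axis mult_ac)
  have dg: "((\<lambda>x. g (T A \<eta> x)) has_derivative (\<lambda>h. M (T A \<eta> x) *v (DT A \<eta> x *v h))) (at x)"
    by (rule has_derivative_compose[OF dT C2_funD(6)[OF C D(3)[OF x]]])
  have lin: "bounded_linear (\<lambda>v. v v* A)"
    using matrix_vector_mul_bounded_linear[of "transpose A"] by (simp only: transpose_matrix_vector[abs_def])
  have dgk: "((\<lambda>x. \<eta> * g (T A \<eta> x) $ k) has_derivative (\<lambda>h. \<eta> * (M (T A \<eta> x) *v (DT A \<eta> x *v h)) $ k)) (at x)"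
    by (intro has_derivative_mult_right bounded_linear.has_derivative[OF bounded_linear_vec_nth dg])
  have tr: "v v* DT A \<eta> x = v v* A + (\<eta> * v $ k) *\<^sub>R ?n x" for v
  proof -
    have "(v v* DT A \<eta> x) \<bullet> h = (v v* A + (\<eta> * v $ k) *\<^sub>R ?n x) \<bullet> h" for h
      by (simp add: dot_lmul_matrix DT_def mat_simps inner_add_left inner_add_right inner_axis mult_ac)
    then show ?thesis by (metis vector_eq_rdot)
  qed
  show "(gV g A \<eta> has_derivative (\<lambda>h. MV g M A \<eta> x *v h)) (at x)"
    unfolding gV_def
    using has_derivative_add[OF bounded_linear.has_derivative[OF lin dg] has_derivative_scaleR[OF dgk C2_funD(6)[OF C2_fun_norm x0]]]
    by (rule has_derivative_eq_rhs)
      (simp add: MV_def matrix_vector_mult_add_rdistrib matrix_vector_mul_assoc[symmetric] transpose_matrix_vector tr scaleR_matrix_vector_assoc[symmetric] fun_eq_iff)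
qed

lemma plap_orthogonal:
  fixes A M :: "real ^ 'n ^ 'n"
  assumes "orthogonal_matrix A"
  shows "plap p (g v* A) (transpose A ** (M ** A)) = plap p g M" and "norm (g v* A) = norm g"
proof -
  have AA: "A ** transpose A = mat 1" "transpose A ** A = mat 1" using assms by (auto simp: orthogonal_matrix_def)
  have Ag: "A *v (g v* A) = g"
    unfolding transpose_matrix_vector[symmetric] matrix_vector_mul_assoc AA by simp
  have "(g v* A) \<bullet> (g v* A) = g \<bullet> g" by (simp add: dot_lmul_matrix Ag)
  then show n: "norm (g v* A) = norm g" by (simp add: norm_eq_sqrt_inner)
  have "trace (transpose A ** (M ** A)) = trace (M ** (A ** transpose A))"
    by (subst trace_mul_sym) (simp only: matrix_mul_assoc)
  moreover have "(g v* A) \<bullet> (transpose A ** (M ** A) *v (g v* A)) = g \<bullet> (M *v g)"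
  proof -
    have "(g v* A) \<bullet> (transpose A ** (M ** A) *v (g v* A)) = g \<bullet> (A *v (transpose A *v (M *v (A *v (g v* A)))))"
      by (simp only: dot_lmul_matrix matrix_vector_mul_assoc[symmetric])
    also have "A *v (transpose A *v (M *v (A *v (g v* A)))) = M *v g"
      unfolding Ag by (simp only: matrix_vector_mul_assoc[of A] AA matrix_vector_mul_lid)
    finally show ?thesis .
  qed
  ultimately show "plap p (g v* A) (transpose A ** (M ** A)) = plap p g M"
    by (simp add: plap_def n AA)
qed

text \<open>The inequality holds for \<open>\<eta> = 0\<close> on the closed half sphere: in the interior \<open>plap\<close> vanishes, on the
  boundary \<open>U\<close> does, and the gradient vanishes nowhere. It is multiplied through by \<open>U\<close> so that both
  sides extend continuously to the boundary.\<close>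

lemma perturbed_supersolution:
  fixes \<nu> :: "real ^ 'n"
  assumes C: "C2_fun half U g M" and cU: "continuous_on chalf U" and cg: "continuous_on chalf g" and cM: "continuous_on chalf M"
    and pl: "\<And>x. x \<in> half \<Longrightarrow> plap p (g x) (M x) = 0"
    and A: "orthogonal_matrix A" and Ak: "\<And>x. (A *v x) $ k = x \<bullet> \<nu>"
    and \<theta>: "\<theta> < 1"
  obtains \<eta> where "\<eta> > 0"
    "\<And>x. norm x = 1 \<Longrightarrow> x \<bullet> \<nu> + \<eta> > 0 \<Longrightarrow>
      U (T A \<eta> x) * plap p (gV g A \<eta> x) (MV g M A \<eta> x) < (p - 1) * (1 - \<theta>) * norm (gV g A \<eta> x) ^ 4"
proof -
  define Q where "Q = (\<lambda>(\<eta>, x). U (T A \<eta> x) * plap p (gV g A \<eta> x) (MV g M A \<eta> x) - (p - 1) * (1 - \<theta>) * norm (gV g A \<eta> x) ^ 4)"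
  \<comment> \<open>\<open>K\<close> includes the pairs with \<open>\<eta> = 0\<close>, where the
    inequality is known. The bound \<open>1/2\<close> keeps \<open>T A \<eta> x\<close> away from
    \<open>0\<close>, as \<open>A\<close> preserves the norm.\<close>
  define K where "K = {(\<eta>::real, x). 0 \<le> \<eta> \<and> \<eta> \<le> 1/2 \<and> norm x = 1 \<and> 0 \<le> x \<bullet> \<nu> + \<eta>}"
  have Kc: "compact K"
  proof -
    have "K = ({0..1/2} \<times> sphere 0 1) \<inter> {z. 0 \<le> snd z \<bullet> \<nu> + fst z}" by (auto simp: K_def)
    moreover have "compact ({0..1/2::real} \<times> sphere (0::real^'n) 1)" by (intro compact_Times) auto
    moreover have "closed {z::real \<times> (real^'n). 0 \<le> snd z \<bullet> \<nu> + fst z}"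
      by (intro closed_Collect_le continuous_intros)
    ultimately show ?thesis by (simp add: compact_Int_closed)
  qed
  have Tk: "T A \<eta> x $ k = x \<bullet> \<nu> + \<eta> * norm x" for \<eta> x by (simp add: T_def Ak)
  have nA: "norm (A *v x) = norm x" for x
    using A orthogonal_transformation_matrix[of "\<lambda>x. A *v x"] orthogonal_transformation_norm by auto
  have TK: "T A (fst z) (snd z) \<in> chalf" if "z \<in> K" for z
  proof -
    obtain \<eta> x where z: "z = (\<eta>, x)" "0 \<le> \<eta>" "\<eta> \<le> 1/2" "norm x = 1" "0 \<le> x \<bullet> \<nu> + \<eta>" using \<open>z \<in> K\<close> by (auto simp: K_def)
    have "norm (A *v x) - norm ((\<eta> * norm x) *\<^sub>R axis k (1::real)) \<le> norm (T A \<eta> x)"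
      unfolding T_def by (metis norm_diff_ineq)
    then have "T A \<eta> x \<noteq> 0" using z by (auto simp: nA)
    then show ?thesis using z by (simp add: chalf_def Tk)
  qed
  have nzK: "norm (snd z) \<noteq> 0" if "z \<in> K" for z using that by (auto simp: K_def)
  have cT: "continuous_on K (\<lambda>z. T A (fst z) (snd z))" unfolding T_def by (intro continuous_intros)
  have TKs: "(\<lambda>z. T A (fst z) (snd z)) ` K \<subseteq> chalf" using TK by auto
  have cQ: "continuous_on K Q"
    unfolding Q_def case_prod_unfold plap_def gV_def MV_def DT_def transpose_def
    by (intro continuous_intros continuous_on_compose2[OF cU cT TKs] continuous_on_compose2[OF cg cT TKs] continuous_on_compose2[OF cM cT TKs])
      (use nzK in auto)
  have Q0: "Q (0, x) < 0" if "(0, x) \<in> K" for x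
  proof -
    have Tc: "T A 0 x \<in> chalf" using TK[OF that] by simp
    have gv: "gV g A 0 x = g (T A 0 x) v* A" "MV g M A 0 x = transpose A ** (M (T A 0 x) ** A)"
      by (simp_all add: gV_def MV_def DT_def)
    have g0: "g (T A 0 x) \<noteq> 0"
      using Tc grad_nonzero_interior[OF C, of "T A 0 x"] grad_nonzero_boundary[OF C cU cg pl, of "T A 0 x"]
      by (cases "T A 0 x $ k = 0") (auto simp: chalf_def half_def less_le)
    have "U (T A 0 x) * plap p (g (T A 0 x)) (M (T A 0 x)) = 0"
      using Tc pl[of "T A 0 x"] U_boundary[of "T A 0 x"]
      by (cases "T A 0 x $ k = 0") (auto simp: chalf_def half_def less_le)
    then have "Q (0, x) = - ((p - 1) * (1 - \<theta>) * norm (g (T A 0 x)) ^ 4)"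
      by (simp add: Q_def gv plap_orthogonal[OF A])
    then show ?thesis using p \<theta> g0 by simp
  qed
  \<comment> \<open>The pairs violating the inequality form a compact set without points at
    \<open>\<eta> = 0\<close>, so their parameters have a positive minimum; half of it is
    admissible.\<close>
  define B where "B = {z \<in> K. 0 \<le> Q z}"
  have Bc: "compact B" unfolding B_def by (rule compact_superlevel[OF Kc cQ])
  have "\<exists>\<eta>>0. \<eta> \<le> 1/2 \<and> (\<forall>z\<in>B. \<eta> < fst z)"
  proof (cases "B = {}")
    case True
    then show ?thesis by (intro exI[of _ "1/2"]) auto
  next
    case False
    have "continuous_on B fst" by (intro continuous_intros)
    then obtain z0 where z0: "z0 \<in> B" "\<And>z. z \<in> B \<Longrightarrow> fst z0 \<le> fst z"
      using continuous_attains_inf[OF Bc False] by blast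
    obtain \<eta>0 x0 where z0e: "z0 = (\<eta>0, x0)" by (cases z0)
    have \<eta>0: "0 \<le> \<eta>0" "\<eta>0 \<le> 1/2" using z0(1) z0e by (auto simp: B_def K_def)
    moreover have "\<eta>0 \<noteq> 0" using z0(1) z0e Q0[of x0] by (auto simp: B_def)
    ultimately show ?thesis using z0(2) z0e by (intro exI[of _ "\<eta>0 / 2"]) fastforce
  qed
  then obtain \<eta> where \<eta>: "\<eta> > 0" "\<eta> \<le> 1/2" "\<And>z. z \<in> B \<Longrightarrow> \<eta> < fst z" by blast
  show thesis
  proof (rule that[OF \<eta>(1)])
    fix x assume "norm x = 1" "x \<bullet> \<nu> + \<eta> > 0"
    then have "(\<eta>, x) \<in> K" using \<eta> by (simp add: K_def)
    moreover have "(\<eta>, x) \<notin> B" using \<eta>(3) by force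
    ultimately have "Q (\<eta>, x) < 0" by (auto simp: B_def)
    then show "U (T A \<eta> x) * plap p (gV g A \<eta> x) (MV g M A \<eta> x) < (p - 1) * (1 - \<theta>) * norm (gV g A \<eta> x) ^ 4"
      by (simp add: Q_def)
  qed
qed

text \<open>The outer function \<open>t powr \<theta>\<close> is concave, and its second derivative
  yields exactly the term by which the perturbed \<open>U\<close> was allowed to fail
  superharmonicity. The bounds follow by homogeneity from compactness of a cap of the unit
  sphere.\<close>

lemma barrier:
  fixes \<nu> :: "real ^ 'n"
  assumes \<nu>: "norm \<nu> = 1" and \<theta>: "0 < \<theta>" "\<theta> < 1"
  obtains \<delta> c W gW MW L where "\<delta> > 0" "c > 0"
    "C2_fun {x. - \<delta> * norm x < x \<bullet> \<nu>} W gW MW"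
    "\<And>x. - \<delta> * norm x < x \<bullet> \<nu> \<Longrightarrow> gW x \<noteq> 0"
    "\<And>x. - \<delta> * norm x < x \<bullet> \<nu> \<Longrightarrow> plap p (gW x) (MW x) \<le> 0"
    "\<And>x. - \<delta> * norm x < x \<bullet> \<nu> \<Longrightarrow> c * norm x powr (- \<theta> * \<beta>) \<le> W x"
    "\<And>x. - \<delta> * norm x < x \<bullet> \<nu> \<Longrightarrow> W x \<le> L * norm x powr (- \<theta> * \<beta>)"
    "\<And>x. - \<delta> * norm x < x \<bullet> \<nu> \<Longrightarrow> norm (gW x) \<le> L * norm x powr (- \<theta> * \<beta> - 1)"
proof -
  obtain g M where C: "C2_fun half U g M" and cU: "continuous_on chalf U" and cg: "continuous_on chalf g" and cM: "continuous_on chalf M"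
    and pl: "\<And>x. x \<in> half \<Longrightarrow> plap p (g x) (M x) = 0"
    using p_harmonic by blast
  have n\<nu>: "norm \<nu> = norm (axis k (1::real))" by (simp add: \<nu>)
  obtain F :: "real ^ 'n \<Rightarrow> real ^ 'n" where F: "orthogonal_transformation F" "F \<nu> = axis k 1"
    by (rule orthogonal_transformation_exists[OF n\<nu>])
  define A where "A = matrix F"
  have AF: "A *v x = F x" for x
    unfolding A_def using matrix_works[of F x] orthogonal_transformation_linear[OF F(1)] by (simp add: linear_matrix_vector_mul_eq)
  have A: "orthogonal_matrix A" using F(1) by (simp add: orthogonal_transformation_matrix A_def)
  have Ak: "(A *v x) $ k = x \<bullet> \<nu>" for x
  proof -
    have "(A *v x) $ k = F x \<bullet> F \<nu>" by (simp add: AF F(2) inner_axis)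
    then show ?thesis using F(1) by (simp add: orthogonal_transformation_def)
  qed
  obtain \<eta> where \<eta>: "\<eta> > 0"
    "\<And>x. norm x = 1 \<Longrightarrow> x \<bullet> \<nu> + \<eta> > 0 \<Longrightarrow>
      U (T A \<eta> x) * plap p (gV g A \<eta> x) (MV g M A \<eta> x) < (p - 1) * (1 - \<theta>) * norm (gV g A \<eta> x) ^ 4"
    using perturbed_supersolution[OF C cU cg cM pl A Ak \<theta>(2)] by blast
  define D where "D = {x. - \<eta> * norm x < x \<bullet> \<nu>}"
  have Dopen: "open D" unfolding D_def by (intro open_Collect_less continuous_intros)
  have D0: "0 \<notin> D" by (simp add: D_def)
  have Dcone: "t *\<^sub>R x \<in> D" if "t > 0" "x \<in> D" for t x
  proof -
    have "t * (- \<eta> * norm x) < t * (x \<bullet> \<nu>)" using that by (intro mult_strict_left_mono) (auto simp: D_def)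
    then show ?thesis using that by (simp add: D_def mult_ac)
  qed
  have TD: "T A \<eta> x \<in> half" if "x \<in> D" for x
    using that by (simp add: D_def half_def T_def Ak)
  define V where "V x = U (T A \<eta> x)" for x
  have Vpos: "V x > 0" if "x \<in> D" for x using U_pos[OF TD[OF that]] by (simp add: V_def)
  have CV: "C2_fun D V (gV g A \<eta>) (MV g M A \<eta>)"
    unfolding V_def[abs_def] by (rule C2_fun_V[OF C Dopen D0 TD])
  define W where "W x = V x powr \<theta>" for x
  define gW where "gW x = (\<theta> * V x powr (\<theta> - 1)) *\<^sub>R gV g A \<eta> x" for x
  define MW where "MW x = (\<theta> * V x powr (\<theta> - 1)) *\<^sub>R MV g M A \<eta> x
     + (\<theta> * ((\<theta> - 1) * V x powr (\<theta> - 1 - 1))) *\<^sub>R outer (gV g A \<eta> x) (gV g A \<eta> x)" for x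
  have CW: "C2_fun D W gW MW"
    unfolding W_def[abs_def] gW_def[abs_def] MW_def[abs_def]
  proof (rule C2_fun_compose[OF CV, where S = "{0<..}"])
    show "V ` D \<subseteq> {0<..}" using Vpos by auto
    fix t :: real assume t: "t \<in> {0<..}"
    then show "((\<lambda>t. t powr \<theta>) has_real_derivative \<theta> * t powr (\<theta> - 1)) (at t)"
      by (auto intro: has_real_derivative_powr)
    show "((\<lambda>t. \<theta> * t powr (\<theta> - 1)) has_real_derivative \<theta> * ((\<theta> - 1) * t powr (\<theta> - 1 - 1))) (at t)"
      using t by (intro DERIV_cmult has_real_derivative_powr) auto
  qed (auto intro!: continuous_intros)
  have Wscale: "W (t *\<^sub>R x) = t powr (- \<theta> * \<beta>) * W x" if "t > 0" "x \<in> D" for t x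
    using that by (simp add: W_def V_def T_scale U_scale powr_mult powr_powr mult.commute)
  have scale: "gW (t *\<^sub>R x) = t powr (- \<theta> * \<beta> - 1) *\<^sub>R gW x" "MW (t *\<^sub>R x) = t powr (- \<theta> * \<beta> - 2) *\<^sub>R MW x"
    if "t > 0" "x \<in> D" for t x
    by (rule C2_fun_homogeneous[OF CW]; use that Dcone Wscale in blast)+
  have unit: "gW x \<noteq> 0 \<and> plap p (gW x) (MW x) \<le> 0" if x: "x \<in> D" "norm x = 1" for x
  proof -
    have Q: "V x * plap p (gV g A \<eta> x) (MV g M A \<eta> x) < (p - 1) * (1 - \<theta>) * norm (gV g A \<eta> x) ^ 4"
      using \<eta>(2)[OF x(2)] x by (simp add: D_def V_def)
    \<comment> \<open>Strictness is used here: with a vanishing gradient both sides would be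
      \<open>0\<close>.\<close>
    then have gv: "gV g A \<eta> x \<noteq> 0" by (auto simp: plap_def)
    then have "gW x \<noteq> 0" using Vpos[OF x(1)] \<theta> by (simp add: gW_def)
    moreover have "plap p (gW x) (MW x) \<le> 0"
    proof -
      define f where "f = \<theta> * V x powr (\<theta> - 1)"
      define v where "v = V x powr (\<theta> - 1 - 1)"
      have "V x powr (\<theta> - 1) = v * V x powr 1" unfolding v_def by (subst powr_add[symmetric]) simp
      then have f: "f = \<theta> * (v * V x)" using Vpos[OF x(1)] by (simp add: f_def)
      have v: "v > 0" using Vpos[OF x(1)] by (simp add: v_def)
      have "plap p (gW x) (MW x) = f ^ 3 * plap p (gV g A \<eta> x) (MV g M A \<eta> x) + (p - 1) * f\<^sup>2 * (\<theta> * ((\<theta> - 1) * v)) * norm (gV g A \<eta> x) ^ 4"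
        unfolding gW_def MW_def f_def[symmetric] v_def[symmetric] plap_compose ..
      \<comment> \<open>Since \<open>f = \<theta> * (v * V x)\<close>, one factor of the cube
        supplies the \<open>V x\<close> by which the perturbed inequality is multiplied.\<close>
      also have "\<dots> = (f\<^sup>2 * \<theta> * v) * (V x * plap p (gV g A \<eta> x) (MV g M A \<eta> x) - (p - 1) * (1 - \<theta>) * norm (gV g A \<eta> x) ^ 4)"
        using f by algebra
      also have "\<dots> \<le> 0" using Q v \<theta> by (intro mult_nonneg_nonpos) auto
      finally show ?thesis .
    qed
    ultimately show ?thesis ..
  qed
  have norm1: "\<exists>s. s \<in> D \<and> norm s = 1 \<and> x = norm x *\<^sub>R s" if "x \<in> D" for x
  proof -
    have "norm x > 0" using that D0 by auto
    then show ?thesis using Dcone[of "inverse (norm x)" x] that by (intro exI[of _ "inverse (norm x) *\<^sub>R x"]) auto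
  qed
  have all: "gW x \<noteq> 0 \<and> plap p (gW x) (MW x) \<le> 0" if x: "x \<in> D" for x
  proof -
    obtain s where s: "s \<in> D" "norm s = 1" "x = norm x *\<^sub>R s" using norm1[OF x] by blast
    have n: "norm x > 0" using x D0 by auto
    have "gW x = norm x powr (- \<theta> * \<beta> - 1) *\<^sub>R gW s" "MW x = norm x powr (- \<theta> * \<beta> - 2) *\<^sub>R MW s"
      using scale[OF n s(1)] s(3) by auto
    then show ?thesis using unit[OF s(1,2)] n by (simp add: plap_scale mult_nonneg_nonpos)
  qed
  \<comment> \<open>At the edge of the full cone \<open>V\<close> vanishes, so \<open>W\<close> has
    no positive lower bound there. Halving the excess over the half space leaves a compact cap
    inside \<open>D\<close>.\<close>
  define \<delta> where "\<delta> = \<eta> / 2"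
  have \<delta>: "\<delta> > 0" "\<delta> < \<eta>" using \<eta>(1) by (auto simp: \<delta>_def)
  define D' where "D' = {x. - \<delta> * norm x < x \<bullet> \<nu>}"
  define K where "K = {x \<in> sphere 0 1. - \<delta> \<le> x \<bullet> \<nu>}"
  have Kc: "compact K" unfolding K_def by (rule compact_superlevel) (auto intro!: continuous_intros)
  have KD: "K \<subseteq> D" using \<delta> by (auto simp: K_def D_def)
  have D'D: "D' \<subseteq> D"
  proof
    fix x assume x: "x \<in> D'"
    have "- \<eta> * norm x \<le> - \<delta> * norm x" using \<delta> by (intro mult_right_mono) auto
    then show "x \<in> D" using x by (simp add: D_def D'_def)
  qed
  have D'open: "open D'" unfolding D'_def by (intro open_Collect_less continuous_intros)
  have \<nu>K: "\<nu> \<in> K" using \<nu> \<delta>(1) by (simp add: K_def power2_norm_eq_inner[symmetric])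
  have cW: "continuous_on K W" "continuous_on K (\<lambda>x. norm (gW x))"
    using C2_funD(2,3)[OF CW] KD by (auto intro!: continuous_intros intro: continuous_on_subset)
  have Kne: "K \<noteq> {}" using \<nu>K by auto
  obtain a where a: "a \<in> K" "\<And>x. x \<in> K \<Longrightarrow> W a \<le> W x" using continuous_attains_inf[OF Kc Kne cW(1)] by blast
  obtain b where b: "b \<in> K" "\<And>x. x \<in> K \<Longrightarrow> W x \<le> W b" using continuous_attains_sup[OF Kc Kne cW(1)] by blast
  obtain d where d: "d \<in> K" "\<And>x. x \<in> K \<Longrightarrow> norm (gW x) \<le> norm (gW d)" using continuous_attains_sup[OF Kc Kne cW(2)] by blast
  have bnd: "W a * norm x powr (- \<theta> * \<beta>) \<le> W x \<and> W x \<le> max (W b) (norm (gW d)) * norm x powr (- \<theta> * \<beta>) \<and>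
      norm (gW x) \<le> max (W b) (norm (gW d)) * norm x powr (- \<theta> * \<beta> - 1)" if x: "x \<in> D'" for x
  proof -
    have xD: "x \<in> D" using D'D x by auto
    obtain s where s: "s \<in> D" "norm s = 1" "x = norm x *\<^sub>R s" using norm1[OF xD] by blast
    have n: "norm x > 0" using xD D0 by auto
    have "norm x * (- \<delta>) < norm x * (s \<bullet> \<nu>)" using x s(3) unfolding D'_def
      by (metis (mono_tags, lifting) inner_scaleR_left mem_Collect_eq mult.commute)
    then have "- \<delta> < s \<bullet> \<nu>" using n mult_less_cancel_left_pos by blast
    then have "s \<in> K" using s(2) by (simp add: K_def)
    then have "W a \<le> W s" "W s \<le> max (W b) (norm (gW d))" "norm (gW s) \<le> max (W b) (norm (gW d))"
      using a(2) b(2) d(2) by (auto simp: le_max_iff_disj)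
    moreover have "W x = norm x powr (- \<theta> * \<beta>) * W s" using Wscale[OF n s(1)] s(3) by simp
    moreover have "norm (gW x) = norm x powr (- \<theta> * \<beta> - 1) * norm (gW s)"
      using scale(1)[OF n s(1)] s(3) by simp
    ultimately show ?thesis by (simp add: mult.commute mult_right_mono)
  qed
  have "W a > 0" using a(1) KD Vpos by (auto simp: W_def less_le)
  show thesis
    by (rule that[of \<delta> "W a" W gW MW "max (W b) (norm (gW d))"])
      (use \<delta>(1) \<open>W a > 0\<close> C2_fun_subset[OF CW D'open D'D] all bnd D'D in \<open>auto simp: D'_def\<close>)
qed

end

section \<open>Solutions near the singularity\<close>

lemma weak_solution_weak_div_eq:
  assumes u: "weak_solution p q \<Omega> u"
  shows "weak_div_eq \<Omega> (\<lambda>x. pflux p (grad u x)) (\<lambda>x. norm (grad u x) powr q)"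
  unfolding weak_div_eq_def
proof (intro allI impI)
  fix K and \<phi> :: "real ^ 'a \<Rightarrow> real" and g
  assume K: "compact K" "K \<subseteq> \<Omega>" and \<phi>: "C1_fun UNIV \<phi> g" and z: "\<forall>x. x \<notin> K \<longrightarrow> \<phi> x = 0"
  have clK: "closed K" using K compact_imp_closed by blast
  have g0: "g x = 0" if "x \<notin> K" for x using C1_fun_grad_eq_0[OF \<phi> clK] z that by blast
  have d\<phi>: "(\<phi> has_derivative (\<lambda>h. g x \<bullet> h)) (at x)" for x using \<phi> by (simp add: C1_fun_def)
  have grad: "grad \<phi> x = g x" for x
    by (simp add: grad_def frechet_derivative_at[OF d\<phi>[of x], symmetric] inner_axis vec_eq_iff)
  have "closure {x. \<phi> x \<noteq> 0} \<subseteq> K" using z clK by (intro closure_minimal) auto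
  moreover from this have "compact (closure {x. \<phi> x \<noteq> 0})"
    using bounded_subset[OF compact_imp_bounded[OF K(1)]] by (simp add: compact_eq_bounded_closed)
  moreover have "Ck_on 1 UNIV \<phi>"
  proof -
    have "continuous_on UNIV \<phi>" by (rule C1_fun_cont[OF \<phi>])
    moreover have "continuous_on UNIV g" using \<phi> by (simp add: C1_fun_def)
    moreover have "extends_continuously UNIV UNIV f" if "continuous_on UNIV f" for f :: "real ^ 'a \<Rightarrow> real"
      using that by (auto simp: extends_continuously_def)
    moreover have "\<phi> differentiable_on UNIV"
      using d\<phi> by (auto simp: differentiable_on_def differentiable_def)
    ultimately show ?thesis by (simp add: Ck_upto_def grad continuous_on_component)
  qed
  ultimately have "C1_test_function \<Omega> \<phi>" using K(2) by (auto simp: C1_test_function_def)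
  then have "(LINT x:\<Omega>|lborel. pflux p (grad u x) \<bullet> grad \<phi> x + norm (grad u x) powr q * \<phi> x) = 0"
    using u by (simp add: weak_solution_def pflux_def)
  moreover have "indicator \<Omega> x *\<^sub>R (pflux p (grad u x) \<bullet> grad \<phi> x + norm (grad u x) powr q * \<phi> x)
     = indicator K x *\<^sub>R (pflux p (grad u x) \<bullet> g x + norm (grad u x) powr q * \<phi> x)" for x
    using z g0[of x] K(2) by (cases "x \<in> K") (auto simp: grad)
  ultimately show "integral\<^sup>L lborel (\<lambda>x. indicator K x *\<^sub>R (pflux p (grad u x) \<bullet> g x + norm (grad u x) powr q * \<phi> x)) = 0"
    by (simp add: set_lebesgue_integral_def)
qed

text \<open>\<open>b\<close> is the exponent that balances both terms of the equation: with
  \<open>m = q - p + 1\<close> one has \<open>(b + 1) * m = 1\<close>. The shift by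
  \<open>\<epsilon>\<close> makes the barrier blow up at the sphere of radius
  \<open>\<epsilon>\<close>, so the unknown behaviour of \<open>u\<close> near \<open>0\<close>
  cannot interfere. The choice \<open>\<epsilon> = norm x / 2\<close> at the end produces the factor
  \<open>2 powr b\<close>.\<close>

lemma singular_upper_bound:
  fixes \<Omega> :: "(real ^ 'n) set" and p q :: real
  defines "b \<equiv> (p - q) / (q + 1 - p)"
  assumes p: "1 < p" and q: "p - 1 < q" "q < p"
    and \<Omega>: "open \<Omega>" "bounded \<Omega>" "0 \<notin> \<Omega>"
    and u: "C1_fun \<Omega> u gu" and eq: "weak_div_eq \<Omega> (\<lambda>x. pflux p (gu x)) (\<lambda>x. norm (gu x) powr q)"
    and cu: "continuous_on (closure \<Omega> - {0}) u" and bdry: "\<And>x. x \<in> frontier \<Omega> \<Longrightarrow> x \<noteq> 0 \<Longrightarrow> u x = 0"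
  obtains C where "C > 0" "\<And>x. x \<in> \<Omega> \<Longrightarrow> u x \<le> C * norm x powr (- b)"
proof -
  have b: "b > 0" using q by (simp add: b_def)
  define m where "m = q - p + 1"
  have m: "m > 0" "(b + 1) * m = 1" using q by (simp_all add: m_def b_def field_simps)
  \<comment> \<open>\<open>(p - 1) * (b + 1)\<close> is the threshold for a supersolution in
    \<open>strict\<close>; the extra \<open>1\<close> makes it strict. The constant \<open>l\<close>
    is solved from \<open>(l * b) powr m = S0\<close>.\<close>
  define S0 where "S0 = 1 + (p - 1) * (b + 1)"
  have S0: "S0 > 0" "S0 > (p - 1) * (b + 1)" using p b by (simp_all add: S0_def add_pos_nonneg)
  define l where "l = S0 powr (1 / m) / b"
  have l: "l > 0" using S0 b by (simp add: l_def)
  have lb: "(l * b) powr m = S0" using b m S0 by (simp add: l_def powr_powr)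
  have key: "u x \<le> l * (norm x - \<epsilon>) powr (- b)" if \<epsilon>: "0 < \<epsilon>" "\<epsilon> < norm x" and x: "x \<in> \<Omega>" for \<epsilon> x
  proof -
    define D where "D = \<Omega> \<inter> {x. \<epsilon> < norm x}"
    have Dopen: "open D" unfolding D_def by (intro open_Int \<Omega> open_Collect_less continuous_intros)
    have D0: "D \<subseteq> - {0}" using \<epsilon> by (auto simp: D_def)
    define f1 where "f1 t = - l * b * (t - \<epsilon>) powr (- b - 1)" for t
    define f2 where "f2 t = l * b * (b + 1) * (t - \<epsilon>) powr (- b - 2)" for t
    define w where "w x = l * (norm x - \<epsilon>) powr (- b)" for x :: "real ^ 'n"
    define gw where "gw x = f1 (norm x) *\<^sub>R (1 / norm x) *\<^sub>R x" for x :: "real ^ 'n"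
    define Mw where "Mw x = f1 (norm x) *\<^sub>R ((1 / norm x) *\<^sub>R mat 1 - (1 / norm x ^ 3) *\<^sub>R outer x x) + f2 (norm x) *\<^sub>R outer ((1 / norm x) *\<^sub>R x) ((1 / norm x) *\<^sub>R x)" for x :: "real ^ 'n"
    have w: "C2_fun D w gw Mw"
      unfolding w_def[abs_def] gw_def[abs_def] Mw_def[abs_def]
    proof (rule C2_fun_compose[OF C2_fun_subset[OF C2_fun_norm Dopen D0], where S = "{\<epsilon><..}"])
      fix t assume t: "t \<in> {\<epsilon><..}"
      have "((\<lambda>t. (t - \<epsilon>) powr a) has_real_derivative a * (t - \<epsilon>) powr (a - 1)) (at t)" for a
        using t by (auto intro!: derivative_eq_intros)
      note d = this
      show "((\<lambda>t. l * (t - \<epsilon>) powr - b) has_real_derivative f1 t) (at t)"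
        using DERIV_cmult[OF d[of "- b"], of l] by (simp add: f1_def mult_ac)
      have "((\<lambda>t. (- l * b) * (t - \<epsilon>) powr (- b - 1)) has_real_derivative (- l * b) * ((- b - 1) * (t - \<epsilon>) powr (- b - 1 - 1))) (at t)"
        by (rule DERIV_cmult[OF d])
      moreover have "(- l * b) * ((- b - 1) * (t - \<epsilon>) powr (- b - 1 - 1)) = f2 t"
        by (simp add: f2_def algebra_simps)
      ultimately show "(f1 has_real_derivative f2 t) (at t)" by (simp add: f1_def[abs_def])
    next
      show "continuous_on {\<epsilon><..} f2" unfolding f2_def by (intro continuous_intros) auto
    qed (auto simp: D_def)
    have f1neg: "f1 t < 0" if "\<epsilon> < t" for t using that l b by (simp add: f1_def mult_neg_pos)
    have ngw: "norm (gw x) = - f1 (norm x)" if "x \<in> D" for x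
      using f1neg[of "norm x"] that \<epsilon> by (auto simp: D_def gw_def)
    have gw0: "gw x \<noteq> 0" if "x \<in> D" for x using ngw[OF that] f1neg[of "norm x"] that by (auto simp: D_def)
    obtain J where J: "C1_field D (\<lambda>x. pflux p (gw x)) J"
      "\<And>x. x \<in> D \<Longrightarrow> trace (J x) = norm (gw x) powr (p - 4) * plap p (gw x) (Mw x)"
      using C1_field_pflux[OF w gw0] by blast
    have strict: "trace (J x) < norm (gw x) powr q" if x: "x \<in> D" for x
    proof -
      have x0: "x \<noteq> 0" and t: "\<epsilon> < norm x" using x D0 by (auto simp: D_def)
      define s where "s = norm x - \<epsilon>"
      have s: "s > 0" using t by (simp add: s_def)
      define a where "a = norm (gw x)"
      have a: "a > 0" using gw0[OF x] by (simp add: a_def)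
      have a_eq: "a = l * b * s powr (- b - 1)" using ngw[OF x] by (simp add: a_def f1_def s_def)
      have f1a: "f1 (norm x) = - a" using ngw[OF x] by (simp add: a_def)
      have f2e: "f2 (norm x) = l * b * (b + 1) * s powr (- b - 2)" by (simp add: f2_def s_def)
      have "plap p (gw x) (Mw x) = (- a) ^ 3 * ((real CARD('n) - 1) / norm x) + (p - 1) * (- a)\<^sup>2 * f2 (norm x)"
        unfolding gw_def Mw_def plap_compose f1a plap_norm[OF x0] using x0 by simp
      \<comment> \<open>The barrier decreases radially, so the curvature term of the spheres has the
        favourable sign and is dropped.\<close>
      also have "\<dots> \<le> (p - 1) * a\<^sup>2 * f2 (norm x)"
      proof -
        have "a ^ 3 * ((real CARD('n) - 1) / norm x) \<ge> 0"
          using a by (intro mult_nonneg_nonneg divide_nonneg_nonneg) auto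
        then show ?thesis by simp
      qed
      finally have "plap p (gw x) (Mw x) \<le> a powr 2 * ((p - 1) * f2 (norm x))" using a by (simp add: mult_ac)
      then have "trace (J x) \<le> a powr (p - 4) * (a powr 2 * ((p - 1) * f2 (norm x)))"
        unfolding J(2)[OF x] a_def[symmetric] by (intro mult_left_mono) auto
      also have "\<dots> = a powr (p - 2) * ((p - 1) * f2 (norm x))"
        by (simp add: mult.assoc[symmetric] powr_add[symmetric])
      also have "\<dots> < a powr (p - 2) * a powr (m + 1)"
      proof (rule mult_strict_left_mono)
        have "a powr m = S0 * s powr (- 1)"
        proof -
          have "a powr m = (l * b) powr m * (s powr (- b - 1)) powr m" unfolding a_eq using l b by (simp add: powr_mult)
          also have "(s powr (- b - 1)) powr m = s powr (- 1)"
          proof -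
            have "(- b - 1) * m = - 1" using m(2) by (simp add: algebra_simps)
            then show ?thesis by (simp only: powr_powr)
          qed
          finally show ?thesis by (simp add: lb)
        qed
        then have "a powr (m + 1) = S0 * s powr (- 1) * (l * b * s powr (- b - 1))"
          using a by (simp add: powr_add a_eq[symmetric])
        also have "\<dots> = S0 * (l * b * s powr (- b - 2))"
          using powr_add[of s "-1" "- b - 1"] by (simp add: algebra_simps)
        also have "\<dots> > (p - 1) * (b + 1) * (l * b * s powr (- b - 2))"
          using S0(2) l b s by (intro mult_strict_right_mono) auto
        finally show "(p - 1) * f2 (norm x) < a powr (m + 1)" by (simp add: f2e mult_ac)
      qed (use a in auto)
      also have "\<dots> = a powr q" by (simp add: powr_add[symmetric] m_def)
      finally show ?thesis by (simp add: a_def)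
    qed
    have Ksub: "compact (closure \<Omega> \<inter> {x. r \<le> norm x})" "closure \<Omega> \<inter> {x. r \<le> norm x} \<subseteq> closure \<Omega> - {0}" if "r > 0" for r
    proof -
      have "closed {x::real^'n. r \<le> norm x}" by (intro closed_Collect_le continuous_intros)
      then show "compact (closure \<Omega> \<inter> {x. r \<le> norm x})"
        using \<Omega>(2) by (simp add: compact_Int_closed compact_closure)
    qed (use that in auto)
    obtain B where B: "B > 0" "\<And>x. x \<in> closure \<Omega> \<Longrightarrow> \<epsilon> \<le> norm x \<Longrightarrow> u x \<le> B"
    proof -
      have "bounded (u ` (closure \<Omega> \<inter> {x. \<epsilon> \<le> norm x}))"
        using compact_continuous_image[OF continuous_on_subset[OF cu Ksub(2)[OF \<epsilon>(1)]] Ksub(1)[OF \<epsilon>(1)]] compact_imp_bounded by blast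
      then obtain B where "B > 0" "\<forall>y\<in>u ` (closure \<Omega> \<inter> {x. \<epsilon> \<le> norm x}). norm y \<le> B" using bounded_pos by blast
      then show ?thesis using that by force
    qed
    \<comment> \<open>Within distance \<open>d\<close> of the sphere of radius
      \<open>\<epsilon>\<close> the barrier is at least \<open>B\<close>, hence at least
      \<open>u\<close>, so the superlevel set stays in
      \<open>\<epsilon> + d \<le> norm x\<close>.\<close>
    define d where "d = (l / B) powr (1 / b)"
    have d: "d > 0" "l * d powr (- b) = B"
      using l B(1) b by (simp_all add: d_def powr_powr powr_minus)
    have "u x \<le> w x + \<kappa>" if \<kappa>: "\<kappa> > 0" for \<kappa>
    proof -
      have "\<forall>x\<in>D. u x - w x \<le> \<kappa>"
      proof (rule comparison[OF p C1_fun_subset[OF u Dopen] C2_funD(7)[OF w] weak_div_eq_subset[OF eq] C1_field_weak_div_eq[OF J(1)]])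
        have "continuous_on D gu" using u by (auto simp: C1_fun_def D_def intro: continuous_on_subset)
        then show "continuous_on D (\<lambda>x. norm (gu x) powr q)"
          using p q by (intro continuous_on_powr_const continuous_intros) auto
        show "continuous_on D (\<lambda>x. trace (J x))" using J(1) by (auto simp: C1_field_def intro!: continuous_intros)
        show "trace (J x) < norm (gu x) powr q" if "x \<in> D" "gu x = gw x" for x using strict[OF that(1)] that(2) by simp
        let ?K = "closure \<Omega> \<inter> {x. \<epsilon> + d \<le> norm x}"
        have ed: "\<epsilon> + d > 0" using \<epsilon> d by simp
        have "compact {x \<in> ?K. \<kappa> \<le> u x - w x}"
          unfolding w_def
          by (rule compact_superlevel[OF Ksub(1)[OF ed]])
            (intro continuous_intros continuous_on_subset[OF cu Ksub(2)[OF ed]]; use d(1) in auto)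
        moreover have "{x \<in> ?K. \<kappa> \<le> u x - w x} = {x \<in> D. \<kappa> \<le> u x - w x}"
        proof -
          have "x \<in> \<Omega>" if x: "x \<in> ?K" "\<kappa> \<le> u x - w x" for x
          proof (rule ccontr)
            assume "x \<notin> \<Omega>"
            then have "x \<in> frontier \<Omega>" using x(1) \<Omega>(1) by (simp add: frontier_def interior_open)
            moreover have "x \<noteq> 0" using x(1) ed by auto
            ultimately have "u x = 0" by (rule bdry)
            moreover have "w x \<ge> 0" using l by (simp add: w_def)
            ultimately show False using x(2) \<kappa> by linarith
          qed
          moreover have "\<epsilon> + d \<le> norm x" if x: "x \<in> D" "\<kappa> \<le> u x - w x" for x
          proof (rule ccontr)
            assume "\<not> \<epsilon> + d \<le> norm x"
            moreover have t: "\<epsilon> < norm x" using x by (simp add: D_def)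
            ultimately have "d powr (- b) \<le> (norm x - \<epsilon>) powr (- b)"
              using b by (intro powr_mono2') auto
            then have "B \<le> w x" unfolding d(2)[symmetric] w_def using l by (intro mult_left_mono) auto
            moreover have "u x \<le> B" using B(2)[of x] x t closure_subset by (auto simp: D_def)
            ultimately show False using x(2) \<kappa> by linarith
          qed
          ultimately show ?thesis using \<epsilon> d closure_subset by (auto simp: D_def)
        qed
        ultimately show "compact {x \<in> D. \<kappa> \<le> u x - w x}" by simp
      qed (auto simp: D_def)
      moreover have "x \<in> D" using x \<epsilon> by (simp add: D_def)
      ultimately show ?thesis by (simp add: algebra_simps)
    qed
    then have "u x \<le> w x" by (rule field_le_epsilon)
    then show ?thesis by (simp add: w_def)
  qed
  show thesis
  proof (rule that)
    show "l * 2 powr b > 0" using l by simp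
    fix x assume x: "x \<in> \<Omega>"
    then have n: "norm x > 0" using \<Omega>(3) by auto
    then have "u x \<le> l * (norm x - norm x / 2) powr (- b)" using x by (intro key) auto
    also have "norm x - norm x / 2 = norm x / 2" by simp
    also have "(norm x / 2) powr (- b) = 2 powr b * norm x powr (- b)"
      using n by (simp add: powr_divide powr_minus field_simps)
    finally show "u x \<le> l * 2 powr b * norm x powr (- b)" by simp
  qed
qed

text \<open>\<open>\<nu>\<close> is the inner normal, obtained by normalising
  \<open>s *\<^sub>R axis i 1 - g 0\<close> with \<open>g 0\<close> the gradient of
  \<open>\<gamma>\<close> at \<open>0\<close>. The first-order expansion of \<open>\<gamma>\<close>
  there has an error smaller than any multiple of \<open>norm x\<close> near
  \<open>0\<close>.\<close>

lemma boundary_cone: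
  fixes \<Omega> :: "(real ^ 'n) set"
  assumes \<Omega>: "open \<Omega>" "C2_boundary \<Omega>" and z: "0 \<in> frontier \<Omega>"
  obtains \<nu> where "norm \<nu> = 1" "\<And>\<delta>. \<delta> > 0 \<Longrightarrow> \<exists>r>0. \<forall>x\<in>\<Omega>. norm x < r \<longrightarrow> - \<delta> * norm x < x \<bullet> \<nu>"
proof -
  from bspec[OF \<Omega>(2)[unfolded C2_boundary_def] z]
  obtain r i s \<gamma> where r: "r > 0" and s: "s \<in> {1, -1}" and \<gamma>: "Ck_on 2 UNIV \<gamma>"
    and indep: "\<forall>x y. (\<forall>j. j \<noteq> i \<longrightarrow> x $ j = y $ j) \<longrightarrow> \<gamma> x = \<gamma> y"
    and graph: "\<Omega> \<inter> ball 0 r = {x \<in> ball 0 r. s * x $ i > \<gamma> x}"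
    by (elim exE conjE bexE) (rule that)
  obtain g M where g: "C2_fun UNIV \<gamma> g M" by (rule Ck_upto_2_C2_fun[OF \<gamma> open_UNIV subset_UNIV]) (rule that)
  have d: "(\<gamma> has_derivative (\<lambda>h. g 0 \<bullet> h)) (at 0)" using C2_funD(5)[OF g] by simp
  have c: "continuous_on UNIV \<gamma>" by (rule C2_funD[OF g])
  have 0: "0 \<notin> \<Omega>" using z \<Omega>(1) by (simp add: frontier_def interior_open)
  \<comment> \<open>A negative value would put \<open>0\<close> into \<open>\<Omega>\<close>, a
    positive one outside its closure.\<close>
  have \<gamma>0: "\<gamma> 0 = 0"
  proof (rule ccontr)
    assume "\<gamma> 0 \<noteq> 0"
    then consider "\<gamma> 0 < 0" | "\<gamma> 0 > 0" by linarith
    then show False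
    proof cases
      case 1
      then have "0 \<in> {x \<in> ball 0 r. s * x $ i > \<gamma> x}" using r by simp
      then show False using 0 graph by blast
    next
      case 2
      let ?N = "{x. s * x $ i < \<gamma> x} \<inter> ball 0 r"
      have "open ?N" by (intro open_Int open_Collect_less continuous_intros c) auto
      moreover have "0 \<in> ?N" using 2 r by simp
      moreover have "0 \<in> closure \<Omega>" using z by (simp add: frontier_def)
      ultimately have "?N \<inter> \<Omega> \<noteq> {}" using open_Int_closure_eq_empty by blast
      then obtain x where "x \<in> ?N" "x \<in> \<Omega>" by blast
      moreover from this have "x \<in> {x \<in> ball 0 r. s * x $ i > \<gamma> x}" using graph by blast
      ultimately show False by simp
    qed
  qed
  \<comment> \<open>\<open>\<gamma>\<close> is constant along the axis \<open>i\<close>; therefore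
    \<open>n $ i = s\<close>, and \<open>n\<close> cannot vanish.\<close>
  have gi: "g 0 $ i = 0"
  proof -
    have "((\<lambda>t. \<gamma> (t *\<^sub>R axis i 1)) has_derivative (\<lambda>t. g 0 \<bullet> (t *\<^sub>R axis i 1))) (at 0)"
      by (rule has_derivative_compose[of "\<lambda>t. t *\<^sub>R axis i 1" "\<lambda>t. t *\<^sub>R axis i 1"])
        (use d in \<open>auto intro!: derivative_eq_intros\<close>)
    moreover have "(\<lambda>t. \<gamma> (t *\<^sub>R axis i 1)) = (\<lambda>t. \<gamma> 0)"
      by (rule ext, rule indep[rule_format]) (simp add: axis_def)
    ultimately have "((\<lambda>t::real. \<gamma> 0) has_derivative (\<lambda>t. g 0 \<bullet> (t *\<^sub>R axis i 1))) (at 0)" by simp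
    then have "(\<lambda>t. g 0 \<bullet> (t *\<^sub>R axis i 1)) = (\<lambda>t::real. 0)" by (metis has_derivative_unique has_derivative_const)
    from fun_cong[OF this, of 1] show ?thesis by (simp add: inner_axis)
  qed
  define n where "n = s *\<^sub>R axis i 1 - g 0"
  have "n $ i = s" by (simp add: n_def gi)
  then have n0: "n \<noteq> 0" using s by auto
  show thesis
  proof (rule that)
    show "norm (n /\<^sub>R norm n) = 1" using n0 by simp
    fix \<delta> :: real assume \<delta>: "\<delta> > 0"
    then have "\<delta> * norm n > 0" using n0 by simp
    then obtain e where e: "e > 0" "\<And>x. norm (x - 0) < e \<Longrightarrow> norm (\<gamma> x - \<gamma> 0 - g 0 \<bullet> (x - 0)) \<le> \<delta> * norm n * norm (x - 0)"
      using d unfolding has_derivative_at_alt by blast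
    show "\<exists>r>0. \<forall>x\<in>\<Omega>. norm x < r \<longrightarrow> - \<delta> * norm x < x \<bullet> (n /\<^sub>R norm n)"
    proof (intro exI[of _ "min r e"] conjI ballI impI)
      show "min r e > 0" using r e by simp
      fix x assume x: "x \<in> \<Omega>" "norm x < min r e"
      then have "x \<in> {x \<in> ball 0 r. s * x $ i > \<gamma> x}" using graph by (metis IntI dist_0_norm mem_ball min_less_iff_conj)
      then have "s * x $ i > \<gamma> x" by simp
      moreover have "\<bar>\<gamma> x - g 0 \<bullet> x\<bar> \<le> \<delta> * norm n * norm x" using e(2)[of x] x(2) \<gamma>0 by simp
      moreover have "x \<bullet> n = s * x $ i - g 0 \<bullet> x" by (simp add: n_def inner_diff_right inner_axis inner_commute)
      ultimately have "x \<bullet> n > - \<delta> * norm x * norm n" by (simp add: mult_ac)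
      then have "inverse (norm n) * (- \<delta> * norm x * norm n) < inverse (norm n) * (x \<bullet> n)"
        using n0 by (intro mult_strict_left_mono) auto
      moreover have "inverse (norm n) * (- \<delta> * norm x * norm n) = - \<delta> * norm x" using n0 by simp
      ultimately have "- \<delta> * norm x < inverse (norm n) * (x \<bullet> n)" by (simp only:)
      then show "- \<delta> * norm x < x \<bullet> (n /\<^sub>R norm n)" by simp
    qed
  qed
qed

section \<open>Gluing by zero and cutoff functions\<close>

lemma continuous_on_glue_zero:
  fixes f :: "'a::topological_space \<Rightarrow> 'b::real_normed_vector"
  assumes "continuous_on E f" "open E" "open A" "\<And>x. x \<in> E \<inter> A \<Longrightarrow> f x = 0"
  shows "continuous_on (E \<union> A) (\<lambda>x. if x \<in> E then f x else 0)"
proof (rule continuous_on_open_Un[OF assms(2,3)])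
  show "continuous_on E (\<lambda>x. if x \<in> E then f x else 0)" by (rule continuous_on_eq[OF assms(1)]) simp
  show "continuous_on A (\<lambda>x. if x \<in> E then f x else 0)"
    by (rule continuous_on_eq[OF continuous_on_const[of _ 0]]) (use assms(4) in auto)
qed

lemma has_derivative_glue_zero:
  assumes d: "\<And>x. x \<in> E \<Longrightarrow> (f has_derivative f' x) (at x)" and "open E" "open A"
    and z: "\<And>x. x \<in> E \<inter> A \<Longrightarrow> f x = 0" and x: "x \<in> E \<union> A"
  shows "((\<lambda>x. if x \<in> E then f x else 0) has_derivative (if x \<in> E then f' x else (\<lambda>h. 0))) (at x)"
proof (cases "x \<in> E")
  case True
  have "((\<lambda>x. if x \<in> E then f x else 0) has_derivative f' x) (at x)"
    by (rule has_derivative_transform_within_open[OF d[OF True] \<open>open E\<close> True]) simp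
  then show ?thesis using True by simp
next
  case False
  then have "x \<in> A" using x by auto
  have "((\<lambda>x. if x \<in> E then f x else 0) has_derivative (\<lambda>h. 0)) (at x)"
    by (rule has_derivative_transform_within_open[OF has_derivative_const[of 0] \<open>open A\<close> \<open>x \<in> A\<close>]) (use z in auto)
  then show ?thesis using False by simp
qed

lemma C1_fun_glue_zero:
  assumes w: "C1_fun E w g" and A: "open A" and z: "\<And>x. x \<in> E \<inter> A \<Longrightarrow> w x = 0 \<and> g x = 0"
  shows "C1_fun (E \<union> A) (\<lambda>x. if x \<in> E then w x else 0) (\<lambda>x. if x \<in> E then g x else 0)"
  unfolding C1_fun_def
proof (intro conjI ballI)
  have E: "open E" and cg: "continuous_on E g" using w by (auto simp: C1_fun_def)
  show "open (E \<union> A)" using E A by (rule open_Un)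
  show "continuous_on (E \<union> A) (\<lambda>x. if x \<in> E then g x else 0)"
    by (rule continuous_on_glue_zero[OF cg E A]) (use z in auto)
  fix x assume x: "x \<in> E \<union> A"
  have "((\<lambda>x. if x \<in> E then w x else 0) has_derivative (if x \<in> E then (\<lambda>h. g x \<bullet> h) else (\<lambda>h. 0))) (at x)"
    by (rule has_derivative_glue_zero[OF _ E A _ x]) (use w z in \<open>auto simp: C1_fun_def\<close>)
  then show "((\<lambda>x. if x \<in> E then w x else 0) has_derivative (\<lambda>h. (if x \<in> E then g x else 0) \<bullet> h)) (at x)"
    by (cases "x \<in> E") auto
qed

lemma C1_field_glue_zero:
  assumes w: "C1_field E F J" and A: "open A" and z: "\<And>x. x \<in> E \<inter> A \<Longrightarrow> F x = 0 \<and> J x = 0"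
  shows "C1_field (E \<union> A) (\<lambda>x. if x \<in> E then F x else 0) (\<lambda>x. if x \<in> E then J x else 0)"
  unfolding C1_field_def
proof (intro conjI ballI)
  have E: "open E" and cg: "continuous_on E J" using w by (auto simp: C1_field_def)
  show "open (E \<union> A)" using E A by (rule open_Un)
  show "continuous_on (E \<union> A) (\<lambda>x. if x \<in> E then J x else 0)"
    by (rule continuous_on_glue_zero[OF cg E A]) (use z in auto)
  fix x assume x: "x \<in> E \<union> A"
  have "((\<lambda>x. if x \<in> E then F x else 0) has_derivative (if x \<in> E then (\<lambda>h. J x *v h) else (\<lambda>h. 0))) (at x)"
    by (rule has_derivative_glue_zero[OF _ E A _ x]) (use w z in \<open>auto simp: C1_field_def\<close>)
  then show "((\<lambda>x. if x \<in> E then F x else 0) has_derivative (\<lambda>h. (if x \<in> E then J x else 0) *v h)) (at x)"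
    by (cases "x \<in> E") auto
qed

text \<open>The function \<open>h (W x)\<close> has as flux \<open>G (W x)\<close> times the flux of
  \<open>W\<close>, because \<open>k\<close> is the derivative of \<open>h\<close> and
  \<open>G s = k s powr (p - 1)\<close>. It is \<open>G\<close> that must be C1, so \<open>G\<close>
  is chosen first, as a polynomial step from \<open>0\<close> at \<open>l\<close> to
  \<open>1\<close> at \<open>l + 1\<close>; \<open>k\<close> is its root and \<open>h\<close> a
  primitive, of slope \<open>1\<close> above \<open>l + 1\<close>.\<close>

lemma cutoff_functions:
  fixes p l :: real
  assumes p: "1 < p" and l: "0 < l"
  obtains h k G G' :: "real \<Rightarrow> real" where
    "\<And>s. 0 < s \<Longrightarrow> (h has_real_derivative k s) (at s)" "continuous_on UNIV k"
    "\<And>s. (G has_real_derivative G' s) (at s)" "continuous_on UNIV G'"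
    "\<And>s. 0 \<le> k s" "\<And>s. G s = k s powr (p - 1)"
    "\<And>s. s \<le> l \<Longrightarrow> h s = 0 \<and> k s = 0 \<and> G s = 0 \<and> G' s = 0"
    "\<And>s. 0 \<le> h s" "\<And>s. s - l - 1 \<le> h s"
    "\<And>s. G' s \<le> 4" "\<And>s. l + 1 \<le> s \<Longrightarrow> G' s = 0"
proof -
  define Q where "Q r = (max r 0)\<^sup>2" for r :: real
  have dQ: "(Q has_real_derivative 2 * max r 0) (at r)" for r
    using has_real_derivative_pos_part_square[of r] by (simp add: Q_def[abs_def])
  have Qmono: "Q r \<le> 1" if "r \<le> 1" for r
    using that by (auto simp: Q_def max_def intro!: power_le_one)
  have Q1: "1 \<le> Q r" if "1 \<le> r" for r using that by (simp add: Q_def max_def)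
  have Q0: "0 \<le> Q r" for r by (simp add: Q_def)
  define G where "G s = 1 - Q (1 - Q (s - l))" for s
  define G' where "G' s = 2 * max (1 - Q (s - l)) 0 * (2 * max (s - l) 0)" for s
  define k where "k s = G s powr (1 / (p - 1))" for s
  define h where "h s = integral {0..s} k" for s
  have cQ: "continuous_on S Q" for S unfolding Q_def by (intro continuous_intros)
  have cG: "continuous_on S G" for S
    unfolding G_def by (intro continuous_intros continuous_on_compose2[OF cQ[of UNIV]]) auto
  have G0: "0 \<le> G s" for s using Qmono[of "1 - Q (s - l)"] Q0[of "s - l"] by (simp add: G_def)
  have ck: "continuous_on S k" for S
    unfolding k_def using p G0 by (intro continuous_on_powr_const cG) auto
  have Glow: "G s = 0 \<and> G' s = 0" if "s \<le> l" for s using that by (simp add: G_def G'_def Q_def)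
  have klow: "k s = 0" if "s \<le> l" for s using Glow[OF that] by (simp add: k_def)
  have G'high: "G' s = 0" if "l + 1 \<le> s" for s using Q1[of "s - l"] that by (simp add: G'_def)
  have khigh: "k s = 1" if "l + 1 \<le> s" for s
  proof -
    have "Q (1 - Q (s - l)) = 0" using Q1[of "s - l"] that by (simp add: Q_def[of "1 - _"])
    then show ?thesis by (simp add: k_def G_def)
  qed
  have kint: "k integrable_on {a..b}" for a b by (rule integrable_continuous_real[OF ck])
  have k0: "0 \<le> k s" for s by (simp add: k_def)
  have h0: "0 \<le> h s" for s unfolding h_def by (rule integral_nonneg[OF kint]) (simp add: k0)
  show thesis
  proof (rule that[of h k G G'])
    fix s :: real
    show "(h has_real_derivative k s) (at s)" if s: "0 < s"
    proof -
      have "(h has_real_derivative k s) (at s within {0..s + 1})"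
        unfolding h_def by (rule integral_has_real_derivative[OF ck]) (use s in auto)
      moreover have "at s within {0..s + 1} = at s" using s by (intro at_within_interior) simp
      ultimately show ?thesis by simp
    qed
    have d1: "((\<lambda>s. 1 - Q (s - l)) has_real_derivative - (2 * max (s - l) 0)) (at s)"
    proof -
      have "((\<lambda>s. s - l) has_real_derivative 1) (at s)" by (auto intro!: derivative_eq_intros)
      from DERIV_chain2[where f = Q and g = "\<lambda>s. s - l", OF dQ this]
      have "((\<lambda>s. Q (s - l)) has_real_derivative 2 * max (s - l) 0) (at s)" by simp
      then show ?thesis by (auto intro!: derivative_eq_intros)
    qed
    have "((\<lambda>s. Q (1 - Q (s - l))) has_real_derivative 2 * max (1 - Q (s - l)) 0 * (- (2 * max (s - l) 0))) (at s)"
      by (rule DERIV_chain2[where f = Q and g = "\<lambda>s. 1 - Q (s - l)", OF dQ d1])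
    then have "((\<lambda>s. 1 - Q (1 - Q (s - l))) has_real_derivative 0 - 2 * max (1 - Q (s - l)) 0 * (- (2 * max (s - l) 0))) (at s)"
      by (intro DERIV_diff DERIV_const)
    then show "(G has_real_derivative G' s) (at s)" by (simp add: G_def[abs_def] G'_def)
    show "G s = k s powr (p - 1)" using G0[of s] p by (simp add: k_def powr_powr)
    show "G' s \<le> 4"
    proof (cases "s \<le> l + 1")
      case True
      have "max (1 - Q (s - l)) 0 * max (s - l) 0 \<le> 1 * 1"
        using True Q0[of "s - l"] by (intro mult_mono) auto
      then show ?thesis by (simp add: G'_def)
    qed (use G'high[of s] in auto)
    show "s \<le> l \<Longrightarrow> h s = 0 \<and> k s = 0 \<and> G s = 0 \<and> G' s = 0"
    proof -
      assume s: "s \<le> l"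
      have "integral {0..s} k = integral {0..s} (\<lambda>x. 0)"
        by (rule integral_cong) (use s klow in auto)
      then show ?thesis using Glow[OF s] klow[OF s] by (simp add: h_def)
    qed
    show "s - l - 1 \<le> h s"
    proof (cases "s \<le> l + 1")
      case True
      then show ?thesis using h0[of s] by linarith
    next
      case False
      have "integral {0..l + 1} k + integral {l + 1..s} k = h s"
        unfolding h_def by (rule Henstock_Kurzweil_Integration.integral_combine[OF _ _ kint]) (use False l in auto)
      moreover have "integral {0..l + 1} k = h (l + 1)" by (simp add: h_def)
      moreover have "integral {l + 1..s} k = integral {l + 1..s} (\<lambda>x. 1)"
        by (rule integral_cong) (use khigh in auto)
      ultimately show ?thesis using h0[of "l + 1"] False by simp
    qed
    show "continuous_on UNIV G'" unfolding G'_def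
      by (intro continuous_intros continuous_on_compose2[OF cQ[of UNIV]]) auto
  qed (use ck k0 h0 G'high in auto)
qed

lemma weak_div_eq_scale:
  assumes "weak_div_eq D F h"
  shows "weak_div_eq D (\<lambda>x. c *\<^sub>R F x) (\<lambda>x. c * h x)"
  unfolding weak_div_eq_def
proof (intro allI impI)
  fix K \<phi> g assume a: "compact K" "K \<subseteq> D" "C1_fun UNIV \<phi> g" "\<forall>x. x \<notin> K \<longrightarrow> \<phi> x = 0"
  have "(\<lambda>x. indicator K x *\<^sub>R (c *\<^sub>R F x \<bullet> g x + c * h x * \<phi> x)) = (\<lambda>x. c * (indicator K x *\<^sub>R (F x \<bullet> g x + h x * \<phi> x)))"
    by (simp add: fun_eq_iff algebra_simps)
  moreover have "integral\<^sup>L lborel (\<lambda>x. indicator K x *\<^sub>R (F x \<bullet> g x + h x * \<phi> x)) = 0"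
    using assms a unfolding weak_div_eq_def by blast
  ultimately show "integral\<^sup>L lborel (\<lambda>x. indicator K x *\<^sub>R (c *\<^sub>R F x \<bullet> g x + c * h x * \<phi> x)) = 0"
    by (simp only: integral_mult_right_zero mult_zero_right)
qed

text \<open>The test function \<open>((u - \<kappa> - \<epsilon> Z)\<^sub>+)\<^sup>2\<close> vanishes near the singularity, and the contribution of
  \<open>Z\<close> is of order \<open>\<epsilon> powr (p - 1)\<close>.\<close>

lemma gradient_eq_0_of_singular_supersolution:
  fixes \<Omega> :: "(real ^ 'n) set" and Z :: "real ^ 'n \<Rightarrow> real"
  assumes p: "1 < p" and q: "0 < q" and \<Omega>: "open \<Omega>" "bounded \<Omega>" "0 \<notin> \<Omega>"
    and u: "C1_fun \<Omega> u gu" and eq: "weak_div_eq \<Omega> (\<lambda>x. pflux p (gu x)) (\<lambda>x. norm (gu x) powr q)"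
    and cu: "continuous_on (closure \<Omega> - {0}) u" and bdry: "\<And>x. x \<in> frontier \<Omega> \<Longrightarrow> x \<noteq> 0 \<Longrightarrow> u x = 0"
    and Z: "C1_fun \<Omega> Z gZ" "\<And>x. x \<in> \<Omega> \<Longrightarrow> 0 \<le> Z x"
    and F: "C1_field \<Omega> (\<lambda>x. pflux p (gZ x)) J"
    and B: "0 \<le> B" "\<And>x. x \<in> \<Omega> \<Longrightarrow> trace (J x) > 0 \<Longrightarrow> u x \<le> B \<and> trace (J x) \<le> B"
    and dom: "\<And>\<epsilon>. 0 < \<epsilon> \<Longrightarrow> \<exists>r>0. \<forall>x\<in>\<Omega>. norm x < r \<longrightarrow> u x \<le> \<epsilon> * Z x"
    and x0: "x0 \<in> \<Omega>" "u x0 > 0"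
  shows "gu x0 = 0"
proof (rule ccontr)
  assume g0: "gu x0 \<noteq> 0"
  \<comment> \<open>Of the height \<open>4 * \<kappa>\<close> at \<open>x0\<close>, one
    \<open>\<kappa>\<close> is spent on passing to a ball, one on \<open>\<epsilon> * Z\<close> and
    one on the truncation level, so \<open>z \<ge> \<kappa>\<close> remains on the ball.\<close>
  define \<kappa> where "\<kappa> = u x0 / 4"
  have \<kappa>: "\<kappa> > 0" "u x0 = 4 * \<kappa>" using x0 by (auto simp: \<kappa>_def)
  have cuO: "continuous_on \<Omega> u" "continuous_on \<Omega> gu" and cZ: "continuous_on \<Omega> Z"
    and cgZ: "continuous_on \<Omega> gZ"
    using u Z C1_fun_cont by (auto simp: C1_fun_def)
  have cJ: "continuous_on \<Omega> (\<lambda>x. trace (J x))" using F by (auto simp: C1_field_def intro: continuous_intros)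
  have ch: "continuous_on \<Omega> (\<lambda>x. norm (gu x) powr q)" using q by (intro continuous_on_powr_const continuous_intros cuO) auto
  define a where "a = norm (gu x0) powr q / 2"
  have a: "a > 0" "a < norm (gu x0) powr q" using g0 by (auto simp: a_def)
  have "open {x \<in> \<Omega>. 3 * \<kappa> < u x}"
    using continuous_open_preimage[OF cuO(1) \<Omega>(1), of "{3 * \<kappa><..}"] by (simp add: vimage_def Int_def)
  moreover have "open {x \<in> \<Omega>. a < norm (gu x) powr q}"
    using continuous_open_preimage[OF ch \<Omega>(1), of "{a<..}"] by (simp add: vimage_def Int_def)
  ultimately have "open ({x \<in> \<Omega>. 3 * \<kappa> < u x} \<inter> {x \<in> \<Omega>. a < norm (gu x) powr q})" by (rule open_Int)
  moreover have "x0 \<in> {x \<in> \<Omega>. 3 * \<kappa> < u x} \<inter> {x \<in> \<Omega>. a < norm (gu x) powr q}" using x0 \<kappa> a by simp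
  ultimately obtain \<rho> where \<rho>: "\<rho> > 0" "cball x0 \<rho> \<subseteq> {x \<in> \<Omega>. 3 * \<kappa> < u x} \<inter> {x \<in> \<Omega>. a < norm (gu x) powr q}"
    using open_contains_cball by blast
  have \<rho>\<Omega>: "cball x0 \<rho> \<subseteq> \<Omega>" using \<rho>(2) by auto
  obtain y where y: "\<And>x. x \<in> cball x0 \<rho> \<Longrightarrow> Z x \<le> Z y" "y \<in> cball x0 \<rho>"
    using continuous_attains_sup[OF compact_cball _ continuous_on_subset[OF cZ \<rho>\<Omega>]] \<rho>(1) by fastforce
  have Zy: "0 \<le> Z y" using Z(2) y(2) \<rho>\<Omega> by auto
  obtain R where R: "\<And>x. x \<in> \<Omega> \<Longrightarrow> norm x \<le> R" using \<Omega>(2) bounded_iff by metis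
  define m where "m = measure lborel (cball (0::real^'n) R)"
  have m0: "m \<ge> 0" by (simp add: m_def)
  \<comment> \<open>A lower bound, independent of \<open>\<epsilon>\<close>, for the contribution of
    the ball to the absorption term; \<open>\<epsilon>\<close> is chosen below so that the error
    coming from \<open>Z\<close> is smaller.\<close>
  define v where "v = a * \<kappa>\<^sup>2 * measure lborel (cball x0 \<rho>)"
  have v: "v > 0" using a(1) \<kappa>(1) content_cball_pos[OF \<rho>(1), of x0] by (simp add: v_def)
  have "((\<lambda>\<epsilon>. \<epsilon> powr (p - 1) * (B ^ 3 * m)) \<longlongrightarrow> 0 powr (p - 1) * (B ^ 3 * m)) (at_right 0)"
    by (intro tendsto_intros tendsto_powr2) (use p in \<open>auto simp: eventually_at_filter\<close>)
  then have "\<forall>\<^sub>F \<epsilon> in at_right 0. \<epsilon> powr (p - 1) * (B ^ 3 * m) < v"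
    using v p by (intro order_tendstoD(2)) auto
  moreover have "\<forall>\<^sub>F \<epsilon> in at_right 0. \<epsilon> < \<kappa> / (Z y + 1)"
    using \<kappa>(1) Zy by (intro eventually_at_right_less order_tendstoD(2)[OF tendsto_ident_at]) auto
  moreover have "\<forall>\<^sub>F \<epsilon>::real in at_right 0. 0 < \<epsilon>" by (rule eventually_at_right_less)
  ultimately have "\<forall>\<^sub>F \<epsilon> in at_right 0. \<epsilon> powr (p - 1) * (B ^ 3 * m) < v \<and> \<epsilon> < \<kappa> / (Z y + 1) \<and> 0 < \<epsilon>"
    by eventually_elim auto
  then obtain \<epsilon> where \<epsilon>: "\<epsilon> powr (p - 1) * (B ^ 3 * m) < v" "\<epsilon> < \<kappa> / (Z y + 1)" "0 < \<epsilon>"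
    using eventually_happens'[OF trivial_limit_at_right_real] by blast
  define z where "z x = u x - \<epsilon> * Z x - \<kappa>" for x
  have z: "C1_fun \<Omega> z (\<lambda>x. gu x - \<epsilon> *\<^sub>R gZ x)"
    unfolding z_def by (rule C1_fun_diff_const[OF u C1_fun_cmult[OF Z(1)]])
  have cz: "continuous_on \<Omega> z" by (rule C1_fun_cont[OF z])
  let ?K = "{x \<in> \<Omega>. 0 \<le> z x}"
  have zu: "z x \<le> u x - \<kappa>" if "x \<in> \<Omega>" for x using Z(2)[OF that] \<epsilon>(3) by (simp add: z_def)
  \<comment> \<open>Near \<open>0\<close> the domination of \<open>u\<close> by
    \<open>\<epsilon> * Z\<close> makes \<open>z\<close> negative; at the remaining boundary
    \<open>u\<close> is \<open>0\<close>, below the level \<open>\<kappa>\<close>.\<close>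
  have K: "compact ?K"
  proof -
    obtain r where r: "r > 0" "\<And>x. x \<in> \<Omega> \<Longrightarrow> norm x < r \<Longrightarrow> u x \<le> \<epsilon> * Z x" using dom[OF \<epsilon>(3)] by blast
    let ?C = "closure \<Omega> \<inter> {x. r \<le> norm x}"
    have "closed {x::real^'n. r \<le> norm x}" by (intro closed_Collect_le continuous_intros)
    then have K0: "compact ?C" using \<Omega>(2) by (simp add: compact_Int_closed compact_closure)
    have K0s: "?C \<subseteq> closure \<Omega> - {0}" using r(1) by auto
    have K1: "compact {x \<in> ?C. \<kappa> \<le> u x}" by (rule compact_superlevel[OF K0 continuous_on_subset[OF cu K0s]])
    have K1\<Omega>: "{x \<in> ?C. \<kappa> \<le> u x} \<subseteq> \<Omega>"
    proof (rule subsetI, rule ccontr)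
      fix x assume x: "x \<in> {x \<in> ?C. \<kappa> \<le> u x}" "x \<notin> \<Omega>"
      then have "x \<in> frontier \<Omega>" using \<Omega>(1) by (simp add: frontier_def interior_open)
      moreover have "x \<noteq> 0" using x(1) r(1) by auto
      ultimately show False using bdry[of x] x(1) \<kappa>(1) by auto
    qed
    have "compact {x \<in> {x \<in> ?C. \<kappa> \<le> u x}. 0 \<le> z x}"
      by (rule compact_superlevel[OF K1 continuous_on_subset[OF cz K1\<Omega>]])
    moreover have "{x \<in> {x \<in> ?C. \<kappa> \<le> u x}. 0 \<le> z x} = ?K"
    proof -
      have *: "r \<le> norm x \<and> \<kappa> \<le> u x" if x: "x \<in> \<Omega>" "0 \<le> z x" for x
      proof
        show "\<kappa> \<le> u x" using zu[OF x(1)] x(2) by linarith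
        show "r \<le> norm x"
        proof (rule ccontr)
          assume "\<not> r \<le> norm x"
          then have "u x \<le> \<epsilon> * Z x" using r(2)[OF x(1)] by simp
          then show False using x(2) \<kappa>(1) by (simp add: z_def)
        qed
      qed
      show ?thesis
      proof (rule set_eqI)
        show "x \<in> {x \<in> {x \<in> ?C. \<kappa> \<le> u x}. 0 \<le> z x} \<longleftrightarrow> x \<in> ?K" for x
          using *[of x] subsetD[OF K1\<Omega>, of x] subsetD[OF closure_subset, of x \<Omega>] by blast
      qed
    qed
    ultimately show ?thesis by simp
  qed
  have sub: "?K \<subseteq> \<Omega>" by auto
  let ?t = "\<lambda>x. \<epsilon> powr (p - 1) * trace (J x)"
  have F2: "weak_div_eq \<Omega> (\<lambda>x. pflux p (\<epsilon> *\<^sub>R gZ x)) ?t"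
    using weak_div_eq_scale[OF C1_field_weak_div_eq[OF F], of "\<epsilon> powr (p - 1)"] by (simp add: pflux_scale \<epsilon>(3))
  let ?f = "\<lambda>x. (norm (gu x) powr q - ?t x) * (max (z x) 0)\<^sup>2"
  have le0: "integral\<^sup>L lborel (\<lambda>x. indicator ?K x *\<^sub>R ?f x) \<le> 0"
    by (rule integral_weak_diff_le_0[OF eq F2 _ _ ch _ z K])
      (auto intro!: continuous_intros p cuO cgZ cJ pflux_monotone)
  define b where "b = \<epsilon> powr (p - 1) * B ^ 3"
  have b0: "b \<ge> 0" using B(1) by (simp add: b_def)
  \<comment> \<open>Only points with \<open>trace (J x) > 0\<close> matter; there \<open>B\<close>
    bounds the trace and also, because \<open>z x \<le> u x - \<kappa>\<close>, the truncated
    function.\<close>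
  have tb: "?t x * (max (z x) 0)\<^sup>2 \<le> b" if x: "x \<in> ?K" for x
  proof (cases "trace (J x) > 0")
    case True
    have xO: "x \<in> \<Omega>" using x by simp
    have "z x \<le> B" using B(2)[OF xO True] zu[OF xO] \<kappa>(1) by linarith
    then have "(max (z x) 0)\<^sup>2 \<le> B\<^sup>2" using x by (intro power_mono) auto
    then have "trace (J x) * (max (z x) 0)\<^sup>2 \<le> B * B\<^sup>2" using B(2)[OF xO True] True by (intro mult_mono) auto
    then have "\<epsilon> powr (p - 1) * (trace (J x) * (max (z x) 0)\<^sup>2) \<le> \<epsilon> powr (p - 1) * (B * B\<^sup>2)" by (intro mult_left_mono) auto
    then show ?thesis by (simp add: b_def mult.assoc power3_eq_cube power2_eq_square)
  next
    case False
    then have "?t x * (max (z x) 0)\<^sup>2 \<le> 0" by (intro mult_nonpos_nonneg mult_nonneg_nonpos) auto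
    then show ?thesis using b0 by linarith
  qed
  have cf: "continuous_on ?K ?f"
    by (intro continuous_intros continuous_on_subset[OF ch sub] continuous_on_subset[OF cJ sub] continuous_on_subset[OF cz sub])
  have zball: "\<kappa> \<le> z x" if x: "x \<in> cball x0 \<rho>" for x
  proof -
    have "\<epsilon> * Z x \<le> \<epsilon> * (Z y + 1)" using y(1)[OF x] \<epsilon>(3) by (intro mult_left_mono) auto
    also have "\<dots> \<le> \<kappa>" using \<epsilon>(2) Zy by (simp add: field_simps)
    finally have "\<epsilon> * Z x \<le> \<kappa>" .
    moreover have "3 * \<kappa> < u x" using \<rho>(2) x by auto
    ultimately show ?thesis by (simp add: z_def)
  qed
  \<comment> \<open>\<open>?f\<close> may be negative off the ball. Adding \<open>b\<close> makes
    the integrand nonnegative, so that the ball alone bounds the integral from below; the price is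
    \<open>b * measure lborel ?K\<close>, less than \<open>v\<close>.\<close>
  have "a * \<kappa>\<^sup>2 * measure lborel (cball x0 \<rho>) \<le> integral\<^sup>L lborel (\<lambda>x. indicator ?K x *\<^sub>R (?f x + b))"
  proof (rule integral_ge_on_cball[OF K])
    show "continuous_on ?K (\<lambda>x. ?f x + b)" by (intro continuous_on_add cf continuous_on_const)
    show "0 \<le> ?f x + b" if "x \<in> ?K" for x
    proof -
      have "0 \<le> norm (gu x) powr q * (max (z x) 0)\<^sup>2" by simp
      then show ?thesis using tb[OF that] unfolding left_diff_distrib by linarith
    qed
    show "cball x0 \<rho> \<subseteq> ?K" using zball \<rho>\<Omega> \<kappa>(1) by force
    fix x assume x: "x \<in> cball x0 \<rho>"
    then have xK: "x \<in> ?K" using zball[OF x] \<rho>\<Omega> \<kappa>(1) by auto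
    have "a \<le> norm (gu x) powr q" using \<rho>(2) x by auto
    moreover have "\<kappa>\<^sup>2 \<le> (max (z x) 0)\<^sup>2" using zball[OF x] \<kappa>(1) by (intro power_mono) auto
    ultimately have "a * \<kappa>\<^sup>2 \<le> norm (gu x) powr q * (max (z x) 0)\<^sup>2" using a(1) by (intro mult_mono) auto
    then show "a * \<kappa>\<^sup>2 \<le> ?f x + b" using tb[OF xK] unfolding left_diff_distrib by linarith
  qed
  also have "\<dots> = integral\<^sup>L lborel (\<lambda>x. indicator ?K x *\<^sub>R ?f x + b * indicator ?K x)"
    by (rule Bochner_Integration.integral_cong) (auto simp: algebra_simps)
  also have "\<dots> = integral\<^sup>L lborel (\<lambda>x. indicator ?K x *\<^sub>R ?f x) + b * measure lborel ?K"
  proof (subst Bochner_Integration.integral_add)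
    show "integrable lborel (\<lambda>x. indicator ?K x *\<^sub>R ?f x)" by (rule borel_integrable_compact[OF K cf])
    show "integrable lborel (\<lambda>x. b * indicator ?K x)"
      using K by (intro integrable_mult_right integrable_real_indicator emeasure_compact_finite) (auto intro: borel_compact)
  qed simp
  also have "\<dots> \<le> b * m"
  proof -
    have "measure lborel ?K \<le> m"
      unfolding m_def
      by (rule measure_mono_fmeasurable) (use R K in \<open>auto simp: fmeasurable_compact intro: borel_compact\<close>)
    then show ?thesis using le0 b0 mult_left_mono by fastforce
  qed
  also have "\<dots> < v" using \<epsilon>(1) by (simp add: b_def mult.assoc)
  finally show False by (simp add: v_def)
qed

section \<open>The cut-off barrier applied to a solution\<close>

context hemisphere_solution begin

text \<open>The condition on \<open>q\<close> yields \<open>p - 1 < q\<close> and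
  \<open>b < \<beta>\<close>, which leaves room for an exponent \<open>\<tau>\<close> between
  \<open>b\<close> and \<open>\<beta>\<close>: \<open>b < \<tau>\<close> makes every multiple of
  \<open>W\<close> dominate \<open>u\<close> near \<open>0\<close>, and
  \<open>\<tau> < \<beta>\<close> means \<open>\<theta> < 1\<close>.\<close>

lemma solution_gradient_eq_0:
  fixes \<Omega> :: "(real ^ 'n) set"
  assumes q: "q_star p \<beta> < q" "q < p"
    and \<Omega>: "open \<Omega>" "bounded \<Omega>" "C2_boundary \<Omega>" "0 \<in> frontier \<Omega>"
    and u: "C1_fun \<Omega> u gu" and eq: "weak_div_eq \<Omega> (\<lambda>x. pflux p (gu x)) (\<lambda>x. norm (gu x) powr q)"
    and cu: "continuous_on (closure \<Omega> - {0}) u" and bdry: "\<And>x. x \<in> frontier \<Omega> \<Longrightarrow> x \<noteq> 0 \<Longrightarrow> u x = 0"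
    and x0: "x0 \<in> \<Omega>" "u x0 > 0"
  shows "gu x0 = 0"
proof -
  have 0: "0 \<notin> \<Omega>" using \<Omega>(1,4) by (simp add: frontier_def interior_open)
  have qs: "p - q < \<beta> / (\<beta> + 1)" using q(1) by (simp add: q_star_def)
  moreover have "\<beta> / (\<beta> + 1) < 1" using \<beta> by simp
  ultimately have q1: "p - 1 < q" by linarith
  define b where "b = (p - q) / (q + 1 - p)"
  have b: "0 < b" using q q1 by (simp add: b_def)
  have "(p - q) * (\<beta> + 1) < \<beta>" using qs \<beta> by (simp add: pos_less_divide_eq)
  then have "p - q < \<beta> * (q + 1 - p)" by (simp add: algebra_simps)
  then have b\<beta>: "b < \<beta>" using q1 by (simp add: b_def pos_divide_less_eq)
  obtain C where C: "C > 0" "\<And>x. x \<in> \<Omega> \<Longrightarrow> u x \<le> C * norm x powr (- b)"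
    using singular_upper_bound[OF p q1 q(2) \<Omega>(1,2) 0 u eq cu bdry] unfolding b_def by blast
  \<comment> \<open>Puts \<open>\<tau> = \<theta> * \<beta>\<close> halfway between \<open>b\<close>
    and \<open>\<beta>\<close>.\<close>
  define \<theta> where "\<theta> = (b + \<beta>) / (2 * \<beta>)"
  define \<tau> where "\<tau> = \<theta> * \<beta>"
  have \<tau>_eq: "\<tau> = (b + \<beta>) / 2" using \<beta> by (simp add: \<tau>_def \<theta>_def)
  have \<tau>': "- \<theta> * \<beta> = - \<tau>" by (simp add: \<tau>_def)
  have \<theta>: "0 < \<theta>" "\<theta> < 1" using b b\<beta> \<beta> by (simp_all add: \<theta>_def)
  have \<tau>: "b < \<tau>" "0 < \<tau>" using b b\<beta> by (simp_all add: \<tau>_eq)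
  obtain \<nu> :: "real ^ 'n" where \<nu>: "norm \<nu> = 1" "\<And>\<delta>. \<delta> > 0 \<Longrightarrow> \<exists>r>0. \<forall>x\<in>\<Omega>. norm x < r \<longrightarrow> - \<delta> * norm x < x \<bullet> \<nu>"
    using boundary_cone[OF \<Omega>(1,3,4)] by blast
  obtain \<delta> c W gW MW L0 where \<delta>: "\<delta> > 0" and c: "c > 0"
    and W: "C2_fun {x. - \<delta> * norm x < x \<bullet> \<nu>} W gW MW"
    and gW0: "\<And>x. - \<delta> * norm x < x \<bullet> \<nu> \<Longrightarrow> gW x \<noteq> 0"
    and plW: "\<And>x. - \<delta> * norm x < x \<bullet> \<nu> \<Longrightarrow> plap p (gW x) (MW x) \<le> 0"
    and Wlow: "\<And>x. - \<delta> * norm x < x \<bullet> \<nu> \<Longrightarrow> c * norm x powr (- \<tau>) \<le> W x"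
    and Wup0: "\<And>x. - \<delta> * norm x < x \<bullet> \<nu> \<Longrightarrow> W x \<le> L0 * norm x powr (- \<tau>)"
    and gWup0: "\<And>x. - \<delta> * norm x < x \<bullet> \<nu> \<Longrightarrow> norm (gW x) \<le> L0 * norm x powr (- \<tau> - 1)"
  proof (rule barrier[OF \<nu>(1) \<theta>, unfolded \<tau>'], goal_cases)
    case (1 \<delta> c W gW MW L0)
    show ?case by (rule 1(1)[OF 1(2-)])
  qed
  define L where "L = max L0 1"
  have L: "L > 0" "L0 \<le> L" by (auto simp: L_def)
  obtain r where r: "r > 0" "\<And>x. x \<in> \<Omega> \<Longrightarrow> norm x < r \<Longrightarrow> - \<delta> * norm x < x \<bullet> \<nu>"
    using \<nu>(2)[OF \<delta>] by blast
  \<comment> \<open>An upper bound for \<open>W\<close> at points of \<open>E\<close> with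
    \<open>norm x > r / 2\<close>: on the overlap of \<open>E\<close> and \<open>A\<close> the
    cut-off function and its flux vanish, so both extend by zero to \<open>\<Omega>\<close>.\<close>
  define l where "l = L * (r / 2) powr (- \<tau>)"
  have l: "l > 0" using L r(1) by (simp add: l_def)
  obtain h k G G' where
    dh: "\<And>s. 0 < s \<Longrightarrow> (h has_real_derivative k s) (at s)" and ck: "continuous_on UNIV k"
    and dG: "\<And>s. (G has_real_derivative G' s) (at s)" and cG': "continuous_on UNIV G'"
    and k0: "\<And>s. 0 \<le> k s" and Gk: "\<And>s. G s = k s powr (p - 1)"
    and low: "\<And>s. s \<le> l \<Longrightarrow> h s = 0 \<and> k s = 0 \<and> G s = 0 \<and> G' s = 0"
    and h0: "\<And>s. 0 \<le> h s" and hlow: "\<And>s. s - l - 1 \<le> h s"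
    and G'4: "\<And>s. G' s \<le> 4" and high: "\<And>s. l + 1 \<le> s \<Longrightarrow> G' s = 0"
  proof (rule cutoff_functions[OF p l], goal_cases)
    case (1 h k G G')
    show ?case by (rule 1(1)[OF 1(2-)])
  qed
  define E where "E = \<Omega> \<inter> ball 0 r"
  define A where "A = \<Omega> \<inter> {x. r / 2 < norm x}"
  have EA: "E \<union> A = \<Omega>" using r(1) by (auto simp: E_def A_def)
  have Eopen: "open E" unfolding E_def using \<Omega>(1) by (intro open_Int) auto
  have Aopen: "open A" unfolding A_def by (intro open_Int \<Omega>(1) open_Collect_less continuous_intros)
  have Econe: "- \<delta> * norm x < x \<bullet> \<nu>" if "x \<in> E" for x using r(2) that by (simp add: E_def)
  have En: "norm x > 0" if "x \<in> E" for x using that 0 by (auto simp: E_def)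
  have WE: "C2_fun E W gW MW" by (rule C2_fun_subset[OF W Eopen]) (use Econe in auto)
  have gWup: "norm (gW x) \<le> L * norm x powr (- \<tau> - 1)" if "x \<in> E" for x
    using gWup0[OF Econe[OF that]] mult_right_mono[OF L(2) powr_ge_zero[of "norm x" "- \<tau> - 1"]] by linarith
  have Wup: "W x \<le> L * norm x powr (- \<tau>)" if "x \<in> E" for x
    using Wup0[OF Econe[OF that]] mult_right_mono[OF L(2) powr_ge_zero[of "norm x" "- \<tau>"]] by linarith
  have Wpos: "W x > 0" if "x \<in> E" for x
  proof -
    have "0 < c * norm x powr (- \<tau>)" using c En[OF that] by simp
    then show ?thesis using Wlow[OF Econe[OF that]] by linarith
  qed
  have Wl: "W x \<le> l" if "x \<in> E \<inter> A" for x
  proof -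
    have "norm x powr (- \<tau>) \<le> (r / 2) powr (- \<tau>)"
      using that r(1) \<tau> by (intro powr_mono2') (auto simp: A_def)
    then have "L * norm x powr (- \<tau>) \<le> l" unfolding l_def using L by (intro mult_left_mono) auto
    then show ?thesis using Wup[of x] that by simp
  qed
  have cW: "continuous_on E W" "continuous_on E gW" by (rule C2_funD[OF WE])+
  obtain Jw where Jw: "C1_field E (\<lambda>x. pflux p (gW x)) Jw"
    "\<And>x. x \<in> E \<Longrightarrow> trace (Jw x) = norm (gW x) powr (p - 4) * plap p (gW x) (MW x)"
    using C1_field_pflux[OF WE] gW0 Econe by blast
  have Z0: "C1_fun E (\<lambda>x. h (W x)) (\<lambda>x. k (W x) *\<^sub>R gW x)"
    unfolding C1_fun_def
  proof (intro conjI ballI)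
    show "continuous_on E (\<lambda>x. k (W x) *\<^sub>R gW x)"
      by (intro continuous_intros cW continuous_on_compose2[OF ck]) auto
    fix x assume x: "x \<in> E"
    show "((\<lambda>x. h (W x)) has_derivative (\<lambda>y. k (W x) *\<^sub>R gW x \<bullet> y)) (at x)"
      using has_derivative_compose[OF C2_funD(5)[OF WE x], of h "\<lambda>y. k (W x) * y"] dh[OF Wpos[OF x]]
      by (simp add: has_field_derivative_def)
  qed (rule Eopen)
  define Z where "Z x = (if x \<in> E then h (W x) else 0)" for x
  define gZ where "gZ x = (if x \<in> E then k (W x) *\<^sub>R gW x else 0)" for x
  have Z: "C1_fun \<Omega> Z gZ"
    using C1_fun_glue_zero[OF Z0 Aopen] Wl low unfolding EA Z_def[abs_def] gZ_def[abs_def] by simp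
  define J0 where "J0 x = G (W x) *\<^sub>R Jw x + G' (W x) *\<^sub>R outer (pflux p (gW x)) (gW x)" for x
  have F0: "C1_field E (\<lambda>x. G (W x) *\<^sub>R pflux p (gW x)) J0"
    unfolding C1_field_def
  proof (intro conjI ballI)
    have cG: "continuous_on UNIV G" using dG DERIV_isCont continuous_at_imp_continuous_on by blast
    have cJw: "continuous_on E Jw" using Jw(1) by (simp add: C1_field_def)
    show "continuous_on E J0" unfolding J0_def
      by (intro continuous_intros cW cJw p continuous_on_compose2[OF cG] continuous_on_compose2[OF cG']) auto
    fix x assume x: "x \<in> E"
    have 1: "((\<lambda>x. G (W x)) has_derivative (\<lambda>y. G' (W x) * (gW x \<bullet> y))) (at x)"
      using has_derivative_compose[OF C2_funD(5)[OF WE x], of G "\<lambda>y. G' (W x) * y"] dG[of "W x"]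
      by (simp add: has_field_derivative_def)
    have 2: "((\<lambda>x. pflux p (gW x)) has_derivative (\<lambda>y. Jw x *v y)) (at x)" using Jw(1) x by (simp add: C1_field_def)
    show "((\<lambda>x. G (W x) *\<^sub>R pflux p (gW x)) has_derivative (\<lambda>y. J0 x *v y)) (at x)"
      using has_derivative_scaleR[OF 1 2] by (rule has_derivative_eq_rhs) (simp add: J0_def mat_simps fun_eq_iff)
  qed (rule Eopen)
  define J where "J x = (if x \<in> E then J0 x else 0)" for x
  have flux: "pflux p (gZ x) = (if x \<in> E then G (W x) *\<^sub>R pflux p (gW x) else 0)" for x
  proof (cases "x \<in> E \<and> k (W x) \<noteq> 0")
    case True
    then have "k (W x) > 0" using k0[of "W x"] by linarith
    then show ?thesis using True by (simp add: gZ_def pflux_scale Gk)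
  qed (auto simp: gZ_def Gk pflux_def)
  have F: "C1_field \<Omega> (\<lambda>x. pflux p (gZ x)) J"
    using C1_field_glue_zero[OF F0 Aopen] Wl low unfolding EA J_def[abs_def] flux by (simp add: J0_def)
  define Y where "Y = (l + 1) / c"
  have Y: "Y > 0" using l c by (simp add: Y_def)
  \<comment> \<open>The radius at which the lower bound \<open>c * norm x powr (- \<tau>)\<close>
    for \<open>W\<close> equals \<open>l + 1\<close>; the zone \<open>W x < l + 1\<close> therefore
    lies in \<open>norm x \<ge> \<rho>\<close>.\<close>
  define \<rho> where "\<rho> = Y powr (- 1 / \<tau>)"
  have \<rho>: "\<rho> > 0" "\<rho> powr (- \<tau>) = Y" using Y \<tau> by (simp_all add: \<rho>_def powr_powr)
  define L1 where "L1 = L * \<rho> powr (- \<tau> - 1)"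
  define B where "B = max (C * \<rho> powr (- b)) (4 * (L1 powr (p - 1) * L1))"
  have B0: "0 \<le> B" using C(1) by (simp add: B_def le_max_iff_disj)
  have B: "u x \<le> B \<and> trace (J x) \<le> B" if x: "x \<in> \<Omega>" "trace (J x) > 0" for x
  proof -
    have xE: "x \<in> E" using x(2) by (auto simp: J_def trace_def split: if_splits)
    have tJ: "trace (J x) = G (W x) * trace (Jw x) + G' (W x) * (pflux p (gW x) \<bullet> gW x)"
      using xE by (simp add: J_def J0_def mat_simps)
    \<comment> \<open>By superharmonicity of \<open>W\<close> only the term with \<open>G'\<close>
      can make the trace positive, and that term lives in the transition zone, away from
      \<open>0\<close>, where the bounds are uniform.\<close>
    have "trace (Jw x) \<le> 0" unfolding Jw(2)[OF xE] using plW[OF Econe[OF xE]] by (simp add: mult_nonneg_nonpos)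
    then have "G (W x) * trace (Jw x) \<le> 0" by (simp add: Gk mult_nonneg_nonpos)
    then have tJle: "trace (J x) \<le> G' (W x) * (pflux p (gW x) \<bullet> gW x)" using tJ by linarith
    have flux_nn: "0 \<le> pflux p (gW x) \<bullet> gW x" by (simp add: pflux_def)
    have "G' (W x) \<noteq> 0" using tJle x(2) by auto
    then have "W x < l + 1" using high[of "W x"] by linarith
    then have "c * norm x powr (- \<tau>) < l + 1" using Wlow[OF Econe[OF xE]] by linarith
    then have nY: "norm x powr (- \<tau>) < \<rho> powr (- \<tau>)" unfolding \<rho>(2) using c by (simp add: Y_def pos_less_divide_eq mult.commute)
    have n\<rho>: "\<rho> \<le> norm x"
    proof (rule ccontr)
      assume "\<not> \<rho> \<le> norm x"
      then have "\<rho> powr (- \<tau>) \<le> norm x powr (- \<tau>)" using En[OF xE] \<tau> by (intro powr_mono2') auto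
      then show False using nY by linarith
    qed
    have "u x \<le> C * norm x powr (- b)" by (rule C(2)[OF x(1)])
    also have "\<dots> \<le> C * \<rho> powr (- b)" using C(1) b n\<rho> \<rho>(1) by (intro mult_left_mono powr_mono2') auto
    finally have "u x \<le> B" by (simp add: B_def)
    moreover have "trace (J x) \<le> B"
    proof -
      have "norm (gW x) \<le> L * norm x powr (- \<tau> - 1)" by (rule gWup[OF xE])
      also have "\<dots> \<le> L1" unfolding L1_def using L \<tau> n\<rho> \<rho>(1) by (intro mult_left_mono powr_mono2') auto
      finally have gL: "norm (gW x) \<le> L1" .
      have "pflux p (gW x) \<bullet> gW x \<le> norm (pflux p (gW x)) * norm (gW x)" by (rule norm_cauchy_schwarz)
      also have "\<dots> \<le> L1 powr (p - 1) * L1"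
        unfolding norm_pflux using gL p by (intro mult_mono powr_mono2) auto
      finally have "pflux p (gW x) \<bullet> gW x \<le> L1 powr (p - 1) * L1" .
      moreover have "G' (W x) * (pflux p (gW x) \<bullet> gW x) \<le> 4 * (pflux p (gW x) \<bullet> gW x)"
        by (rule mult_right_mono[OF G'4 flux_nn])
      ultimately show ?thesis using tJle by (simp add: B_def le_max_iff_disj)
    qed
    ultimately show ?thesis ..
  qed
  have dom: "\<exists>r'>0. \<forall>x\<in>\<Omega>. norm x < r' \<longrightarrow> u x \<le> \<epsilon> * Z x" if \<epsilon>: "0 < \<epsilon>" for \<epsilon>
  proof -
    \<comment> \<open>Once \<open>norm x powr (- (\<tau> - b))\<close> reaches \<open>X\<close>, the
      bound \<open>C * norm x powr (- b)\<close> for \<open>u\<close> is at most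
      \<open>\<epsilon> * (W x - l - 1)\<close>. Requiring \<open>norm x < 1\<close> as well lets
      the constant \<open>l + 1\<close> be absorbed into a multiple of
      \<open>norm x powr (- b)\<close>.\<close>
    define X where "X = (C + \<epsilon> * (l + 1)) / (\<epsilon> * c)"
    have X: "X > 0" using C(1) \<epsilon> l c by (simp add: X_def add_pos_pos)
    define r1 where "r1 = X powr (- 1 / (\<tau> - b))"
    have "- 1 / (\<tau> - b) * - (\<tau> - b) = 1" using \<tau>(1) by (simp add: field_simps)
    then have r1: "r1 > 0" "r1 powr (- (\<tau> - b)) = X" using X unfolding r1_def powr_powr by simp_all
    show ?thesis
    proof (intro exI[of _ "min r (min 1 r1)"] conjI ballI impI)
      show "0 < min r (min 1 r1)" using r(1) r1(1) by simp
      fix x assume x: "x \<in> \<Omega>" "norm x < min r (min 1 r1)"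
      then have xE: "x \<in> E" by (simp add: E_def)
      define t where "t = norm x"
      have t: "0 < t" "t \<le> 1" "t \<le> r1" using En[OF xE] x(2) by (auto simp: t_def)
      have "1 powr (- b) \<le> t powr (- b)" using t b by (intro powr_mono2') auto
      then have tb: "1 \<le> t powr (- b)" by simp
      have "X \<le> t powr (- (\<tau> - b))" unfolding r1(2)[symmetric] using t \<tau> by (intro powr_mono2') auto
      then have "\<epsilon> * c * X \<le> \<epsilon> * c * t powr (- (\<tau> - b))" using \<epsilon> c by (intro mult_left_mono) auto
      then have "C + \<epsilon> * (l + 1) \<le> \<epsilon> * c * t powr (- (\<tau> - b))" using \<epsilon> c by (simp add: X_def)
      then have "t powr (- b) * (C + \<epsilon> * (l + 1)) \<le> t powr (- b) * (\<epsilon> * c * t powr (- (\<tau> - b)))" by (intro mult_left_mono) auto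
      also have "\<dots> = \<epsilon> * (c * t powr (- \<tau>))"
        using powr_add[of t "- b" "- (\<tau> - b)"] by (simp add: mult_ac)
      also have "\<dots> \<le> \<epsilon> * W x" using Wlow[OF Econe[OF xE]] \<epsilon> by (intro mult_left_mono) (auto simp: t_def)
      finally have 1: "C * t powr (- b) + t powr (- b) * (\<epsilon> * (l + 1)) \<le> \<epsilon> * W x" by (simp add: algebra_simps)
      have "1 * (\<epsilon> * (l + 1)) \<le> t powr (- b) * (\<epsilon> * (l + 1))" using tb \<epsilon> l by (intro mult_right_mono) auto
      then have "C * t powr (- b) \<le> \<epsilon> * (W x - l - 1)" using 1 by (simp add: algebra_simps)
      also have "\<dots> \<le> \<epsilon> * Z x" using hlow[of "W x"] \<epsilon> xE by (intro mult_left_mono) (auto simp: Z_def)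
      finally show "u x \<le> \<epsilon> * Z x" using C(2)[OF x(1)] by (simp add: t_def)
    qed
  qed
  have Znn: "0 \<le> Z x" for x by (simp add: Z_def h0)
  have q0: "0 < q" using p q1 by linarith
  show ?thesis
    by (rule gradient_eq_0_of_singular_supersolution[OF p q0 \<Omega>(1,2) 0 u eq cu bdry Z Znn F B0 B dom x0])
qed

end

theorem theorem3p4:
  fixes p q \<beta> :: real
    and k :: "'n::finite"
    and \<Omega> :: "(real ^ 'n) set"
    and u :: "real ^ 'n \<Rightarrow> real"
  assumes "CARD('n) \<ge> 2"
    and "1 < p" and "p \<le> real CARD('n)"
    and "is_beta_star k p \<beta>"
    and "q_star p \<beta> < q" and "q < p"
    and "C2_bounded_domain \<Omega>"
    and "0 \<in> frontier \<Omega>"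
    and "weak_solution p q \<Omega> u"
    and "\<forall>x\<in>\<Omega>. u x \<ge> 0"
    and "Ck_upto 1 \<Omega> (closure \<Omega> - {0}) u"
    and "\<forall>x\<in>frontier \<Omega> - {0}. u x = 0"
  shows "\<forall>x\<in>closure \<Omega> - {0}. u x = 0"
proof -
  obtain \<psi> where "hemisphere_solution k p \<beta> \<psi>"
    using assms(2,4) unfolding is_beta_star_def hemisphere_solution_def by blast
  then interpret hemisphere_solution k p \<beta> \<psi> .
  have \<Omega>: "open \<Omega>" "connected \<Omega>" "\<Omega> \<noteq> {}" "bounded \<Omega>" "C2_boundary \<Omega>"
    using assms(7) by (auto simp: C2_bounded_domain_def)
  have 0: "0 \<notin> \<Omega>" using \<Omega>(1) assms(8) by (simp add: frontier_def interior_open)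
  have u: "C1_fun \<Omega> u (grad u)"
    using Ck_upto_1_C1_fun[of \<Omega> \<Omega> u] assms(9) \<Omega>(1) by (simp add: weak_solution_def)
  have cu: "continuous_on (closure \<Omega> - {0}) u" using assms(11) by (simp add: Ck_upto_def)
  have bdry: "\<And>x. x \<in> frontier \<Omega> \<Longrightarrow> x \<noteq> 0 \<Longrightarrow> u x = 0" using assms(12) by auto
  have du: "(u has_derivative (\<lambda>h. grad u x \<bullet> h)) (at x)" if "x \<in> \<Omega>" for x
    using u that by (simp add: C1_fun_def)
  have d0: "(u has_derivative (\<lambda>h. 0)) (at x)" if x: "x \<in> \<Omega>" for x
  proof (cases "u x > 0")
    case True
    have "grad u x = 0"
      by (rule solution_gradient_eq_0[OF assms(5,6) \<Omega>(1,4,5) assms(8) u weak_solution_weak_div_eq[OF assms(9)] cu bdry x True])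
    then show ?thesis using du[OF x] by simp
  next
    case False
    \<comment> \<open>At such a point \<open>u\<close> is \<open>0\<close>, a minimum by
      nonnegativity, so the gradient vanishes there too.\<close>
    then have "u x \<le> u y" if "y \<in> \<Omega>" for y using assms(10) x that by force
    then have "(\<lambda>h. grad u x \<bullet> h) = (\<lambda>h. 0)"
      by (intro differential_zero_maxmin[OF x \<Omega>(1) du[OF x]]) auto
    then show ?thesis using du[OF x] by simp
  qed
  obtain K where K: "\<And>x. x \<in> \<Omega> \<Longrightarrow> u x = K"
  proof -
    have "u constant_on \<Omega>"
      by (rule has_derivative_zero_connected_constant_on[OF \<Omega>(2,1) finite.emptyI C1_fun_cont[OF u]])
        (use d0 has_derivative_at_withinI in blast)
    then show ?thesis using that by (auto simp: constant_on_def)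
  qed
  have K': "u x = K" if x: "x \<in> closure \<Omega> - {0}" for x
  proof -
    obtain f where f: "\<And>n. f n \<in> \<Omega>" "f \<longlonglongrightarrow> x" using x closure_sequential by blast
    have "f n \<in> closure \<Omega> - {0}" for n using subsetD[OF closure_subset f(1)[of n]] f(1)[of n] 0 by force
    then have "(\<lambda>n. u (f n)) \<longlonglongrightarrow> u x"
      by (intro continuous_on_tendsto_compose[OF cu f(2) x] always_eventually) blast
    then show ?thesis using f(1) K by (simp add: LIMSEQ_const_iff)
  qed
  \<comment> \<open>In dimension at least 2 the punctured space is connected; it meets the bounded
    set \<open>\<Omega>\<close> and its complement, so there is a boundary point other than
    \<open>0\<close>, and the boundary condition there fixes the constant.\<close>
  have "frontier \<Omega> \<inter> (- {0}) \<noteq> {}"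
  proof -
    have "connected (- {0 :: real ^ 'n})" using assms(1) by (intro connected_punctured_universe) simp
    moreover have "- {0} \<inter> \<Omega> \<noteq> {}"
    proof -
      obtain x where "x \<in> \<Omega>" using \<Omega>(3) by blast
      moreover from this have "x \<noteq> 0" using 0 by metis
      ultimately show ?thesis by blast
    qed
    moreover have "- {0} - \<Omega> \<noteq> {}"
    proof
      assume "- {0} - \<Omega> = {}"
      then have "UNIV \<subseteq> insert 0 \<Omega>" by auto
      then have "bounded (UNIV :: (real ^ 'n) set)" using \<Omega>(4) bounded_subset bounded_insert by blast
      then show False by simp
    qed
    ultimately show ?thesis using connected_Int_frontier[of "- {0}" \<Omega>] by blast
  qed
  then obtain y where "y \<in> frontier \<Omega>" "y \<noteq> 0" by auto
  then have "K = 0" using K'[of y] bdry[of y] by (simp add: frontier_def)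
  then show ?thesis using K' by auto
qed

end
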